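(* Suppose that the following three conditions hold. (A1) There exists an increasing sequence of nonempty finite subsets $\{V_m\}_{m=0}^\infty$ of $K$ such that: (i) for each $m$, $K\setminus V_m$ is decomposed into finitely many connected components $\{U_\lambda\}_{\lambda\in\Lambda_m}$; (ii) for every $x\in K$, the sets $\Bigl\{\bigcup_{\lambda\in\Lambda_m;\,x\in\overline{U_\lambda}}\overline{U_\lambda}\Bigr\}_{m=0}^\infty$ constitute a fundamental system of neighborhoods of $x$. (A2) $\mathcal F\subset C(K)$. (A3) $\mathcal E(f,f)=0$ if and only if $f$ is a constant function. Then $\rho_{\boldsymbol h}(x,y)\le \mathsf d_{\boldsymbol h}(x,y)$ for all $x,y\in K$.
   Context: Let $K$ be a compact metrizable space, $\mu$ a finite Borel measure on $K$ with full support, $C(K)$ the space of real-valued continuous functions on $K$, and $(\mathcal E,\mathcal F)$ a strong local regular symmetric Dirichlet form on $L^2(K,\mu)$. For $f\in\mathcal F$, $\mu_{\langle f\rangle}$ denotes the energy measure of $f$: for bounded $f$ it is characterized by $\int_K\varphi\,d\mu_{\langle f\rangle}=2\mathcal E(f,f\varphi)-\mathcal E(f^2,\varphi)$ for all $\varphi\in\mathcal F\cap C(K)$, and for general $f\in\mathcal F$ it is defined by the natural approximation. Let $N\in\mathbb N$ and $\boldsymbol h=(h_1,\dots,h_N)$ with $h_j\in\mathcal F\cap C(K)$ for every $j$; put $\mu_{\langle\boldsymbol h\rangle}=\sum_{j=1}^N\mu_{\langle h_j\rangle}$. The intrinsic distance is $$\mathsf d_{\boldsymbol h}(x,y)=\sup\{f(y)-f(x)\mid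 f\in\mathcal F\cap C(K),\ \mu_{\langle f\rangle}\le\mu_{\langle\boldsymbol h\rangle}\},\quad x,y\in K.$$ For a continuous curve $\gamma\in C([s,t]\to K)$, its length is $$\ell_{\boldsymbol h}(\gamma)=\sup\Bigl\{\sum_{i=1}^n|\boldsymbol h(\gamma(t_i))-\boldsymbol h(\gamma(t_{i-1}))|_{\mathbb R^N}\Bigm| n\in\mathbb N,\ s=t_0<t_1<\dots<t_n=t\Bigr\}$$ with $|\cdot|_{\mathbb R^N}$ the Euclidean norm. The geodesic distance is $$\rho_{\boldsymbol h}(x,y)=\inf\{\ell_{\boldsymbol h}(\gamma)\mid\gamma\in C([0,1]\to K),\ \gamma(0)=x,\ \gamma(1)=y\},\quad x,y\in K,$$ where $\inf\emptyset=\infty$. Both take values in $[0,\infty]$. When $\mathcal F\subset C(K)$, every element of $\mathcal F$ is identified with its continuous version. *)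

theory Defs
  imports "HOL-Analysis.Analysis"
begin

section \<open>Dirichlet forms\<close>

text \<open>
  Elements of \<open>L\<^sup>2(K, \<mu>)\<close> are represented by functions rather than by equivalence classes.
  Accordingly, the domain of a form is a set of functions that is saturated under equality
  almost everywhere, and the form does not depend on the representative.
\<close>

definition L2 :: "'a measure \<Rightarrow> ('a \<Rightarrow> real) set" where
  "L2 M = {f \<in> borel_measurable M. integrable M (\<lambda>x. (f x)\<^sup>2)}"

text \<open>The squared norm \<open>\<E>\<^sub>1(f, f) = \<E>(f, f) + \<parallel>f\<parallel>\<^sup>2\<close> on the domain of a form.\<close>

definition form_norm1 :: "'a measure \<Rightarrow> (('a \<Rightarrow> real) \<Rightarrow> ('a \<Rightarrow> real) \<Rightarrow> real) \<Rightarrow> ('a \<Rightarrow> real) \<Rightarrow> real"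
  where "form_norm1 M E f = E f f + (\<integral>x. (f x)\<^sup>2 \<partial>M)"

locale dirichlet_form =
  fixes M :: "'a measure"
    and E :: "('a \<Rightarrow> real) \<Rightarrow> ('a \<Rightarrow> real) \<Rightarrow> real"
    and F :: "('a \<Rightarrow> real) set"
  assumes domain_L2: "F \<subseteq> L2 M"
    and domain_AE: "\<lbrakk>f \<in> F; g \<in> borel_measurable M; AE x in M. f x = g x\<rbrakk> \<Longrightarrow> g \<in> F"
    and form_AE: "\<lbrakk>f \<in> F; g \<in> F; u \<in> F; AE x in M. f x = g x\<rbrakk> \<Longrightarrow> E f u = E g u"
    and domain_zero: "(\<lambda>x. 0) \<in> F"
    and domain_add: "\<lbrakk>f \<in> F; g \<in> F\<rbrakk> \<Longrightarrow> (\<lambda>x. f x + g x) \<in> F"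
    and domain_scale: "f \<in> F \<Longrightarrow> (\<lambda>x. c * f x) \<in> F"
    and domain_dense: "\<lbrakk>f \<in> L2 M; e > 0\<rbrakk> \<Longrightarrow> \<exists>g\<in>F. (\<integral>x. (f x - g x)\<^sup>2 \<partial>M) < e"
    and form_add: "\<lbrakk>f \<in> F; g \<in> F; u \<in> F\<rbrakk> \<Longrightarrow> E (\<lambda>x. f x + g x) u = E f u + E g u"
    and form_scale: "\<lbrakk>f \<in> F; u \<in> F\<rbrakk> \<Longrightarrow> E (\<lambda>x. c * f x) u = c * E f u"
    and form_sym: "\<lbrakk>f \<in> F; g \<in> F\<rbrakk> \<Longrightarrow> E f g = E g f"
    and form_nonneg: "f \<in> F \<Longrightarrow> E f f \<ge> 0"
    and form_closed:
      "\<lbrakk>\<And>n. w n \<in> F;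
        \<And>e. e > 0 \<Longrightarrow> \<exists>n0. \<forall>m\<ge>n0. \<forall>n\<ge>n0. form_norm1 M E (\<lambda>x. w m x - w n x) < e\<rbrakk>
       \<Longrightarrow> \<exists>v\<in>F. (\<lambda>n. form_norm1 M E (\<lambda>x. w n x - v x)) \<longlonglongrightarrow> 0"
    and markov_domain: "f \<in> F \<Longrightarrow> (\<lambda>x. min 1 (max 0 (f x))) \<in> F"
    and markov_form:
      "f \<in> F \<Longrightarrow> E (\<lambda>x. min 1 (max 0 (f x))) (\<lambda>x. min 1 (max 0 (f x))) \<le> E f f"

text \<open>Regularity is stated for a compact space, where \<open>C\<^sub>0(K) = C(K)\<close>.\<close>

definition regular_form ::
    "'a::topological_space measure \<Rightarrow> (('a \<Rightarrow> real) \<Rightarrow> ('a \<Rightarrow> real) \<Rightarrow> real) \<Rightarrow> ('a \<Rightarrow> real) set \<Rightarrow> bool"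
  where "regular_form M E F \<longleftrightarrow>
    (\<forall>f\<in>F. \<forall>e>0. \<exists>g\<in>F. continuous_on UNIV g \<and> form_norm1 M E (\<lambda>x. f x - g x) < e) \<and>
    (\<forall>f e. continuous_on UNIV f \<and> e > 0 \<longrightarrow>
       (\<exists>g\<in>F. continuous_on UNIV g \<and> (\<forall>x. \<bar>f x - g x\<bar> < e)))"

text \<open>The support of the measure \<open>\<bar>f\<bar> d\<mu>\<close>.\<close>

definition supp :: "'a::topological_space measure \<Rightarrow> ('a \<Rightarrow> real) \<Rightarrow> 'a set" where
  "supp M f = - \<Union>{U. open U \<and> (AE x in M. x \<in> U \<longrightarrow> f x = 0)}"

definition strong_local ::
    "'a::topological_space measure \<Rightarrow> (('a \<Rightarrow> real) \<Rightarrow> ('a \<Rightarrow> real) \<Rightarrow> real) \<Rightarrow> ('a \<Rightarrow> real) set \<Rightarrow> bool"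
  where "strong_local M E F \<longleftrightarrow>
    (\<forall>f\<in>F. \<forall>g\<in>F. compact (supp M f) \<and> compact (supp M g) \<and>
       (\<exists>U c. open U \<and> supp M f \<subseteq> U \<and> (AE x in M. x \<in> U \<longrightarrow> g x = c)) \<longrightarrow> E f g = 0)"

definition full_support :: "'a::topological_space measure \<Rightarrow> bool" where
  "full_support M \<longleftrightarrow> (\<forall>U. open U \<and> U \<noteq> {} \<longrightarrow> emeasure M U > 0)"

section \<open>Energy measures\<close>

definition energy_measure_bounded ::
    "(('a::topological_space \<Rightarrow> real) \<Rightarrow> ('a \<Rightarrow> real) \<Rightarrow> real) \<Rightarrow> ('a \<Rightarrow> real) set \<Rightarrow> ('a \<Rightarrow> real) \<Rightarrow> 'a measure"
  where "energy_measure_bounded E F f = (THE \<nu>. sets \<nu> = sets borel \<and> finite_measure \<nu> \<and>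
    (\<forall>\<phi>\<in>F. continuous_on UNIV \<phi> \<longrightarrow>
      (\<integral>x. \<phi> x \<partial>\<nu>) = 2 * E f (\<lambda>x. f x * \<phi> x) - E (\<lambda>x. (f x)\<^sup>2) \<phi>))"

definition truncate :: "nat \<Rightarrow> ('a \<Rightarrow> real) \<Rightarrow> 'a \<Rightarrow> real" where
  "truncate n f = (\<lambda>x. max (- real n) (min (real n) (f x)))"

text \<open>For unbounded \<open>f\<close>, the energy measure is the setwise limit of those of the truncations of \<open>f\<close>.\<close>

definition energy_measure ::
    "'a::topological_space measure \<Rightarrow> (('a \<Rightarrow> real) \<Rightarrow> ('a \<Rightarrow> real) \<Rightarrow> real) \<Rightarrow> ('a \<Rightarrow> real) set
      \<Rightarrow> ('a \<Rightarrow> real) \<Rightarrow> 'a measure"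
  where "energy_measure M E F f =
    (if \<exists>C. AE x in M. \<bar>f x\<bar> \<le> C then energy_measure_bounded E F f
     else (THE \<nu>. sets \<nu> = sets borel \<and> finite_measure \<nu> \<and>
       (\<forall>B\<in>sets borel.
         (\<lambda>n. measure (energy_measure_bounded E F (truncate n f)) B) \<longlonglongrightarrow> measure \<nu> B)))"

definition energy_measure_vec ::
    "'a::topological_space measure \<Rightarrow> (('a \<Rightarrow> real) \<Rightarrow> ('a \<Rightarrow> real) \<Rightarrow> real) \<Rightarrow> ('a \<Rightarrow> real) set
      \<Rightarrow> ('a \<Rightarrow> real ^ 'n) \<Rightarrow> 'a measure"
  where "energy_measure_vec M E F h =
    measure_of UNIV (sets borel) (\<lambda>B. \<Sum>j\<in>UNIV. emeasure (energy_measure M E F (\<lambda>x. h x $ j)) B)"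

section \<open>Intrinsic and geodesic distances\<close>

definition intrinsic_dist ::
    "'a::topological_space measure \<Rightarrow> (('a \<Rightarrow> real) \<Rightarrow> ('a \<Rightarrow> real) \<Rightarrow> real) \<Rightarrow> ('a \<Rightarrow> real) set
      \<Rightarrow> ('a \<Rightarrow> real ^ 'n) \<Rightarrow> 'a \<Rightarrow> 'a \<Rightarrow> ereal"
  where "intrinsic_dist M E F h x y =
    Sup {ereal (f y - f x) | f. f \<in> F \<and> continuous_on UNIV f \<and>
      (\<forall>B\<in>sets borel. emeasure (energy_measure M E F f) B \<le> emeasure (energy_measure_vec M E F h) B)}"

definition curve_length :: "('a \<Rightarrow> real ^ 'n) \<Rightarrow> real \<Rightarrow> real \<Rightarrow> (real \<Rightarrow> 'a) \<Rightarrow> ereal" where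
  "curve_length h s t \<gamma> =
    Sup {ereal (\<Sum>i=1..n. norm (h (\<gamma> (\<tau> i)) - h (\<gamma> (\<tau> (i - 1))))) | (n::nat) (\<tau>::nat \<Rightarrow> real).
      n \<ge> 1 \<and> \<tau> 0 = s \<and> \<tau> n = t \<and> (\<forall>i\<in>{1..n}. \<tau> (i - 1) < \<tau> i)}"

definition geodesic_dist :: "('a::topological_space \<Rightarrow> real ^ 'n) \<Rightarrow> 'a \<Rightarrow> 'a \<Rightarrow> ereal" where
  "geodesic_dist h x y =
    Inf {curve_length h 0 1 \<gamma> | \<gamma>. path \<gamma> \<and> pathstart \<gamma> = x \<and> pathfinish \<gamma> = y}"

section \<open>Finite decompositions\<close>

text \<open>The union of the closures of those components of \<open>K \<setminus> V\<close> whose closure contains \<open>x\<close>.\<close>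

definition cell_star :: "'a::topological_space set \<Rightarrow> 'a \<Rightarrow> 'a set" where
  "cell_star V x = \<Union>{closure U | U. U \<in> components (- V) \<and> x \<in> closure U}"

definition fundamental_system :: "'a::topological_space \<Rightarrow> (nat \<Rightarrow> 'a set) \<Rightarrow> bool" where
  "fundamental_system x A \<longleftrightarrow>
    (\<forall>m. x \<in> interior (A m)) \<and> (\<forall>W. open W \<and> x \<in> W \<longrightarrow> (\<exists>m. A m \<subseteq> W))"

end

theory Submission
  imports Defs
begin

text \<open>
  Fix a level \<open>V\<close> of the decomposition. The distance from \<open>x\<close> in the finite graph on
  \<open>V \<union> {x, y}\<close>, where two points are joined if they lie in the closure of one component of
  \<open>- V\<close> and \<open>{p, q}\<close> has length \<open>|h p - h q|\<close>, extends to a function \<open>f\<close> on \<open>K\<close> that on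
  every component is a minimum of functions \<open>a + |h - h p|\<close>. Shortening all edges a little makes
  \<open>f\<close> constant near \<open>V\<close>, so that \<open>f\<close> is locally a 1-Lipschitz function of \<open>h\<close>; hence \<open>f\<close> is
  admissible for the intrinsic distance, which therefore bounds the length of the shortest walk
  from \<open>x\<close> to \<open>y\<close>. By compactness the short walks of all levels can be chosen compatibly, and
  they converge to a curve that is not longer.

  That Lipschitz functions of \<open>h\<close> do not increase the energy measure follows from the Markov property
  of the resolvents, applied to squared increments. Energy measures are defined by a definite
  description, so their existence has to be shown by a Riesz representation theorem.
\<close>

section \<open>Resolvents of a Dirichlet form\<close>

text \<open>The intrinsic distance bounds energy measures, whereas the form itself only yields
  bounds on the functionals \<open>energy_integral f\<close> on F \<inter> C(K). Both sides are
  therefore compared on nonnegative test functions, where partitions of unity localize. The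
  inequality of measures is recovered because the measures are built as outer measures whose values
  on open sets are suprema over such tests. Those tests are only dense in C(K), so the Riesz theorem
  is proved on a dense lattice. The shortening of the edges is paid for by the gap between the
  intrinsic distance and a real number strictly above it. The number of edges is under control
  because loops can be cut out of a walk; the same fact leaves finitely many walks per level, as the
  compactness argument requires. Compatible walks carry only a common order, so the time parameter
  of the curve has to be manufactured from the ranks of a point on all levels.\<close>

lemma L2_mult_integrable:
  assumes "f \<in> L2 M" "g \<in> L2 M"
  shows "integrable M (\<lambda>x. f x * g x)"
proof (rule Bochner_Integration.integrable_bound)
  show "integrable M (\<lambda>x. (f x)\<^sup>2 + (g x)\<^sup>2)"
    using assms by (auto simp: L2_def)
  show "(\<lambda>x. f x * g x) \<in> borel_measurable M"
    using assms by (auto simp: L2_def)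
  have "\<bar>a * b\<bar> \<le> a\<^sup>2 + b\<^sup>2" for a b :: real
  proof -
    have "2 * (\<bar>a\<bar> * \<bar>b\<bar>) \<le> a\<^sup>2 + b\<^sup>2"
      using zero_le_power2[of "\<bar>a\<bar> - \<bar>b\<bar>"] by (simp add: power2_diff)
    moreover have "0 \<le> a\<^sup>2 + b\<^sup>2" by simp
    ultimately show ?thesis unfolding abs_mult by linarith
  qed
  then show "AE x in M. norm (f x * g x) \<le> norm ((f x)\<^sup>2 + (g x)\<^sup>2)"
    by auto
qed

lemma L2_scale: "f \<in> L2 M \<Longrightarrow> (\<lambda>x. c * f x) \<in> L2 M"
  by (auto simp: L2_def power_mult_distrib)

lemma L2_add:
  assumes "f \<in> L2 M" "g \<in> L2 M"
  shows "(\<lambda>x. f x + g x) \<in> L2 M"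
proof -
  have "integrable M (\<lambda>x. (f x)\<^sup>2 + (g x)\<^sup>2 + 2 * (f x * g x))"
    using assms L2_mult_integrable[OF assms] by (auto simp: L2_def)
  moreover have "(\<lambda>x. (f x + g x)\<^sup>2) = (\<lambda>x. (f x)\<^sup>2 + (g x)\<^sup>2 + 2 * (f x * g x))"
    by (auto simp: power2_sum)
  ultimately show ?thesis using assms by (auto simp: L2_def)
qed

lemma L2_diff:
  assumes "f \<in> L2 M" "g \<in> L2 M"
  shows "(\<lambda>x. f x - g x) \<in> L2 M"
  using L2_add[OF assms(1) L2_scale[OF assms(2), of "-1"]] by simp

lemma L2_integral_square_zero:
  assumes "f \<in> L2 M" "(\<integral>x. (f x)\<^sup>2 \<partial>M) = 0"
  shows "AE x in M. f x = 0"
proof -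
  have "AE x in M. (f x)\<^sup>2 = 0"
    using assms integral_nonneg_eq_0_iff_AE[of M "\<lambda>x. (f x)\<^sup>2"] by (auto simp: L2_def)
  then show ?thesis by auto
qed

context dirichlet_form
begin

lemma domain_diff: "\<lbrakk>f \<in> F; g \<in> F\<rbrakk> \<Longrightarrow> (\<lambda>x. f x - g x) \<in> F"
  using domain_add[of f "\<lambda>x. (-1) * g x"] domain_scale[of g "-1"] by simp

lemma form_add_right: "\<lbrakk>f \<in> F; g \<in> F; u \<in> F\<rbrakk> \<Longrightarrow> E u (\<lambda>x. f x + g x) = E u f + E u g"
  using form_add[of f g u] by (metis domain_add form_sym)

lemma form_scale_right: "\<lbrakk>f \<in> F; u \<in> F\<rbrakk> \<Longrightarrow> E u (\<lambda>x. c * f x) = c * E u f"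
  using form_scale[of f u c] by (metis domain_scale form_sym)

lemma form_diff: "\<lbrakk>f \<in> F; g \<in> F; u \<in> F\<rbrakk> \<Longrightarrow> E (\<lambda>x. f x - g x) u = E f u - E g u"
  using form_add[of f "\<lambda>x. (-1) * g x" u] form_scale[of g u "-1"] domain_scale[of g "-1"] by simp

lemma form_diff_right: "\<lbrakk>f \<in> F; g \<in> F; u \<in> F\<rbrakk> \<Longrightarrow> E u (\<lambda>x. f x - g x) = E u f - E u g"
  using form_diff[of f g u] by (metis domain_diff form_sym)

lemma form_Cauchy_Schwarz:
  assumes "f \<in> F" "g \<in> F"
  shows "(E f g)\<^sup>2 \<le> E f f * E g g"
proof -
  have q: "0 \<le> E f f + 2 * t * E f g + t\<^sup>2 * E g g" for t
  proof -
    have "0 \<le> E (\<lambda>x. f x + t * g x) (\<lambda>x. f x + t * g x)"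
      by (intro form_nonneg domain_add domain_scale assms)
    then show ?thesis
      using assms by (simp add: form_add form_add_right domain_add domain_scale form_scale
          form_scale_right form_sym[of g f] power2_eq_square algebra_simps)
  qed
  show ?thesis
  proof (cases "E g g = 0")
    case True
    have "E f g = 0"
    proof (rule ccontr)
      assume "E f g \<noteq> 0"
      \<comment> \<open>At this \<open>t\<close> the polynomial in \<open>q\<close>, which is linear
        because \<open>E g g = 0\<close>, has the value -1.\<close>
      then show False using q[of "- (E f f + 1) / (2 * E f g)"] True by (simp add: field_simps)
    qed
    then show ?thesis using True by simp
  next
    case False
    then have pos: "E g g > 0" using form_nonneg[OF assms(2)] by simp
    have "0 \<le> E f f - (E f g)\<^sup>2 / E g g"
      using q[of "- E f g / E g g"] pos by (simp add: power2_eq_square field_simps)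
    then show ?thesis using pos by (simp add: field_simps)
  qed
qed

section \<open>Penalized energies and the resolvent as their minimizer\<close>

text \<open>A Tikhonov functional whose minimizer over \<open>F\<close> is
  \<open>\<beta> G\<^sub>\<beta> f\<close> with \<open>\<beta> = b\<close>, so that the direct
  method of the calculus of variations yields the resolvent. For \<open>f = 0\<close> it is a
  squared Hilbert norm on \<open>F\<close>.\<close>

definition penalty :: "real \<Rightarrow> ('a \<Rightarrow> real) \<Rightarrow> ('a \<Rightarrow> real) \<Rightarrow> real" where
  "penalty b f v = E v v + b * (\<integral>x. (v x - f x)\<^sup>2 \<partial>M)"

lemma domain_L2': "f \<in> F \<Longrightarrow> f \<in> L2 M" using domain_L2 by auto

lemma penalty_nonneg: "\<lbrakk>v \<in> F; b \<ge> 0\<rbrakk> \<Longrightarrow> penalty b f v \<ge> 0"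
  unfolding penalty_def by (simp add: form_nonneg)

text \<open>The bracket in the middle is half the derivative of \<open>penalty b f\<close> at
  \<open>v\<close> in the direction \<open>w\<close>; it vanishes when \<open>v\<close> is the
  minimizer.\<close>

lemma penalty_expand:
  assumes "f \<in> L2 M" "v \<in> F" "w \<in> F"
  shows "penalty b f (\<lambda>x. v x + w x)
    = penalty b f v + 2 * (E v w + b * (\<integral>x. (v x - f x) * w x \<partial>M)) + penalty b (\<lambda>x. 0) w"
proof -
  have vf: "(\<lambda>x. v x - f x) \<in> L2 M" and w: "w \<in> L2 M"
    using assms domain_L2' L2_diff by auto
  have "(\<integral>x. (v x + w x - f x)\<^sup>2 \<partial>M)
    = (\<integral>x. (v x - f x)\<^sup>2 + 2 * ((v x - f x) * w x) + (w x)\<^sup>2 \<partial>M)"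
    by (intro Bochner_Integration.integral_cong) (auto simp: power2_eq_square algebra_simps)
  also have "\<dots> = (\<integral>x. (v x - f x)\<^sup>2 \<partial>M) + 2 * (\<integral>x. (v x - f x) * w x \<partial>M) + (\<integral>x. (w x)\<^sup>2 \<partial>M)"
    using vf w L2_mult_integrable[OF vf w] by (simp add: L2_def)
  finally show ?thesis unfolding penalty_def
    using assms by (simp add: form_add form_add_right domain_add form_sym[of w v] algebra_simps)
qed

lemma penalty_scale: "w \<in> F \<Longrightarrow> penalty b (\<lambda>x. 0) (\<lambda>x. c * w x) = c\<^sup>2 * penalty b (\<lambda>x. 0) w"
  unfolding penalty_def
  by (simp add: form_scale form_scale_right domain_scale power2_eq_square algebra_simps)

lemma penalty_parallelogram:
  assumes "f \<in> L2 M" "m \<in> F" "d \<in> F"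
  shows "penalty b f (\<lambda>x. m x + d x) + penalty b f (\<lambda>x. m x - d x)
    = 2 * penalty b f m + 2 * penalty b (\<lambda>x. 0) d"
proof -
  have d': "(\<lambda>x. (-1) * d x) \<in> F" by (intro domain_scale assms)
  have int: "(\<integral>x. (m x - f x) * ((-1) * d x) \<partial>M) = - (\<integral>x. (m x - f x) * d x \<partial>M)" by simp
  have "penalty b f (\<lambda>x. m x - d x) = penalty b f (\<lambda>x. m x + (-1) * d x)" by simp
  also have "\<dots> = penalty b f m + 2 * (- E m d + b * (- (\<integral>x. (m x - f x) * d x \<partial>M)))
      + (-1)\<^sup>2 * penalty b (\<lambda>x. 0) d"
    unfolding penalty_expand[OF assms(1,2) d'] int form_scale_right[OF assms(3,2)]
      penalty_scale[OF assms(3)] by simp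
  finally show ?thesis using penalty_expand[OF assms] by simp
qed

text \<open>The projection argument: midpoints of a minimizing sequence cannot fall below the
  infimum, so the parallelogram identity makes the sequence Cauchy. For \<open>b > 0\<close> the
  quadratic form \<open>penalty b (\<lambda>x. 0)\<close> is equivalent to
  \<open>form_norm1\<close>, and closedness of the form provides a limit.\<close>

lemma penalty_minimizer:
  assumes f: "f \<in> L2 M" and b: "b > 0"
  shows "\<exists>v\<in>F. \<forall>w\<in>F. penalty b f v \<le> penalty b f w"
proof -
  define I where "I = Inf (penalty b f ` F)"
  have bdd: "bdd_below (penalty b f ` F)"
    using penalty_nonneg b by (intro bdd_belowI[of _ 0]) fastforce
  have I_le: "I \<le> penalty b f w" if "w \<in> F" for w
    unfolding I_def using that bdd by (simp add: cInf_lower)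
  have "\<exists>w\<in>F. penalty b f w < I + e" if "e > 0" for e
    using cInf_lessD[of "penalty b f ` F" "I + e"] that domain_zero unfolding I_def by auto
  then have "\<exists>w. \<forall>n. w n \<in> F \<and> penalty b f (w n) < I + 1 / Suc n"
    by (intro choice) (metis divide_pos_pos of_nat_0_less_iff zero_less_Suc zero_less_one)
  then obtain w where wF: "\<And>n. w n \<in> F" and w: "\<And>n. penalty b f (w n) < I + 1 / Suc n" by blast
  let ?N = "penalty b (\<lambda>x. 0)"
  have norm_le: "form_norm1 M E u \<le> (1 + 1 / b) * ?N u" if "u \<in> F" for u
    unfolding form_norm1_def penalty_def using b form_nonneg[OF that]
    by (auto simp: field_simps)
  have N_le: "?N u \<le> (1 + b) * form_norm1 M E u" if "u \<in> F" for u
    unfolding form_norm1_def penalty_def using b form_nonneg[OF that]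
    by (auto simp: field_simps)
  have N_diff: "?N (\<lambda>x. w m x - w n x) \<le> 2 * (1 / Suc m + 1 / Suc n)" for m n
  proof -
    let ?m = "\<lambda>x. (1/2) * (w m x + w n x)" and ?d = "\<lambda>x. (1/2) * (w m x - w n x)"
    have F: "?m \<in> F" "?d \<in> F" by (intro domain_scale domain_add domain_diff wF)+
    have e: "w m = (\<lambda>x. ?m x + ?d x)" "w n = (\<lambda>x. ?m x - ?d x)"
      by (auto simp: fun_eq_iff field_simps)
    have "penalty b f (w m) + penalty b f (w n) = 2 * penalty b f ?m + 2 * ?N ?d"
      using penalty_parallelogram[OF f F, of b] e by simp
    moreover have "?N ?d = 1/4 * ?N (\<lambda>x. w m x - w n x)"
      using penalty_scale[OF domain_diff[OF wF wF], of b "1/2" m n] by (simp add: power2_eq_square)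
    moreover have "N \<le> 2 * (r + s)"
      if "a + c = 2 * p + 2 * q" "q = 1/4 * N" "I \<le> p" "a < I + r" "c < I + s" for a c p q N r s :: real
    proof -
      have "2 * q \<le> r + s" using that by linarith
      then show ?thesis using that(2) by simp
    qed
    ultimately show ?thesis using I_le[OF F(1)] w by blast
  qed
  have cauchy: "\<exists>n0. \<forall>m\<ge>n0. \<forall>n\<ge>n0. form_norm1 M E (\<lambda>x. w m x - w n x) < e" if "e > 0" for e
  proof -
    define K where "K = 1 + 1 / b"
    have K: "K > 0" unfolding K_def using b by (simp add: add_pos_pos)
    define r where "r = e / K"
    have "r / 4 > 0" unfolding r_def using K that by simp
    then obtain n0 where n0: "1 / real (Suc n0) < r / 4"
      using nat_approx_posE by blast
    have "form_norm1 M E (\<lambda>x. w m x - w n x) < e" if "m \<ge> n0" "n \<ge> n0" for m n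
    proof -
      have "1 / real (Suc m) \<le> 1 / real (Suc n0)" "1 / real (Suc n) \<le> 1 / real (Suc n0)"
        using that by (auto simp: frac_le)
      then have "1 / real (Suc m) + 1 / real (Suc n) < r / 2" using n0 by linarith
      then have "?N (\<lambda>x. w m x - w n x) < r"
        using N_diff[of m n] by simp
      then have "(1 + 1 / b) * ?N (\<lambda>x. w m x - w n x) < e"
        using K unfolding K_def r_def by (simp add: less_divide_eq mult.commute)
      then show ?thesis using norm_le[OF domain_diff[OF wF wF], of m n] by linarith
    qed
    then show ?thesis by blast
  qed
  obtain v where v: "v \<in> F" and lim: "(\<lambda>n. form_norm1 M E (\<lambda>x. w n x - v x)) \<longlonglongrightarrow> 0"
    using form_closed[OF wF cauchy] by blast
  \<comment> \<open>The parallelogram is centred at \<open>w n\<close> and has \<open>v\<close> and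
    its reflection \<open>2 w n - v\<close> as endpoints. The reflection has penalty at least
    \<open>I\<close>, which bounds the penalty of \<open>v\<close> from above without a separate
    continuity argument.\<close>
  have "penalty b f v \<le> I + 2 / Suc n + 2 * ((1 + b) * form_norm1 M E (\<lambda>x. w n x - v x))" for n
  proof -
    let ?d = "\<lambda>x. w n x - v x"
    have d: "?d \<in> F" using wF v domain_diff by auto
    have "(\<lambda>x. w n x - ?d x) = v" by auto
    then have "penalty b f (\<lambda>x. w n x + ?d x) + penalty b f v = 2 * penalty b f (w n) + 2 * ?N ?d"
      using penalty_parallelogram[OF f wF d, of b n] by simp
    moreover have "I \<le> penalty b f (\<lambda>x. w n x + ?d x)"
      by (intro I_le domain_add wF d)
    ultimately show ?thesis using w[of n] N_le[OF d] by linarith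
  qed
  moreover have "(\<lambda>n. I + 2 / Suc n + 2 * ((1 + b) * form_norm1 M E (\<lambda>x. w n x - v x)))
      \<longlonglongrightarrow> I + 0 + 2 * ((1 + b) * 0)"
    by (intro tendsto_intros lim) (rule LIMSEQ_Suc, rule lim_const_over_n)
  ultimately have "penalty b f v \<le> I + 0 + 2 * ((1 + b) * 0)"
    by (intro LIMSEQ_le_const) auto
  then show ?thesis using I_le v by force
qed

text \<open>The operator \<open>\<beta> G\<^sub>\<beta>\<close>, where \<open>G\<^sub>\<beta>\<close> is the resolvent of the form.\<close>

definition resolvent :: "real \<Rightarrow> ('a \<Rightarrow> real) \<Rightarrow> 'a \<Rightarrow> real" where
  "resolvent b f = (SOME v. v \<in> F \<and> (\<forall>w\<in>F. E v w = b * (\<integral>x. (f x - v x) * w x \<partial>M)))"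

text \<open>The weak resolvent equation is the Euler-Lagrange equation of the penalty: along
  \<open>v + t w\<close> the penalty changes by \<open>2 t B + t\<^sup>2 N\<close>, which is
  nonnegative for all \<open>t\<close> only if \<open>B = 0\<close>.\<close>

lemma resolvent_exists:
  assumes f: "f \<in> L2 M" and b: "b > 0"
  shows "\<exists>v. v \<in> F \<and> (\<forall>w\<in>F. E v w = b * (\<integral>x. (f x - v x) * w x \<partial>M))"
proof -
  obtain v where v: "v \<in> F" and min: "\<And>w. w \<in> F \<Longrightarrow> penalty b f v \<le> penalty b f w"
    using penalty_minimizer[OF assms] by blast
  have "E v w = b * (\<integral>x. (f x - v x) * w x \<partial>M)" if w: "w \<in> F" for w
  proof -
    define B where "B = E v w + b * (\<integral>x. (v x - f x) * w x \<partial>M)"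
    define N where "N = penalty b (\<lambda>x. 0) w"
    have N: "N \<ge> 0" using penalty_nonneg[OF w, of b] b unfolding N_def by simp
    have q: "0 \<le> 2 * t * B + t\<^sup>2 * N" for t
    proof -
      have "penalty b f v \<le> penalty b f (\<lambda>x. v x + t * w x)"
        by (intro min domain_add domain_scale v w)
      also have "\<dots> = penalty b f v + 2 * (E v (\<lambda>x. t * w x)
          + b * (\<integral>x. (v x - f x) * (t * w x) \<partial>M)) + penalty b (\<lambda>x. 0) (\<lambda>x. t * w x)"
        by (intro penalty_expand f v domain_scale w)
      also have "(\<lambda>x. (v x - f x) * (t * w x)) = (\<lambda>x. t * ((v x - f x) * w x))"
        by (simp add: mult.left_commute)
      also have "penalty b f v + 2 * (E v (\<lambda>x. t * w x) + b * (\<integral>x. t * ((v x - f x) * w x) \<partial>M))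
          + penalty b (\<lambda>x. 0) (\<lambda>x. t * w x) = penalty b f v + (2 * t * B + t\<^sup>2 * N)"
        unfolding B_def N_def form_scale_right[OF w v] penalty_scale[OF w] integral_mult_right_zero
        by (simp add: distrib_left)
      finally show ?thesis by simp
    qed
    have "B = 0"
    proof (rule ccontr)
      assume "B \<noteq> 0"
      then have "0 < B\<^sup>2" by simp
      \<comment> \<open>Dividing by \<open>N + 1\<close> instead of \<open>N\<close> covers the case
        \<open>N = 0\<close>.\<close>
      have "0 \<le> 2 * (- B / (N + 1)) * B + (- B / (N + 1))\<^sup>2 * N" by (rule q)
      also have "\<dots> = - B\<^sup>2 * (N + 2) / (N + 1)\<^sup>2"
        using N by (simp add: power2_eq_square divide_simps add_nonneg_eq_0_iff) (simp add: algebra_simps)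
      also have "\<dots> < 0" using N \<open>0 < B\<^sup>2\<close> by (simp add: divide_neg_pos mult_pos_pos)
      finally show False by simp
    qed
    moreover have "(\<integral>x. (v x - f x) * w x \<partial>M) = - (\<integral>x. (f x - v x) * w x \<partial>M)"
      by (subst Bochner_Integration.integral_minus[symmetric])
         (intro Bochner_Integration.integral_cong, auto simp: algebra_simps)
    ultimately show ?thesis unfolding B_def by simp
  qed
  then show ?thesis using v by blast
qed

lemma resolvent_in [simp]: "\<lbrakk>f \<in> L2 M; b > 0\<rbrakk> \<Longrightarrow> resolvent b f \<in> F"
  and resolvent_eq: "\<lbrakk>f \<in> L2 M; b > 0; w \<in> F\<rbrakk>
    \<Longrightarrow> E (resolvent b f) w = b * (\<integral>x. (f x - resolvent b f x) * w x \<partial>M)"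
  using someI_ex[OF resolvent_exists, of f b] unfolding resolvent_def by blast+

text \<open>Pythagoras: the first variation vanishes at the resolvent, so the expansion around it
  has no mixed term. It serves to recognize other minimizers and to measure the distance between
  minimizers for different \<open>b\<close>.\<close>

lemma penalty_resolvent:
  assumes f: "f \<in> L2 M" and b: "b > 0" and w: "w \<in> F"
  shows "penalty b f w = penalty b f (resolvent b f) + penalty b (\<lambda>x. 0) (\<lambda>x. w x - resolvent b f x)"
proof -
  let ?v = "resolvent b f" and ?d = "\<lambda>x. w x - resolvent b f x"
  have d: "?d \<in> F" using f b w domain_diff by simp
  have "(\<integral>x. (?v x - f x) * ?d x \<partial>M) = - (\<integral>x. (f x - ?v x) * ?d x \<partial>M)"
      by (subst Bochner_Integration.integral_minus[symmetric])
         (intro Bochner_Integration.integral_cong, auto simp: algebra_simps)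
  then have "E ?v ?d + b * (\<integral>x. (?v x - f x) * ?d x \<partial>M) = 0"
    using resolvent_eq[OF f b d] by simp
  then show ?thesis using penalty_expand[OF f resolvent_in[OF f b] d, of b] by simp
qed

lemma penalty_zero_AE:
  assumes "w \<in> F" "b > 0" "penalty b (\<lambda>x. 0) w \<le> 0"
  shows "AE x in M. w x = 0"
proof -
  have "b * (\<integral>x. (w x)\<^sup>2 \<partial>M) \<le> 0"
    using assms form_nonneg[of w] unfolding penalty_def by simp
  moreover have "0 \<le> (\<integral>x. (w x)\<^sup>2 \<partial>M)" by simp
  ultimately have "(\<integral>x. (w x)\<^sup>2 \<partial>M) = 0"
    using assms(2) by (metis mult_le_0_iff order_antisym not_le)
  then show ?thesis using L2_integral_square_zero assms domain_L2' by blast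
qed

text \<open>The resolvent is a chosen representative, so its algebra holds only almost everywhere
  and is always derived from here. The difference of two solutions of the weak equation has penalty
  norm zero.\<close>

lemma resolvent_unique:
  assumes f: "f \<in> L2 M" and b: "b > 0" and v: "v \<in> F"
    and eq: "\<And>w. w \<in> F \<Longrightarrow> E v w = b * (\<integral>x. (f x - v x) * w x \<partial>M)"
  shows "AE x in M. resolvent b f x = v x"
proof -
  let ?r = "resolvent b f" and ?d = "\<lambda>x. resolvent b f x - v x"
  have d: "?d \<in> F" using f b v domain_diff by simp
  have L: "?r \<in> L2 M" "v \<in> L2 M" "?d \<in> L2 M" using f b v d domain_L2' by auto
  have "E ?d ?d = b * (\<integral>x. (f x - ?r x) * ?d x \<partial>M) - b * (\<integral>x. (f x - v x) * ?d x \<partial>M)"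
    using form_diff[OF resolvent_in[OF f b] v d] resolvent_eq[OF f b d] eq[OF d] by simp
  also have "\<dots> = b * (\<integral>x. (f x - ?r x) * ?d x - (f x - v x) * ?d x \<partial>M)"
    using L2_mult_integrable[OF L2_diff[OF f L(1)] L(3)]
      L2_mult_integrable[OF L2_diff[OF f L(2)] L(3)] by (simp add: right_diff_distrib)
  also have "(\<integral>x. (f x - ?r x) * ?d x - (f x - v x) * ?d x \<partial>M) = (\<integral>x. - ((?d x)\<^sup>2) \<partial>M)"
    by (intro Bochner_Integration.integral_cong) (auto simp: power2_eq_square algebra_simps)
  finally have "penalty b (\<lambda>x. 0) ?d \<le> 0" unfolding penalty_def by simp
  then have "AE x in M. ?d x = 0" using penalty_zero_AE[OF d b] by simp
  then show ?thesis by auto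
qed

lemma resolvent_add:
  assumes f: "f \<in> L2 M" and g: "g \<in> L2 M" and b: "b > 0"
  shows "AE x in M. resolvent b (\<lambda>x. f x + g x) x = resolvent b f x + resolvent b g x"
proof (rule resolvent_unique[OF L2_add[OF f g] b])
  show "(\<lambda>x. resolvent b f x + resolvent b g x) \<in> F" using f g b by (simp add: domain_add)
  fix w assume w: "w \<in> F"
  note i = L2_mult_integrable[OF L2_diff[OF f domain_L2'[OF resolvent_in[OF f b]]] domain_L2'[OF w]]
    L2_mult_integrable[OF L2_diff[OF g domain_L2'[OF resolvent_in[OF g b]]] domain_L2'[OF w]]
  have "(\<integral>x. (f x + g x - (resolvent b f x + resolvent b g x)) * w x \<partial>M)
    = (\<integral>x. (f x - resolvent b f x) * w x + (g x - resolvent b g x) * w x \<partial>M)"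
    by (intro Bochner_Integration.integral_cong) (auto simp: algebra_simps)
  also have "\<dots> = (\<integral>x. (f x - resolvent b f x) * w x \<partial>M) + (\<integral>x. (g x - resolvent b g x) * w x \<partial>M)"
    by (rule Bochner_Integration.integral_add[OF i])
  finally show "E (\<lambda>x. resolvent b f x + resolvent b g x) w
    = b * (\<integral>x. (f x + g x - (resolvent b f x + resolvent b g x)) * w x \<partial>M)"
    using f g b w by (simp add: form_add resolvent_eq algebra_simps)
qed

lemma resolvent_scale:
  assumes f: "f \<in> L2 M" and b: "b > 0"
  shows "AE x in M. resolvent b (\<lambda>x. c * f x) x = c * resolvent b f x"
proof (rule resolvent_unique[OF L2_scale[OF f] b])
  show "(\<lambda>x. c * resolvent b f x) \<in> F" using f b by (simp add: domain_scale)
  fix w assume w: "w \<in> F"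
  have "(\<integral>x. (c * f x - c * resolvent b f x) * w x \<partial>M)
    = (\<integral>x. c * ((f x - resolvent b f x) * w x) \<partial>M)"
    by (intro Bochner_Integration.integral_cong) (auto simp: algebra_simps)
  also have "\<dots> = c * (\<integral>x. (f x - resolvent b f x) * w x \<partial>M)" by simp
  finally show "E (\<lambda>x. c * resolvent b f x) w
    = b * (\<integral>x. (c * f x - c * resolvent b f x) * w x \<partial>M)"
    using f b w by (simp add: form_scale resolvent_eq)
qed

lemma resolvent_symmetric:
  assumes f: "f \<in> L2 M" and g: "g \<in> L2 M" and b: "b > 0"
  shows "(\<integral>x. resolvent b f x * g x \<partial>M) = (\<integral>x. f x * resolvent b g x \<partial>M)"
proof -
  let ?f = "resolvent b f" and ?g = "resolvent b g"
  have F: "?f \<in> F" "?g \<in> F" and L: "?f \<in> L2 M" "?g \<in> L2 M" using f g b domain_L2' by auto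
  have "(\<integral>x. (f x - ?f x) * ?g x \<partial>M) = (\<integral>x. (g x - ?g x) * ?f x \<partial>M)"
    using resolvent_eq[OF f b F(2)] resolvent_eq[OF g b F(1)] form_sym[OF F] b by simp
  then have "(\<integral>x. f x * ?g x \<partial>M) - (\<integral>x. ?f x * ?g x \<partial>M)
      = (\<integral>x. g x * ?f x \<partial>M) - (\<integral>x. ?g x * ?f x \<partial>M)"
    using L2_mult_integrable[OF f L(2)] L2_mult_integrable[OF L(1) L(2)]
      L2_mult_integrable[OF g L(1)] L2_mult_integrable[OF L(2) L(1)]
    by (simp add: left_diff_distrib)
  then show ?thesis by (simp add: mult.commute)
qed

text \<open>For \<open>f\<close> with values in [0, 1], truncating to [0, 1] increases neither term
  of the penalty. The truncated minimizer is therefore a minimizer again, and the Pythagorean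
  identity makes the two agree almost everywhere.\<close>

lemma resolvent_markov:
  assumes f: "f \<in> L2 M" and b: "b > 0" and rng: "AE x in M. 0 \<le> f x \<and> f x \<le> 1"
  shows "AE x in M. 0 \<le> resolvent b f x \<and> resolvent b f x \<le> 1"
proof -
  let ?v = "resolvent b f" and ?u = "\<lambda>x. min 1 (max 0 (resolvent b f x))"
  have v: "?v \<in> F" and u: "?u \<in> F" using f b markov_domain by auto
  have le: "(\<integral>x. (?u x - f x)\<^sup>2 \<partial>M) \<le> (\<integral>x. (?v x - f x)\<^sup>2 \<partial>M)"
  proof (rule integral_mono_AE)
    show "integrable M (\<lambda>x. (?u x - f x)\<^sup>2)" "integrable M (\<lambda>x. (?v x - f x)\<^sup>2)"
      using L2_diff[OF domain_L2'[OF u] f] L2_diff[OF domain_L2'[OF v] f] by (auto simp: L2_def)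
    have "\<bar>?u x - f x\<bar> \<le> \<bar>?v x - f x\<bar>" if "0 \<le> f x \<and> f x \<le> 1" for x
      using that by (auto simp: min_def max_def)
    then have "(?u x - f x)\<^sup>2 \<le> (?v x - f x)\<^sup>2" if "0 \<le> f x \<and> f x \<le> 1" for x
      using that abs_le_square_iff by blast
    then show "AE x in M. (?u x - f x)\<^sup>2 \<le> (?v x - f x)\<^sup>2"
      using rng by auto
  qed
  have "penalty b f ?u \<le> penalty b f ?v"
    unfolding penalty_def using markov_form[OF v] le b by (simp add: add_mono)
  then have "penalty b (\<lambda>x. 0) (\<lambda>x. ?u x - ?v x) \<le> 0"
    using penalty_resolvent[OF f b u] by simp
  then have "AE x in M. ?u x - ?v x = 0"
    using penalty_zero_AE[OF domain_diff[OF u v] b] by simp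
  then show ?thesis by (rule AE_mp) (auto intro!: AE_I2 simp: min_def max_def split: if_splits)
qed

section \<open>Approximating forms\<close>

text \<open>The Deny-Yosida approximation of the form. It makes sense on all of \<open>L2 M\<close>,
  so its boundedness can serve as a criterion for membership in \<open>F\<close>.\<close>

definition approx_form :: "real \<Rightarrow> ('a \<Rightarrow> real) \<Rightarrow> ('a \<Rightarrow> real) \<Rightarrow> real" where
  "approx_form b u v = b * (\<integral>x. (u x - resolvent b u x) * v x \<partial>M)"

text \<open>Identifies the approximating energy with a minimal penalty. For \<open>u\<close> in
  \<open>F\<close> the competitor \<open>u\<close> itself then bounds it by \<open>E u u\<close>,
  and it controls both the energy of the resolvent and its distance from \<open>u\<close>.\<close>

lemma approx_form_self:
  assumes u: "u \<in> L2 M" and b: "b > 0"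
  shows "approx_form b u u = penalty b u (resolvent b u)"
proof -
  let ?v = "resolvent b u"
  have L: "?v \<in> L2 M" using u b domain_L2' by simp
  have "approx_form b u u = b * (\<integral>x. (u x - ?v x) * ?v x + (?v x - u x)\<^sup>2 \<partial>M)"
    unfolding approx_form_def
    by (intro arg_cong[where f="(*) b"] Bochner_Integration.integral_cong)
       (auto simp: power2_eq_square algebra_simps)
  also have "\<dots> = b * (\<integral>x. (u x - ?v x) * ?v x \<partial>M) + b * (\<integral>x. (?v x - u x)\<^sup>2 \<partial>M)"
    using L2_mult_integrable[OF L2_diff[OF u L] L] L2_diff[OF L u] by (simp add: L2_def distrib_left)
  finally show ?thesis
    unfolding penalty_def using resolvent_eq[OF u b, of ?v] u b by simp
qed

lemma approx_form_le: "u \<in> F \<Longrightarrow> b > 0 \<Longrightarrow> approx_form b u u \<le> E u u"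
  using penalty_resolvent[of u b u] penalty_nonneg[of "\<lambda>x. u x - resolvent b u x" b "\<lambda>x. 0"]
    approx_form_self[of u b] domain_L2'[of u] domain_diff[of u "resolvent b u"]
  by (simp add: penalty_def)

text \<open>The resolvents form a Cauchy sequence because the minimal penalties increase with \<open>\<beta>\<close> and
  control the distance between minimizers.\<close>

lemma resolvent_tendsto:
  assumes u: "u \<in> L2 M" and bound: "\<And>n. approx_form (real (Suc n)) u u \<le> C"
  shows "u \<in> F"
    and "(\<lambda>n. form_norm1 M E (\<lambda>x. resolvent (real (Suc n)) u x - u x)) \<longlonglongrightarrow> 0"
proof -
  define v where "v n = resolvent (real (Suc n)) u" for n
  define e where "e n = penalty (real (Suc n)) u (v n)" for n
  have vF: "v n \<in> F" for n unfolding v_def using u by simp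
  have eC: "e n \<le> C" for n
    using bound[of n] approx_form_self[OF u, of "real (Suc n)"] unfolding e_def v_def by simp
  have step: "form_norm1 M E (\<lambda>x. v m x - v n x) \<le> e m - e n" if "n \<le> m" for m n
  proof -
    have d: "(\<lambda>x. v m x - v n x) \<in> F" using vF domain_diff by simp
    \<comment> \<open>The weight \<open>Suc n\<close> is at least 1, so the penalty norm dominates
      \<open>form_norm1\<close>.\<close>
    have "form_norm1 M E (\<lambda>x. v m x - v n x) \<le> penalty (real (Suc n)) (\<lambda>x. 0) (\<lambda>x. v m x - v n x)"
      unfolding form_norm1_def penalty_def by (simp add: distrib_right)
    also have "\<dots> = penalty (real (Suc n)) u (v m) - e n"
      using penalty_resolvent[OF u, of "real (Suc n)" "v m"] vF unfolding e_def v_def by simp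
    also have "penalty (real (Suc n)) u (v m) \<le> e m"
      unfolding e_def penalty_def using that by (intro add_left_mono mult_right_mono) auto
    finally show ?thesis by simp
  qed
  have norm_nonneg: "0 \<le> form_norm1 M E w" if "w \<in> F" for w
    unfolding form_norm1_def using form_nonneg[OF that] by simp
  have "incseq e"
  proof (rule incseq_SucI)
    fix n
    show "e n \<le> e (Suc n)"
      using step[of n "Suc n"] norm_nonneg[OF domain_diff[OF vF vF], of "Suc n" n] by linarith
  qed
  then have "Cauchy e"
    using incseq_convergent[of e C] eC by (metis LIMSEQ_imp_Cauchy)
  have sym: "form_norm1 M E (\<lambda>x. v m x - v n x) = form_norm1 M E (\<lambda>x. v n x - v m x)" for m n
  proof -
    have d: "(\<lambda>x. v m x - v n x) \<in> F" using vF domain_diff by simp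
    have e: "(\<lambda>x. v n x - v m x) = (\<lambda>x. (-1) * (v m x - v n x))" by auto
    have "E (\<lambda>x. v n x - v m x) (\<lambda>x. v n x - v m x) = E (\<lambda>x. v m x - v n x) (\<lambda>x. v m x - v n x)"
      unfolding e form_scale[OF d domain_scale[OF d]] form_scale_right[OF d d] by simp
    then show ?thesis unfolding form_norm1_def by (simp add: power2_commute)
  qed
  have cauchy: "\<exists>n0. \<forall>m\<ge>n0. \<forall>n\<ge>n0. form_norm1 M E (\<lambda>x. v m x - v n x) < r" if r: "r > 0" for r
  proof -
    obtain n0 where n0: "\<And>m n. m \<ge> n0 \<Longrightarrow> n \<ge> n0 \<Longrightarrow> \<bar>e m - e n\<bar> < r"
      using CauchyD[OF \<open>Cauchy e\<close> r] by auto
    have "form_norm1 M E (\<lambda>x. v m x - v n x) < r" if "m \<ge> n0" "n \<ge> n0" for m n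
      using step[of m n] step[of n m] n0[OF that] sym[of m n] by (cases "n \<le> m") auto
    then show ?thesis by blast
  qed
  obtain w where w: "w \<in> F" and lim: "(\<lambda>n. form_norm1 M E (\<lambda>x. v n x - w x)) \<longlonglongrightarrow> 0"
    using form_closed[OF vF cauchy] by blast
  have L: "v n \<in> L2 M" "w \<in> L2 M" for n using vF w domain_L2' by auto
  \<comment> \<open>The quadratic part of the minimal penalty carries the weight
    \<open>Suc n\<close> while the whole stays below \<open>C\<close>, so the resolvents tend to
    \<open>u\<close> in mean square. Their limit \<open>w\<close> in the form norm is therefore
    \<open>u\<close> almost everywhere.\<close>
  have "(\<integral>x. (w x - u x)\<^sup>2 \<partial>M) \<le> 2 * form_norm1 M E (\<lambda>x. v n x - w x) + 2 * (C / Suc n)" for n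
  proof -
    have "(\<integral>x. (w x - u x)\<^sup>2 \<partial>M) \<le> (\<integral>x. 2 * (v n x - w x)\<^sup>2 + 2 * (v n x - u x)\<^sup>2 \<partial>M)"
    proof (rule integral_mono)
      show "integrable M (\<lambda>x. (w x - u x)\<^sup>2)"
        "integrable M (\<lambda>x. 2 * (v n x - w x)\<^sup>2 + 2 * (v n x - u x)\<^sup>2)"
        using L2_diff[OF L(2) u] L2_diff[OF L(1,2), of n] L2_diff[OF L(1) u, of n] by (auto simp: L2_def)
      show "(w x - u x)\<^sup>2 \<le> 2 * (v n x - w x)\<^sup>2 + 2 * (v n x - u x)\<^sup>2" for x
        using zero_le_power2[of "(v n x - w x) + (v n x - u x)"]
        by (simp add: power2_eq_square algebra_simps)
    qed
    also have "\<dots> = 2 * (\<integral>x. (v n x - w x)\<^sup>2 \<partial>M) + 2 * (\<integral>x. (v n x - u x)\<^sup>2 \<partial>M)"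
      using L2_diff[OF L(1,2), of n] L2_diff[OF L(1) u, of n] by (simp add: L2_def)
    also have "(\<integral>x. (v n x - w x)\<^sup>2 \<partial>M) \<le> form_norm1 M E (\<lambda>x. v n x - w x)"
      unfolding form_norm1_def using form_nonneg[OF domain_diff[OF vF w]] by simp
    also have "(\<integral>x. (v n x - u x)\<^sup>2 \<partial>M) \<le> C / Suc n"
      using eC[of n] form_nonneg[OF vF, of n] unfolding e_def penalty_def by (simp add: field_simps)
    finally show ?thesis by simp
  qed
  moreover have "(\<lambda>n. 2 * form_norm1 M E (\<lambda>x. v n x - w x) + 2 * (C / Suc n)) \<longlonglongrightarrow> 2 * 0 + 2 * 0"
    by (intro tendsto_intros lim) (rule LIMSEQ_Suc, rule lim_const_over_n)
  ultimately have "(\<integral>x. (w x - u x)\<^sup>2 \<partial>M) \<le> 2 * 0 + 2 * 0"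
    by (intro LIMSEQ_le_const) auto
  then have "(\<integral>x. (w x - u x)\<^sup>2 \<partial>M) = 0" by (simp add: antisym)
  then have "AE x in M. w x - u x = 0"
    using L2_integral_square_zero[OF L2_diff[OF L(2) u]] by simp
  then have ae: "AE x in M. w x = u x" by auto
  show uF: "u \<in> F"
    using domain_AE[OF w _ ae] u by (simp add: L2_def)
  have "form_norm1 M E (\<lambda>x. v n x - w x) = form_norm1 M E (\<lambda>x. v n x - u x)" for n
  proof -
    have F: "(\<lambda>x. v n x - w x) \<in> F" "(\<lambda>x. v n x - u x) \<in> F" using vF w uF domain_diff by auto
    have ae': "AE x in M. v n x - w x = v n x - u x" using ae by auto
    have "E (\<lambda>x. v n x - w x) (\<lambda>x. v n x - w x) = E (\<lambda>x. v n x - u x) (\<lambda>x. v n x - u x)"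
      using form_AE[OF F F(1) ae'] form_AE[OF F F(2) ae'] form_sym[OF F] by simp
    moreover have "(\<integral>x. (v n x - w x)\<^sup>2 \<partial>M) = (\<integral>x. (v n x - u x)\<^sup>2 \<partial>M)"
      using F domain_L2' ae' by (intro integral_cong_AE) (auto simp: L2_def)
    ultimately show ?thesis unfolding form_norm1_def by simp
  qed
  then show "(\<lambda>n. form_norm1 M E (\<lambda>x. resolvent (real (Suc n)) u x - u x)) \<longlonglongrightarrow> 0"
    using lim unfolding v_def by simp
qed

text \<open>By the resolvent equation, \<open>approx_form b u v\<close> is the form evaluated at the
  resolvent of \<open>u\<close> and at \<open>v\<close>. The error is thus controlled by
  Cauchy-Schwarz and the convergence of the resolvents in the form norm.\<close>

lemma approx_form_tendsto:
  assumes u: "u \<in> F" and v: "v \<in> F"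
  shows "(\<lambda>n. approx_form (real (Suc n)) u v) \<longlonglongrightarrow> E u v"
proof -
  define d where "d n = (\<lambda>x. resolvent (real (Suc n)) u x - u x)" for n
  have L: "u \<in> L2 M" using u domain_L2' by simp
  have dF: "d n \<in> F" for n unfolding d_def using u L by (intro domain_diff) auto
  have lim: "(\<lambda>n. form_norm1 M E (d n)) \<longlonglongrightarrow> 0"
    unfolding d_def
    by (rule resolvent_tendsto(2)[OF L]) (rule approx_form_le[OF u], simp)
  have diff: "approx_form (real (Suc n)) u v - E u v = E (d n) v" for n
  proof -
    have "E (d n) v = E (resolvent (real (Suc n)) u) v - E u v"
      unfolding d_def using u v L by (intro form_diff) auto
    also have "E (resolvent (real (Suc n)) u) v = approx_form (real (Suc n)) u v"
      unfolding approx_form_def using v L by (intro resolvent_eq) auto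
    finally show ?thesis by simp
  qed
  have "(\<lambda>n. (E (d n) v)\<^sup>2) \<longlonglongrightarrow> 0"
  proof (rule tendsto_sandwich[OF _ _ tendsto_const])
    have "(\<lambda>n. form_norm1 M E (d n) * E v v) \<longlonglongrightarrow> 0 * E v v"
      by (intro tendsto_intros lim)
    then show "(\<lambda>n. form_norm1 M E (d n) * E v v) \<longlonglongrightarrow> 0" by simp
    have "(E (d n) v)\<^sup>2 \<le> form_norm1 M E (d n) * E v v" for n
    proof -
      have "(E (d n) v)\<^sup>2 \<le> E (d n) (d n) * E v v" by (rule form_Cauchy_Schwarz[OF dF v])
      also have "\<dots> \<le> form_norm1 M E (d n) * E v v"
        unfolding form_norm1_def using form_nonneg[OF v] by (intro mult_right_mono) auto
      finally show ?thesis .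
    qed
    then show "\<forall>\<^sub>F n in sequentially. (E (d n) v)\<^sup>2 \<le> form_norm1 M E (d n) * E v v" by simp
  qed auto
  then have "(\<lambda>n. E (d n) v) \<longlonglongrightarrow> 0"
    using tendsto_real_sqrt[of "\<lambda>n. (E (d n) v)\<^sup>2" 0] by (simp add: tendsto_rabs_zero_iff)
  then have "(\<lambda>n. approx_form (real (Suc n)) u v - E u v) \<longlonglongrightarrow> 0" using diff by simp
  then show ?thesis by (rule LIM_zero_cancel)
qed

end

section \<open>Normal contractions and energy integrals\<close>

definition bounded_measurable :: "'a measure \<Rightarrow> ('a \<Rightarrow> real) set" where
  "bounded_measurable M = {f \<in> borel_measurable M. \<exists>C. \<forall>x. \<bar>f x\<bar> \<le> C}"

lemma bounded_measurableI:
  "\<lbrakk>f \<in> borel_measurable M; \<And>x. \<bar>f x\<bar> \<le> C\<rbrakk> \<Longrightarrow> f \<in> bounded_measurable M"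
  unfolding bounded_measurable_def by blast

lemma bounded_measurable_const [simp]: "(\<lambda>x. c) \<in> bounded_measurable M"
  by (rule bounded_measurableI[of _ _ "\<bar>c\<bar>"]) auto

lemma bounded_measurable_add:
  assumes "f \<in> bounded_measurable M" "g \<in> bounded_measurable M"
  shows "(\<lambda>x. f x + g x) \<in> bounded_measurable M"
proof -
  obtain A B where "\<And>x. \<bar>f x\<bar> \<le> A" "\<And>x. \<bar>g x\<bar> \<le> B"
    using assms unfolding bounded_measurable_def by blast
  then have "\<bar>f x + g x\<bar> \<le> A + B" for x
    by (meson abs_triangle_ineq add_mono order_trans)
  then show ?thesis
    using assms by (intro bounded_measurableI) (auto simp: bounded_measurable_def)
qed

lemma bounded_measurable_mult:
  assumes "f \<in> bounded_measurable M" "g \<in> bounded_measurable M"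
  shows "(\<lambda>x. f x * g x) \<in> bounded_measurable M"
proof -
  obtain A B where AB: "\<And>x. \<bar>f x\<bar> \<le> A" "\<And>x. \<bar>g x\<bar> \<le> B"
    using assms unfolding bounded_measurable_def by blast
  have "\<bar>f x * g x\<bar> \<le> A * B" for x
    unfolding abs_mult by (intro mult_mono AB abs_ge_zero order_trans[OF abs_ge_zero AB(1)])
  then show ?thesis
    using assms by (intro bounded_measurableI) (auto simp: bounded_measurable_def)
qed

lemma bounded_measurable_diff:
  assumes "f \<in> bounded_measurable M" "g \<in> bounded_measurable M"
  shows "(\<lambda>x. f x - g x) \<in> bounded_measurable M"
  using bounded_measurable_add[OF assms(1) bounded_measurable_mult[OF bounded_measurable_const assms(2)], of "-1"]
  by simp

lemma bounded_measurable_power2: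
  "f \<in> bounded_measurable M \<Longrightarrow> (\<lambda>x. (f x)\<^sup>2) \<in> bounded_measurable M"
  unfolding power2_eq_square by (rule bounded_measurable_mult)

lemma bounded_measurable_sum:
  "\<lbrakk>finite I; \<And>i. i \<in> I \<Longrightarrow> f i \<in> bounded_measurable M\<rbrakk>
    \<Longrightarrow> (\<lambda>x. \<Sum>i\<in>I. f i x) \<in> bounded_measurable M"
  by (induction I rule: finite_induct) (auto intro!: bounded_measurable_add)

lemmas bounded_measurable_intros = bounded_measurable_const bounded_measurable_add
  bounded_measurable_mult bounded_measurable_diff bounded_measurable_power2 bounded_measurable_sum

lemma (in finite_measure) bounded_measurable_L2: "f \<in> bounded_measurable M \<Longrightarrow> f \<in> L2 M"
proof -
  assume f: "f \<in> bounded_measurable M"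
  then obtain C where C: "\<And>x. \<bar>f x\<bar> \<le> C" unfolding bounded_measurable_def by blast
  have "\<bar>(f x)\<^sup>2\<bar> \<le> C\<^sup>2" for x using C[of x] by (simp add: abs_le_square_iff power2_abs) (metis abs_ge_zero abs_of_nonneg order_trans power_mono power2_abs)
  then have "integrable M (\<lambda>x. (f x)\<^sup>2)"
    using f by (intro integrable_const_bound[where B="C\<^sup>2"]) (auto simp: bounded_measurable_def)
  then show ?thesis using f by (auto simp: L2_def bounded_measurable_def)
qed

text \<open>Conservativeness is automatic for a strong local form on a compact space.\<close>

locale conservative_form = dirichlet_form M E F + finite_measure M
  for M :: "'a measure" and E F +
  assumes one_in: "(\<lambda>x. 1) \<in> F"
    and form_one: "f \<in> F \<Longrightarrow> E (\<lambda>x. 1) f = 0"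
begin

lemma const_in: "(\<lambda>x. c) \<in> F"
  using domain_scale[OF one_in, of c] by simp

lemma form_const: "f \<in> F \<Longrightarrow> E (\<lambda>x. c) f = 0"
  using form_scale[OF one_in, of f c] form_one by simp

lemma L2_integrable: "f \<in> L2 M \<Longrightarrow> integrable M f"
  using L2_mult_integrable[of f M "\<lambda>x. 1"] bounded_measurable_L2[of "\<lambda>x. 1"] by simp

lemma resolvent_L2 [simp]: "\<lbrakk>f \<in> L2 M; b > 0\<rbrakk> \<Longrightarrow> resolvent b f \<in> L2 M"
  using domain_L2' resolvent_in by blast

lemma resolvent_const: "b > 0 \<Longrightarrow> AE x in M. resolvent b (\<lambda>x. c) x = c"
  by (intro resolvent_unique) (auto simp: bounded_measurable_L2 const_in form_const)

lemma resolvent_nonneg: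
  assumes f: "f \<in> bounded_measurable M" and b: "b > 0" and nn: "\<And>x. 0 \<le> f x"
  shows "AE x in M. 0 \<le> resolvent b f x"
proof -
  obtain C where C: "\<And>x. \<bar>f x\<bar> \<le> C" using f unfolding bounded_measurable_def by blast
  define D where "D = max 1 C"
  have D: "D > 0" "\<And>x. f x \<le> D"
    unfolding D_def using C by (auto simp: abs_le_iff le_max_iff_disj)
  have L: "f \<in> L2 M" by (rule bounded_measurable_L2[OF f])
  have "AE x in M. 0 \<le> resolvent b (\<lambda>x. (1/D) * f x) x \<and> resolvent b (\<lambda>x. (1/D) * f x) x \<le> 1"
    using D nn by (intro resolvent_markov L2_scale L b) (auto simp: field_simps)
  moreover have "AE x in M. resolvent b (\<lambda>x. (1/D) * f x) x = (1/D) * resolvent b f x"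
    by (rule resolvent_scale[OF L b])
  ultimately show ?thesis
  proof eventually_elim
    case (elim x)
    then show ?case using D by (simp add: zero_le_divide_iff)
  qed
qed

lemma resolvent_sum:
  assumes "finite I" "\<And>i. i \<in> I \<Longrightarrow> f i \<in> L2 M" and b: "b > 0"
  shows "AE x in M. resolvent b (\<lambda>x. \<Sum>i\<in>I. f i x) x = (\<Sum>i\<in>I. resolvent b (f i) x)"
  using assms(1,2)
proof (induction I rule: finite_induct)
  case empty
  then show ?case using resolvent_const[OF b, of 0] by simp
next
  case (insert i I)
  have L: "(\<lambda>x. \<Sum>i\<in>I. f i x) \<in> L2 M"
    using insert.hyps(1) insert.prems
  proof (induction I rule: finite_induct)
    case empty
    then show ?case using bounded_measurable_L2 by simp
  next
    case (insert j J)
    then show ?case using L2_add[of "f j" M "\<lambda>x. \<Sum>i\<in>J. f i x"] by auto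
  qed
  have "AE x in M. resolvent b (\<lambda>x. f i x + (\<Sum>i\<in>I. f i x)) x
      = resolvent b (f i) x + resolvent b (\<lambda>x. \<Sum>i\<in>I. f i x) x"
    using insert L by (intro resolvent_add b) auto
  moreover have "AE x in M. resolvent b (\<lambda>x. \<Sum>i\<in>I. f i x) x = (\<Sum>i\<in>I. resolvent b (f i) x)"
    using insert by auto
  ultimately show ?case
  proof eventually_elim
    case (elim x)
    then show ?case using insert.hyps by simp
  qed
qed

lemma resolvent_diff:
  assumes f: "f \<in> L2 M" and g: "g \<in> L2 M" and b: "b > 0"
  shows "AE x in M. resolvent b (\<lambda>x. f x - g x) x = resolvent b f x - resolvent b g x"
  using resolvent_add[OF f L2_scale[OF g, of "-1"] b] resolvent_scale[OF g b, of "-1"]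
  by eventually_elim simp

text \<open>Conservativeness enters through the term \<open>c\<^sup>2\<close>. At a fixed point the
  right-hand side is a polynomial in \<open>c\<close> whose coefficients do not involve
  \<open>c\<close>; this is what later allows \<open>c\<close> to depend on the point.\<close>

lemma resolvent_square_diff:
  assumes f: "f \<in> bounded_measurable M" and b: "b > 0"
  shows "AE x in M. resolvent b (\<lambda>x. (f x - c)\<^sup>2) x
    = resolvent b (\<lambda>x. (f x)\<^sup>2) x - 2 * c * resolvent b f x + c\<^sup>2"
proof -
  note L = bounded_measurable_L2
  have e: "(\<lambda>x. (f x - c)\<^sup>2) = (\<lambda>x. ((f x)\<^sup>2 + c\<^sup>2) - (2 * c) * f x)"
    by (auto simp: power2_diff algebra_simps)
  have "AE x in M. resolvent b (\<lambda>x. ((f x)\<^sup>2 + c\<^sup>2) - (2 * c) * f x) x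
      = resolvent b (\<lambda>x. (f x)\<^sup>2 + c\<^sup>2) x - resolvent b (\<lambda>x. (2 * c) * f x) x"
    by (intro resolvent_diff L bounded_measurable_intros f b)
  moreover have "AE x in M. resolvent b (\<lambda>x. (f x)\<^sup>2 + c\<^sup>2) x
      = resolvent b (\<lambda>x. (f x)\<^sup>2) x + resolvent b (\<lambda>x. c\<^sup>2) x"
    by (intro resolvent_add L bounded_measurable_intros f b)
  moreover have "AE x in M. resolvent b (\<lambda>x. (2 * c) * f x) x = (2 * c) * resolvent b f x"
    by (intro resolvent_scale L f b)
  moreover note resolvent_const[OF b, of "c\<^sup>2"]
  ultimately show ?thesis unfolding e by eventually_elim simp
qed

section \<open>Squared increments under the resolvent\<close>

text \<open>For a resolvent given by a probability kernel this would be the mean of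
  \<open>(f y - f x)\<^sup>2\<close> over the law of \<open>y\<close>. Taken as a density with
  respect to \<open>M\<close>, the multiple \<open>b * gamma b f\<close> approximates the energy
  measure.\<close>

definition gamma :: "real \<Rightarrow> ('a \<Rightarrow> real) \<Rightarrow> 'a \<Rightarrow> real" where
  "gamma b f x = resolvent b (\<lambda>x. (f x)\<^sup>2) x - 2 * f x * resolvent b f x + (f x)\<^sup>2"

lemma gamma_integrable:
  assumes f: "f \<in> bounded_measurable M" and p: "\<phi> \<in> bounded_measurable M" and b: "b > 0"
  shows "integrable M (\<lambda>x. \<phi> x * gamma b f x)"
proof -
  note L = bounded_measurable_L2
  have "integrable M (\<lambda>x. \<phi> x * resolvent b (\<lambda>x. (f x)\<^sup>2) x - (2 * (\<phi> x * f x)) * resolvent b f x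
      + \<phi> x * (f x)\<^sup>2)"
    by (intro Bochner_Integration.integrable_add Bochner_Integration.integrable_diff
        L2_mult_integrable resolvent_L2 L bounded_measurable_intros f p b)
  moreover have "(\<lambda>x. \<phi> x * gamma b f x) = (\<lambda>x. \<phi> x * resolvent b (\<lambda>x. (f x)\<^sup>2) x
      - (2 * (\<phi> x * f x)) * resolvent b f x + \<phi> x * (f x)\<^sup>2)"
    unfolding gamma_def by (auto simp: algebra_simps)
  ultimately show ?thesis by simp
qed

text \<open>The expression that characterizes the energy measure, evaluated for the approximating
  form, is an integral of squared increments. This is the passage from forms to pointwise
  estimates.\<close>

lemma approx_form_gamma:
  assumes f: "f \<in> bounded_measurable M" and p: "\<phi> \<in> bounded_measurable M" and b: "b > 0"
  shows "2 * approx_form b f (\<lambda>x. f x * \<phi> x) - approx_form b (\<lambda>x. (f x)\<^sup>2) \<phi>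
    = b * (\<integral>x. \<phi> x * gamma b f x \<partial>M)"
proof -
  note L = bounded_measurable_L2
  have "integrable M (\<lambda>x. (f x - resolvent b f x) * (f x * \<phi> x))"
    "integrable M (\<lambda>x. ((f x)\<^sup>2 - resolvent b (\<lambda>x. (f x)\<^sup>2) x) * \<phi> x)"
    by (intro L2_mult_integrable L2_diff resolvent_L2 L bounded_measurable_intros f p b)+
  then have "2 * (\<integral>x. (f x - resolvent b f x) * (f x * \<phi> x) \<partial>M)
      - (\<integral>x. ((f x)\<^sup>2 - resolvent b (\<lambda>x. (f x)\<^sup>2) x) * \<phi> x \<partial>M)
    = (\<integral>x. 2 * ((f x - resolvent b f x) * (f x * \<phi> x))
      - ((f x)\<^sup>2 - resolvent b (\<lambda>x. (f x)\<^sup>2) x) * \<phi> x \<partial>M)"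
    by simp
  also have "\<dots> = (\<integral>x. \<phi> x * gamma b f x \<partial>M)"
    unfolding gamma_def
    by (intro Bochner_Integration.integral_cong) (auto simp: power2_eq_square algebra_simps)
  finally show ?thesis unfolding approx_form_def by (simp add: algebra_simps)
qed

text \<open>For \<open>\<phi> = 1\<close> the term with \<open>f\<^sup>2\<close> vanishes, because a
  symmetric resolvent that fixes constants preserves integrals.\<close>

lemma approx_form_gamma_self:
  assumes f: "f \<in> bounded_measurable M" and b: "b > 0"
  shows "2 * approx_form b f f = b * (\<integral>x. gamma b f x \<partial>M)"
proof -
  note L = bounded_measurable_L2
  let ?f2 = "\<lambda>x. (f x)\<^sup>2"
  have L2: "?f2 \<in> L2 M" "(\<lambda>x. 1) \<in> L2 M" by (intro L bounded_measurable_intros f)+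
  have "(\<integral>x. resolvent b ?f2 x * 1 \<partial>M) = (\<integral>x. ?f2 x * resolvent b (\<lambda>x. 1) x \<partial>M)"
    by (rule resolvent_symmetric[OF L2 b])
  also have "\<dots> = (\<integral>x. ?f2 x \<partial>M)"
    using resolvent_const[OF b, of 1] L2 resolvent_L2[OF L2(2) b]
    by (intro integral_cong_AE) (auto simp: L2_def)
  finally have "approx_form b ?f2 (\<lambda>x. 1) = 0"
    unfolding approx_form_def using L2_integrable[OF L2(1)] L2_integrable[OF resolvent_L2[OF L2(1) b]]
    by simp
  then show ?thesis using approx_form_gamma[OF f bounded_measurable_const b, of 1] by simp
qed

text \<open>For fixed values \<open>d\<close> and \<open>c\<close> the inequality \<open>(u - c)\<^sup>2 \<le> |h - d|\<^sup>2\<close> is preserved by the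
  resolvent; outside a null set this holds for countably many \<open>(d, c)\<close> at once, hence by continuity
  also for \<open>d = h x\<close> and \<open>c = u x\<close>. This replaces a kernel representation of the resolvent.\<close>

lemma gamma_mono:
  fixes h :: "'a \<Rightarrow> 'e::euclidean_space"
  assumes u: "u \<in> bounded_measurable M" and h: "\<And>i. i \<in> Basis \<Longrightarrow> (\<lambda>x. h x \<bullet> i) \<in> bounded_measurable M"
    and b: "b > 0" and le: "\<And>x y. \<bar>u x - u y\<bar> \<le> norm (h x - h y)"
  shows "AE x in M. gamma b u x \<le> (\<Sum>i\<in>Basis. gamma b (\<lambda>x. h x \<bullet> i) x)"
proof -
  note L = bounded_measurable_L2
  \<comment> \<open>The countable set is dense in the range because \<open>u\<close> and
    \<open>h\<close> carry no continuity here. It consists of actual values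
    \<open>(h y, u y)\<close>, for which the contraction hypothesis is available.\<close>
  obtain T where T: "countable T" "T \<subseteq> range (\<lambda>x. (h x, u x))" "range (\<lambda>x. (h x, u x)) \<subseteq> closure T"
    using separable[of "range (\<lambda>x. (h x, u x))"] by blast
  define P where "P x p \<longleftrightarrow>
      resolvent b (\<lambda>x. (u x)\<^sup>2) x - 2 * snd p * resolvent b u x + (snd p)\<^sup>2
      \<le> (\<Sum>i\<in>Basis. resolvent b (\<lambda>x. (h x \<bullet> i)\<^sup>2) x
          - 2 * (fst p \<bullet> i) * resolvent b (\<lambda>x. h x \<bullet> i) x + (fst p \<bullet> i)\<^sup>2)" for x and p :: "'e \<times> real"
  have "AE x in M. P x p" if pT: "p \<in> T" for p
  proof -
    obtain y where p: "p = (h y, u y)" using pT T(2) by blast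
    let ?s = "\<lambda>x. \<Sum>i\<in>Basis. (h x \<bullet> i - h y \<bullet> i)\<^sup>2" and ?t = "\<lambda>x. (u x - u y)\<^sup>2"
    have nn: "0 \<le> ?s x - ?t x" for x
    proof -
      have "\<bar>u x - u y\<bar>\<^sup>2 \<le> (norm (h x - h y))\<^sup>2" by (intro power_mono le) auto
      also have "(norm (h x - h y))\<^sup>2 = ?s x"
        unfolding power2_norm_eq_inner
        by (subst euclidean_inner) (simp add: inner_diff_left power2_eq_square)
      finally show ?thesis by simp
    qed
    have s: "?s \<in> L2 M" and t: "?t \<in> L2 M" and si: "\<And>i. i \<in> Basis \<Longrightarrow> (\<lambda>x. (h x \<bullet> i - h y \<bullet> i)\<^sup>2) \<in> L2 M"
      by (intro L bounded_measurable_intros u h finite_Basis; assumption)+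
    have "AE x in M. 0 \<le> resolvent b (\<lambda>x. ?s x - ?t x) x"
      by (intro resolvent_nonneg b nn bounded_measurable_intros u h finite_Basis)
    moreover have "AE x in M. resolvent b (\<lambda>x. ?s x - ?t x) x = resolvent b ?s x - resolvent b ?t x"
      by (rule resolvent_diff[OF s t b])
    moreover have "AE x in M. resolvent b ?s x
        = (\<Sum>i\<in>Basis. resolvent b (\<lambda>x. (h x \<bullet> i - h y \<bullet> i)\<^sup>2) x)"
      by (rule resolvent_sum[OF finite_Basis si b])
    moreover have "AE x in M. \<forall>i\<in>Basis. resolvent b (\<lambda>x. (h x \<bullet> i - h y \<bullet> i)\<^sup>2) x
        = resolvent b (\<lambda>x. (h x \<bullet> i)\<^sup>2) x - 2 * (h y \<bullet> i) * resolvent b (\<lambda>x. h x \<bullet> i) x + (h y \<bullet> i)\<^sup>2"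
      by (intro AE_finite_allI finite_Basis resolvent_square_diff h b)
    moreover have "AE x in M. resolvent b ?t x
        = resolvent b (\<lambda>x. (u x)\<^sup>2) x - 2 * u y * resolvent b u x + (u y)\<^sup>2"
      by (rule resolvent_square_diff[OF u b])
    ultimately show ?thesis
    proof eventually_elim
      case (elim x)
      then have "(\<Sum>i\<in>Basis. resolvent b (\<lambda>x. (h x \<bullet> i - h y \<bullet> i)\<^sup>2) x)
        = (\<Sum>i\<in>Basis. resolvent b (\<lambda>x. (h x \<bullet> i)\<^sup>2) x
          - 2 * (h y \<bullet> i) * resolvent b (\<lambda>x. h x \<bullet> i) x + (h y \<bullet> i)\<^sup>2)"
        by (intro sum.cong) auto
      then show ?case using elim unfolding P_def p by simp
    qed
  qed
  then have "AE x in M. \<forall>p\<in>T. P x p"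
    using AE_ball_countable[OF T(1)] by blast
  then show ?thesis
  proof eventually_elim
    case (elim x)
    have "closed {p. P x p}"
      unfolding P_def by (intro closed_Collect_le continuous_intros)
    then have "closure T \<subseteq> {p. P x p}"
      using elim by (intro closure_minimal) auto
    then have "P x (h x, u x)" using T(3) by blast
    then show ?case unfolding P_def gamma_def by simp
  qed
qed

text \<open>Integrating \<open>gamma_mono\<close> bounds the approximating energies of
  \<open>u\<close> by those of the coordinates of \<open>h\<close>, which stay below the energies of
  these coordinates. The resolvent criterion then puts \<open>u\<close> into
  \<open>F\<close>.\<close>

lemma lipschitz_domain:
  fixes h :: "'a \<Rightarrow> 'e::euclidean_space"
  assumes u: "u \<in> bounded_measurable M" and h: "\<And>i. i \<in> Basis \<Longrightarrow> (\<lambda>x. h x \<bullet> i) \<in> bounded_measurable M"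
    and hF: "\<And>i. i \<in> Basis \<Longrightarrow> (\<lambda>x. h x \<bullet> i) \<in> F"
    and le: "\<And>x y. \<bar>u x - u y\<bar> \<le> norm (h x - h y)"
  shows "u \<in> F"
proof (rule resolvent_tendsto(1)[OF bounded_measurable_L2[OF u]])
  fix n
  let ?b = "real (Suc n)"
  have b: "?b > 0" by simp
  have int: "integrable M (gamma ?b f)" if "f \<in> bounded_measurable M" for f
    using gamma_integrable[OF that bounded_measurable_const b, of 1] by simp
  have "2 * approx_form ?b u u = ?b * (\<integral>x. gamma ?b u x \<partial>M)"
    by (rule approx_form_gamma_self[OF u b])
  also have "\<dots> \<le> ?b * (\<integral>x. (\<Sum>i\<in>Basis. gamma ?b (\<lambda>x. h x \<bullet> i) x) \<partial>M)"
    using gamma_mono[OF u h b le]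
    by (intro mult_left_mono integral_mono_AE Bochner_Integration.integrable_sum int u h) auto
  also have "\<dots> = (\<Sum>i\<in>Basis. ?b * (\<integral>x. gamma ?b (\<lambda>x. h x \<bullet> i) x \<partial>M))"
    using int h by (subst Bochner_Integration.integral_sum) (auto simp: sum_distrib_left)
  also have "\<dots> = (\<Sum>i\<in>Basis. 2 * approx_form ?b (\<lambda>x. h x \<bullet> i) (\<lambda>x. h x \<bullet> i))"
    by (intro sum.cong refl approx_form_gamma_self[symmetric] h b)
  also have "\<dots> \<le> (\<Sum>i\<in>Basis. 2 * E (\<lambda>x. h x \<bullet> i) (\<lambda>x. h x \<bullet> i))"
    by (intro sum_mono mult_left_mono approx_form_le hF b) auto
  finally show "approx_form ?b u u \<le> (\<Sum>i\<in>Basis. 2 * E (\<lambda>x. h x \<bullet> i) (\<lambda>x. h x \<bullet> i)) / 2"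
    by simp
qed

text \<open>On [-C, C] the square is Lipschitz with constant \<open>2 * C\<close>, so
  \<open>f\<^sup>2\<close> is a contraction of \<open>2 * C * f\<close>.\<close>

lemma domain_power2:
  assumes f: "f \<in> F" "f \<in> bounded_measurable M"
  shows "(\<lambda>x. (f x)\<^sup>2) \<in> F"
proof -
  obtain C where C: "\<And>x. \<bar>f x\<bar> \<le> C" using f(2) unfolding bounded_measurable_def by blast
  show ?thesis
  proof (rule lipschitz_domain[where h = "\<lambda>x. (2 * C) * f x"])
    fix x y
    have "\<bar>(f x)\<^sup>2 - (f y)\<^sup>2\<bar> = \<bar>f x + f y\<bar> * \<bar>f x - f y\<bar>"
      unfolding power2_eq_square square_diff_square_factored abs_mult by (simp add: mult.commute)
    also have "\<dots> \<le> (2 * C) * \<bar>f x - f y\<bar>"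
      using C[of x] C[of y] by (intro mult_right_mono) auto
    also have "\<dots> = norm ((2 * C) * f x - (2 * C) * f y)"
      using order_trans[OF abs_ge_zero C[of x]] unfolding right_diff_distrib[symmetric]
      by (simp add: abs_mult)
    finally show "\<bar>(f x)\<^sup>2 - (f y)\<^sup>2\<bar> \<le> norm ((2 * C) * f x - (2 * C) * f y)" .
  next
    show "(\<lambda>x. (f x)\<^sup>2) \<in> bounded_measurable M"
      by (intro bounded_measurable_intros f)
    show "(\<lambda>x. (2 * C * f x) \<bullet> i) \<in> bounded_measurable M" if "i \<in> Basis" for i :: real
      using that f by (auto intro!: bounded_measurable_intros)
    show "(\<lambda>x. (2 * C * f x) \<bullet> i) \<in> F" if "i \<in> Basis" for i :: real
      using that f by (auto intro!: domain_scale)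
  qed
qed

lemma domain_mult:
  assumes f: "f \<in> F" "f \<in> bounded_measurable M" and g: "g \<in> F" "g \<in> bounded_measurable M"
  shows "(\<lambda>x. f x * g x) \<in> F"
proof -
  have "(\<lambda>x. (1/4) * ((f x + g x)\<^sup>2 - (f x - g x)\<^sup>2)) \<in> F"
    by (intro domain_scale domain_diff domain_power2 domain_add bounded_measurable_intros f g)
  moreover have "(\<lambda>x. (1/4) * ((f x + g x)\<^sup>2 - (f x - g x)\<^sup>2)) = (\<lambda>x. f x * g x)"
    by (auto simp: power2_eq_square algebra_simps)
  ultimately show ?thesis by simp
qed

text \<open>The integral of \<open>\<phi>\<close> against the energy measure of \<open>f\<close>,
  available as a functional before the measure exists.\<close>

definition energy_integral :: "('a \<Rightarrow> real) \<Rightarrow> ('a \<Rightarrow> real) \<Rightarrow> real" where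
  "energy_integral f \<phi> = 2 * E f (\<lambda>x. f x * \<phi> x) - E (\<lambda>x. (f x)\<^sup>2) \<phi>"

lemma energy_integral_tendsto:
  assumes f: "f \<in> F" "f \<in> bounded_measurable M" and p: "\<phi> \<in> F" "\<phi> \<in> bounded_measurable M"
  shows "(\<lambda>n. real (Suc n) * (\<integral>x. \<phi> x * gamma (real (Suc n)) f x \<partial>M)) \<longlonglongrightarrow> energy_integral f \<phi>"
proof -
  have "(\<lambda>n. 2 * approx_form (real (Suc n)) f (\<lambda>x. f x * \<phi> x)
      - approx_form (real (Suc n)) (\<lambda>x. (f x)\<^sup>2) \<phi>) \<longlonglongrightarrow> energy_integral f \<phi>"
    unfolding energy_integral_def
    by (intro tendsto_intros approx_form_tendsto f p domain_mult domain_power2)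
  then show ?thesis by (subst (asm) approx_form_gamma) (use f p in auto)
qed

text \<open>The pointwise bound of \<open>gamma_mono\<close> survives multiplication by a
  nonnegative weight, integration and the limit in the resolvent parameter.\<close>

lemma energy_integral_mono:
  fixes h :: "'a \<Rightarrow> 'e::euclidean_space"
  assumes u: "u \<in> F" "u \<in> bounded_measurable M"
    and h: "\<And>i. i \<in> Basis \<Longrightarrow> (\<lambda>x. h x \<bullet> i) \<in> F"
      "\<And>i. i \<in> Basis \<Longrightarrow> (\<lambda>x. h x \<bullet> i) \<in> bounded_measurable M"
    and p: "\<phi> \<in> F" "\<phi> \<in> bounded_measurable M" "\<And>x. 0 \<le> \<phi> x"
    and le: "\<And>x y. \<bar>u x - u y\<bar> \<le> norm (h x - h y)"
  shows "energy_integral u \<phi> \<le> (\<Sum>i\<in>Basis. energy_integral (\<lambda>x. h x \<bullet> i) \<phi>)"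
proof (rule LIMSEQ_le)
  show "(\<lambda>n. real (Suc n) * (\<integral>x. \<phi> x * gamma (real (Suc n)) u x \<partial>M)) \<longlonglongrightarrow> energy_integral u \<phi>"
    by (rule energy_integral_tendsto[OF u p(1,2)])
  show "(\<lambda>n. \<Sum>i\<in>Basis. real (Suc n) * (\<integral>x. \<phi> x * gamma (real (Suc n)) (\<lambda>x. h x \<bullet> i) x \<partial>M))
      \<longlonglongrightarrow> (\<Sum>i\<in>Basis. energy_integral (\<lambda>x. h x \<bullet> i) \<phi>)"
    by (intro tendsto_sum energy_integral_tendsto h p)
  have "real (Suc n) * (\<integral>x. \<phi> x * gamma (real (Suc n)) u x \<partial>M)
      \<le> (\<Sum>i\<in>Basis. real (Suc n) * (\<integral>x. \<phi> x * gamma (real (Suc n)) (\<lambda>x. h x \<bullet> i) x \<partial>M))" for n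
  proof -
    let ?b = "real (Suc n)"
    have b: "?b > 0" by simp
    have "?b * (\<integral>x. \<phi> x * gamma ?b u x \<partial>M)
        \<le> ?b * (\<integral>x. (\<Sum>i\<in>Basis. \<phi> x * gamma ?b (\<lambda>x. h x \<bullet> i) x) \<partial>M)"
    proof (intro mult_left_mono integral_mono_AE Bochner_Integration.integrable_sum gamma_integrable u h p b)
      show "AE x in M. \<phi> x * gamma ?b u x \<le> (\<Sum>i\<in>Basis. \<phi> x * gamma ?b (\<lambda>x. h x \<bullet> i) x)"
        using gamma_mono[of u h, OF u(2) _ b le] h(2)
        by (auto simp: sum_distrib_left[symmetric] intro!: mult_left_mono p elim!: eventually_mono)
    qed auto
    also have "\<dots> = (\<Sum>i\<in>Basis. ?b * (\<integral>x. \<phi> x * gamma ?b (\<lambda>x. h x \<bullet> i) x \<partial>M))"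
      using gamma_integrable h p b by (subst Bochner_Integration.integral_sum) (auto simp: sum_distrib_left)
    finally show ?thesis .
  qed
  then show "\<exists>N. \<forall>n\<ge>N. real (Suc n) * (\<integral>x. \<phi> x * gamma (real (Suc n)) u x \<partial>M)
      \<le> (\<Sum>i\<in>Basis. real (Suc n) * (\<integral>x. \<phi> x * gamma (real (Suc n)) (\<lambda>x. h x \<bullet> i) x \<partial>M))"
    by blast
qed

lemma energy_integral_const:
  assumes "\<phi> \<in> F" "\<phi> \<in> bounded_measurable M"
  shows "energy_integral (\<lambda>x. c) \<phi> = 0"
  unfolding energy_integral_def using assms by (simp add: form_const domain_scale)

text \<open>The zero function is a contraction of \<open>f\<close> and has no energy.\<close>

lemma energy_integral_nonneg:
  assumes f: "f \<in> F" "f \<in> bounded_measurable M"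
    and p: "\<phi> \<in> F" "\<phi> \<in> bounded_measurable M" "\<And>x. 0 \<le> \<phi> x"
  shows "0 \<le> energy_integral f \<phi>"
  using energy_integral_mono[of "\<lambda>x. 0" f \<phi>] f p energy_integral_const[OF p(1,2), of 0]
  by (simp add: domain_zero)

lemma energy_integral_add:
  assumes f: "f \<in> F" "f \<in> bounded_measurable M"
    and p: "\<phi> \<in> F" "\<phi> \<in> bounded_measurable M" and q: "\<psi> \<in> F" "\<psi> \<in> bounded_measurable M"
  shows "energy_integral f (\<lambda>x. \<phi> x + \<psi> x) = energy_integral f \<phi> + energy_integral f \<psi>"
  unfolding energy_integral_def distrib_left using assms
  by (simp add: form_add_right domain_mult domain_power2)

lemma energy_integral_scale:
  assumes f: "f \<in> F" "f \<in> bounded_measurable M" and p: "\<phi> \<in> F" "\<phi> \<in> bounded_measurable M"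
  shows "energy_integral f (\<lambda>x. c * \<phi> x) = c * energy_integral f \<phi>"
  unfolding energy_integral_def mult.left_commute[of _ c] using assms
  by (simp add: form_scale_right domain_mult domain_power2 algebra_simps)

end

section \<open>The Riesz representation theorem on a compact metric space\<close>

lemma metric_urysohn:
  fixes C W :: "'a::metric_space set"
  assumes "closed C" "open W" "C \<subseteq> W"
  obtains g :: "'a \<Rightarrow> real" where "continuous_on UNIV g" "\<And>x. 0 \<le> g x \<and> g x \<le> 1"
    "\<And>x. x \<in> C \<Longrightarrow> g x = 1" "\<And>x. x \<notin> W \<Longrightarrow> g x = 0"
\<comment> \<open>\<open>infdist\<close> to the empty set is 0 by convention, so the quotient of
  distances below needs both sets to be nonempty.\<close>
proof (cases "C = {} \<or> W = UNIV")
  case True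
  then show ?thesis
  proof
    assume "C = {}"
    then show ?thesis by (intro that[of "\<lambda>x. 0"]) auto
  next
    assume "W = UNIV"
    then show ?thesis by (intro that[of "\<lambda>x. 1"]) auto
  qed
next
  case False
  let ?c = "\<lambda>x. infdist x C" and ?w = "\<lambda>x. infdist x (- W)"
  have ne: "C \<noteq> {}" "- W \<noteq> {}" using False by auto
  have cl: "closed (- W)" using assms by auto
  have c0: "?c x = 0 \<longleftrightarrow> x \<in> C" for x
    using in_closed_iff_infdist_zero[OF assms(1) ne(1)] by auto
  have w0: "?w x = 0 \<longleftrightarrow> x \<notin> W" for x
    using in_closed_iff_infdist_zero[OF cl ne(2)] by auto
  have pos: "?c x + ?w x > 0" for x
    using infdist_nonneg[of x C] infdist_nonneg[of x "- W"] c0[of x] w0[of x] assms(3)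
    by (metis add_nonneg_eq_0_iff add_nonneg_nonneg less_eq_real_def subsetD)
  show ?thesis
  proof (rule that[of "\<lambda>x. ?w x / (?c x + ?w x)"])
    show "continuous_on UNIV (\<lambda>x. ?w x / (?c x + ?w x))"
      using pos by (intro continuous_intros) (metis less_irrefl)
    show "0 \<le> ?w x / (?c x + ?w x) \<and> ?w x / (?c x + ?w x) \<le> 1" for x
      using pos[of x] infdist_nonneg[of x C] infdist_nonneg[of x "- W"] by simp
    show "?w x / (?c x + ?w x) = 1" if "x \<in> C" for x
      using that c0[of x] pos[of x] by simp
    show "?w x / (?c x + ?w x) = 0" if "x \<notin> W" for x
      using that w0[of x] by simp
  qed
qed

text \<open>Abstracts F \<inter> C(K), where the energy functionals live: a uniformly dense vector
  lattice with constants. The measure theory below relies on lattice operations in place of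
  products.\<close>

locale dense_lattice =
  fixes D :: "('a::metric_space \<Rightarrow> real) set"
  assumes compact_space: "compact (UNIV :: 'a set)"
    and D_continuous: "f \<in> D \<Longrightarrow> continuous_on UNIV f"
    and D_add: "\<lbrakk>f \<in> D; g \<in> D\<rbrakk> \<Longrightarrow> (\<lambda>x. f x + g x) \<in> D"
    and D_scale: "f \<in> D \<Longrightarrow> (\<lambda>x. c * f x) \<in> D"
    and D_one: "(\<lambda>x. 1) \<in> D"
    and D_max: "f \<in> D \<Longrightarrow> (\<lambda>x. max 0 (f x)) \<in> D"
    and D_dense: "\<lbrakk>continuous_on UNIV f; e > 0\<rbrakk> \<Longrightarrow> \<exists>g\<in>D. \<forall>x. \<bar>f x - g x\<bar> < e"
begin

lemma D_const: "(\<lambda>x. c) \<in> D"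
  using D_scale[OF D_one, of c] by simp

lemma D_diff: "\<lbrakk>f \<in> D; g \<in> D\<rbrakk> \<Longrightarrow> (\<lambda>x. f x - g x) \<in> D"
  using D_add[OF _ D_scale[of g "-1"], of f] by simp

lemma D_sum: "\<lbrakk>finite I; \<And>i. i \<in> I \<Longrightarrow> f i \<in> D\<rbrakk> \<Longrightarrow> (\<lambda>x. \<Sum>i\<in>I. f i x) \<in> D"
  by (induction I rule: finite_induct) (auto intro!: D_const D_add)

lemma D_clamp:
  assumes "f \<in> D"
  shows "(\<lambda>x. min 1 (max 0 (f x))) \<in> D"
proof -
  have "(\<lambda>x. min 1 (max 0 (f x))) = (\<lambda>x. max 0 (f x) - max 0 (f x - 1))"
    by (auto simp: min_def max_def)
  then show ?thesis using assms by (simp add: D_diff D_max D_const)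
qed

lemma D_bounded:
  assumes "f \<in> D"
  obtains C where "C > 0" "\<And>x. \<bar>f x\<bar> \<le> C"
proof -
  have "bounded (range f)"
    using compact_continuous_image[OF D_continuous[OF assms] compact_space]
    by (rule compact_imp_bounded)
  then show ?thesis using that unfolding bounded_pos by auto
qed

lemma cutoff:
  assumes "closed C" "open W" "C \<subseteq> W"
  obtains \<xi> where "\<xi> \<in> D" "\<And>x. 0 \<le> \<xi> x" "\<And>x. \<xi> x \<le> 1" "\<And>x. x \<in> C \<Longrightarrow> \<xi> x = 1"
    "closure {x. \<xi> x \<noteq> 0} \<subseteq> W"
proof -
  obtain g :: "'a \<Rightarrow> real" where g: "continuous_on UNIV g" "\<And>x. 0 \<le> g x \<and> g x \<le> 1"
    "\<And>x. x \<in> C \<Longrightarrow> g x = 1" "\<And>x. x \<notin> W \<Longrightarrow> g x = 0"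
    by (rule metric_urysohn[OF assms]) blast
  obtain k where k: "k \<in> D" "\<And>x. \<bar>g x - k x\<bar> < 1/4"
    using D_dense[OF g(1), of "1/4"] by auto
  \<comment> \<open>\<open>k\<close> exceeds 3/4 on \<open>C\<close> and is below 1/4 outside
    \<open>W\<close>; the affine map sends these two levels to 1 and 0. The closed set where
    \<open>k\<close> is at least 1/4 keeps even the closure of the support inside
    \<open>W\<close>.\<close>
  let ?\<xi> = "\<lambda>x. min 1 (max 0 (2 * k x - 1/2))"
  show ?thesis
  proof (rule that)
    show "?\<xi> \<in> D" by (intro D_clamp D_diff D_scale D_const k)
    show "?\<xi> x = 1" if "x \<in> C" for x
      using g(3)[OF that] k(2)[of x] by (auto simp: abs_if split: if_splits)
    have "{x. ?\<xi> x \<noteq> 0} \<subseteq> {x. 1/4 \<le> k x}"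
      by (auto simp: max_def min_def split: if_splits)
    moreover have "closed {x. 1/4 \<le> k x}"
      by (intro closed_Collect_le D_continuous k continuous_on_const)
    ultimately have "closure {x. ?\<xi> x \<noteq> 0} \<subseteq> {x. 1/4 \<le> k x}"
      by (rule closure_minimal)
    moreover have "x \<in> W" if "1/4 \<le> k x" for x
    proof (rule ccontr)
      assume "x \<notin> W"
      then show False using g(4)[of x] k(2)[of x] that by auto
    qed
    ultimately show "closure {x. ?\<xi> x \<noteq> 0} \<subseteq> W" by blast
  qed auto
qed

lemma finite_measure_integrable:
  assumes "f \<in> D" "sets \<nu> = sets borel" "finite_measure \<nu>"
  shows "integrable \<nu> f"
proof -
  interpret finite_measure \<nu> by fact
  obtain C where "\<And>x. \<bar>f x\<bar> \<le> C" using D_bounded[OF assms(1)] by blast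
  moreover have "f \<in> borel_measurable \<nu>"
    using borel_measurable_continuous_onI[OF D_continuous[OF assms(1)]]
      measurable_cong_sets[OF assms(2) refl] by blast
  ultimately show ?thesis by (intro integrable_const_bound[where B=C]) auto
qed

text \<open>Open sets form an intersection-stable generator, and the indicator of an open set is the
  pointwise limit of cutoffs from \<open>D\<close> bounded by 1, so dominated convergence
  applies.\<close>

lemma measure_eqI_D:
  assumes \<mu>: "sets \<mu> = sets borel" "finite_measure \<mu>" and \<nu>: "sets \<nu> = sets borel" "finite_measure \<nu>"
    and eq: "\<And>f. f \<in> D \<Longrightarrow> (\<integral>x. f x \<partial>\<mu>) = (\<integral>x. f x \<partial>\<nu>)"
  shows "\<mu> = \<nu>"
proof -
  interpret \<mu>: finite_measure \<mu> by fact
  interpret \<nu>: finite_measure \<nu> by fact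
  have sp: "space \<mu> = UNIV" "space \<nu> = UNIV"
    using sets_eq_imp_space_eq[OF \<mu>(1)] sets_eq_imp_space_eq[OF \<nu>(1)] by auto
  have op: "measure \<mu> G = measure \<nu> G" if G: "open G" for G
  proof -
    \<comment> \<open>The closed sets of points at distance at least \<open>1 / Suc k\<close> from
      the complement exhaust \<open>G\<close>. The bounded quantifier includes
      \<open>G = UNIV\<close> without a case distinction.\<close>
    define C where "C k = {x. \<forall>y\<in>- G. 1 / real (Suc k) \<le> dist x y}" for k
    have clC: "closed (C k)" for k
    proof -
      have "C k = (\<Inter>y\<in>- G. {x. 1 / real (Suc k) \<le> dist x y})" unfolding C_def by auto
      then show ?thesis by (auto intro!: closed_INT closed_Collect_le continuous_intros)
    qed
    have sub: "C k \<subseteq> G" for k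
    proof
      fix x assume "x \<in> C k"
      then show "x \<in> G" unfolding C_def by (cases "x \<in> G") force+
    qed
    have "\<exists>\<xi>\<in>D. (\<forall>x. 0 \<le> \<xi> x \<and> \<xi> x \<le> 1) \<and> (\<forall>x\<in>C k. \<xi> x = 1) \<and> (\<forall>x. x \<notin> G \<longrightarrow> \<xi> x = 0)" for k
    proof -
      obtain \<xi> where \<xi>: "\<xi> \<in> D" "\<And>x. 0 \<le> \<xi> x" "\<And>x. \<xi> x \<le> 1" "\<And>x. x \<in> C k \<Longrightarrow> \<xi> x = 1"
        "closure {x. \<xi> x \<noteq> 0} \<subseteq> G" by (rule cutoff[OF clC G sub]) blast
      have "\<xi> x = 0" if "x \<notin> G" for x
        using that \<xi>(5) closure_subset[of "{x. \<xi> x \<noteq> 0}"] by blast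
      then show ?thesis using \<xi> by blast
    qed
    then obtain \<xi> where \<xi>: "\<And>k. \<xi> k \<in> D" "\<And>k x. 0 \<le> \<xi> k x \<and> \<xi> k x \<le> 1"
      "\<And>k x. x \<in> C k \<Longrightarrow> \<xi> k x = 1" "\<And>k x. x \<notin> G \<Longrightarrow> \<xi> k x = 0"
      by metis
    have lim: "(\<lambda>k. \<xi> k x) \<longlonglongrightarrow> indicator G x" for x
    proof (cases "x \<in> G")
      case True
      obtain e where e: "e > 0" "ball x e \<subseteq> G" using \<open>open G\<close> True open_contains_ball by blast
      obtain k0 where k0: "1 / real (Suc k0) < e" using e(1) nat_approx_posE by blast
      have "\<xi> k x = 1" if "k \<ge> k0" for k
      proof (rule \<xi>(3))
        have "1 / real (Suc k) \<le> 1 / real (Suc k0)" using that by (simp add: frac_le)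
        then have "1 / real (Suc k) \<le> dist x y" if "y \<in> - G" for y
          using k0 e(2) that by (force simp: subset_iff)
        then show "x \<in> C k" unfolding C_def by blast
      qed
      then have "eventually (\<lambda>k. \<xi> k x = 1) sequentially" unfolding eventually_sequentially by blast
      then show ?thesis using True by (simp add: tendsto_eventually)
    qed (use \<xi>(4) in simp)
    have "(\<lambda>k. \<integral>x. \<xi> k x \<partial>N) \<longlonglongrightarrow> measure N G"
      if N: "sets N = sets borel" "finite_measure N" for N
    proof -
      interpret N: finite_measure N by fact
      have spN: "space N = UNIV" using sets_eq_imp_space_eq[OF N(1)] by auto
      have GN: "G \<in> sets N" using \<open>open G\<close> N(1) by auto
      have "(\<lambda>k. \<integral>x. \<xi> k x \<partial>N) \<longlonglongrightarrow> (\<integral>x. indicator G x \<partial>N)"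
      proof (rule integral_dominated_convergence[where w = "\<lambda>x. 1"])
        show "indicator G \<in> borel_measurable N" using GN by auto
        show "\<xi> k \<in> borel_measurable N" for k
          using finite_measure_integrable[OF \<xi>(1) N] by auto
        show "AE x in N. (\<lambda>k. \<xi> k x) \<longlonglongrightarrow> indicator G x" using lim by auto
        show "AE x in N. norm (\<xi> k x) \<le> 1" for k using \<xi>(2) by auto
      qed auto
      then show ?thesis using GN spN by simp
    qed
    then have "(\<lambda>k. \<integral>x. \<xi> k x \<partial>\<mu>) \<longlonglongrightarrow> measure \<mu> G" "(\<lambda>k. \<integral>x. \<xi> k x \<partial>\<nu>) \<longlonglongrightarrow> measure \<nu> G"
      using \<mu> \<nu> by auto
    then show ?thesis using eq[OF \<xi>(1)] LIMSEQ_unique by fastforce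
  qed
  show ?thesis
  proof (rule measure_eqI_generator_eq[where A = "\<lambda>_. UNIV" and E = "{S. open S}" and \<Omega> = UNIV])
    show "Int_stable {S :: 'a set. open S}" by (auto simp: Int_stable_def)
    show "sets \<mu> = sigma_sets UNIV {S. open S}" "sets \<nu> = sigma_sets UNIV {S. open S}"
      using \<mu>(1) \<nu>(1) by (auto simp: borel_def)
    show "emeasure \<mu> X = emeasure \<nu> X" if "X \<in> {S. open S}" for X
      using op that by (simp add: \<mu>.emeasure_eq_measure \<nu>.emeasure_eq_measure)
  qed auto
qed

end

section \<open>From a positive functional to a Borel measure\<close>

locale positive_functional = dense_lattice D
  for D :: "('a::metric_space \<Rightarrow> real) set" +
  fixes L :: "('a \<Rightarrow> real) \<Rightarrow> real"
  assumes L_add: "\<lbrakk>f \<in> D; g \<in> D\<rbrakk> \<Longrightarrow> L (\<lambda>x. f x + g x) = L f + L g"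
    and L_scale: "f \<in> D \<Longrightarrow> L (\<lambda>x. c * f x) = c * L f"
    and L_nonneg: "\<lbrakk>f \<in> D; \<And>x. 0 \<le> f x\<rbrakk> \<Longrightarrow> 0 \<le> L f"
begin

lemma L_diff: "\<lbrakk>f \<in> D; g \<in> D\<rbrakk> \<Longrightarrow> L (\<lambda>x. f x - g x) = L f - L g"
  using L_add[OF _ D_scale[of g "-1"], of f] L_scale[of g "-1"] by simp

lemma L_mono: "\<lbrakk>f \<in> D; g \<in> D; \<And>x. f x \<le> g x\<rbrakk> \<Longrightarrow> L f \<le> L g"
  using L_nonneg[OF D_diff[of g f]] L_diff[of g f] by simp

lemma L_sum: "\<lbrakk>finite I; \<And>i. i \<in> I \<Longrightarrow> f i \<in> D\<rbrakk> \<Longrightarrow> L (\<lambda>x. \<Sum>i\<in>I. f i x) = (\<Sum>i\<in>I. L (f i))"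
proof (induction I rule: finite_induct)
  case empty
  show ?case using L_scale[OF D_one, of 0] by simp
next
  case (insert i I)
  then show ?case using L_add[of "f i" "\<lambda>x. \<Sum>i\<in>I. f i x"] by (simp add: D_sum)
qed

text \<open>The tests lie below the indicator of \<open>U\<close>, but their supports may reach the
  boundary of \<open>U\<close>; compactness is regained by truncating at a positive level.\<close>

definition tests :: "'a set \<Rightarrow> ('a \<Rightarrow> real) set" where
  "tests U = {\<phi> \<in> D. (\<forall>x. 0 \<le> \<phi> x \<and> \<phi> x \<le> 1) \<and> (\<forall>x. x \<notin> U \<longrightarrow> \<phi> x = 0)}"

definition content :: "'a set \<Rightarrow> ennreal" where
  "content U = (SUP \<phi>\<in>tests U. ennreal (L \<phi>))"

lemma zero_test: "(\<lambda>x. 0) \<in> tests U"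
  unfolding tests_def using D_const by simp

lemma content_upper: "\<phi> \<in> tests U \<Longrightarrow> ennreal (L \<phi>) \<le> content U"
  unfolding content_def by (rule SUP_upper)

lemma content_mono: "U \<subseteq> V \<Longrightarrow> content U \<le> content V"
  unfolding content_def by (rule SUP_subset_mono) (auto simp: tests_def)

lemma content_UNIV: "content UNIV = ennreal (L (\<lambda>x. 1))"
proof (rule antisym)
  show "content UNIV \<le> ennreal (L (\<lambda>x. 1))"
    unfolding content_def tests_def using D_one
    by (auto intro!: SUP_least ennreal_leI L_mono)
  show "ennreal (L (\<lambda>x. 1)) \<le> content UNIV"
    by (rule content_upper) (auto simp: tests_def D_one)
qed

text \<open>It suffices to bound \<open>L\<close> on the functions \<open>(\<phi> - d)\<^sup>+\<close>, which live on the compact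
  sets \<open>{\<phi> \<ge> d}\<close>.\<close>

lemma content_leI:
  assumes "\<And>\<phi> d. \<lbrakk>\<phi> \<in> tests U; d > 0\<rbrakk> \<Longrightarrow> ennreal (L (\<lambda>x. max 0 (\<phi> x - d))) \<le> c"
  shows "content U \<le> c"
  unfolding content_def
proof (rule SUP_least)
  fix \<phi> assume \<phi>: "\<phi> \<in> tests U"
  then have D: "\<phi> \<in> D" by (simp add: tests_def)
  have L1: "0 \<le> L (\<lambda>x. 1)" by (intro L_nonneg D_one) simp
  show "ennreal (L \<phi>) \<le> c"
  proof (rule ennreal_le_epsilon)
    fix e :: real assume e: "e > 0"
    define d where "d = e / (L (\<lambda>x. 1) + 1)"
    have d: "d > 0" "d * L (\<lambda>x. 1) \<le> e"
      unfolding d_def using e L1 by (auto simp: field_simps)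
    have D': "(\<lambda>x. max 0 (\<phi> x - d)) \<in> D" by (intro D_max D_diff D_const D)
    have "L \<phi> \<le> L (\<lambda>x. max 0 (\<phi> x - d) + d)"
      by (intro L_mono D_add D' D_const D) auto
    also have "\<dots> = L (\<lambda>x. max 0 (\<phi> x - d)) + d * L (\<lambda>x. 1)"
      using L_add[OF D' D_const, of d] L_scale[OF D_one, of d] by simp
    also have "\<dots> \<le> L (\<lambda>x. max 0 (\<phi> x - d)) + e" using d by simp
    finally have "ennreal (L \<phi>) \<le> ennreal (L (\<lambda>x. max 0 (\<phi> x - d)) + e)" by (rule ennreal_leI)
    also have "\<dots> = ennreal (L (\<lambda>x. max 0 (\<phi> x - d))) + ennreal e"
      using e by (intro ennreal_plus L_nonneg D') auto
    also have "\<dots> \<le> c + ennreal e" by (intro add_right_mono assms \<phi> d)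
    finally show "ennreal (L \<phi>) \<le> c + ennreal e" .
  qed
qed

lemma closed_superlevel: "\<phi> \<in> D \<Longrightarrow> closed {x. d \<le> \<phi> x}"
  by (intro closed_Collect_le D_continuous continuous_on_const)

text \<open>A truncated test is split additively rather than by multiplication with a partition of
  unity. The cutoff \<open>\<xi>\<close> lives in \<open>U\<close> and is 1 on the part of the level
  set outside \<open>V\<close>; the excess of the truncated test over \<open>\<xi>\<close> then
  vanishes outside \<open>V\<close>.\<close>

lemma content_Un:
  assumes "open U" "open V"
  shows "content (U \<union> V) \<le> content U + content V"
proof (rule content_leI)
  fix \<phi> and d :: real assume \<phi>: "\<phi> \<in> tests (U \<union> V)" and d: "d > 0"
  then have D: "\<phi> \<in> D" by (simp add: tests_def)
  let ?\<phi> = "\<lambda>x. max 0 (\<phi> x - d)"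
  have D': "?\<phi> \<in> D" by (intro D_max D_diff D_const D)
  have "{x. d \<le> \<phi> x} - V \<subseteq> U" using \<phi> d by (fastforce simp: tests_def)
  then obtain \<xi> where \<xi>: "\<xi> \<in> D" "\<And>x. 0 \<le> \<xi> x" "\<And>x. \<xi> x \<le> 1"
      "\<And>x. x \<in> {x. d \<le> \<phi> x} - V \<Longrightarrow> \<xi> x = 1" "closure {x. \<xi> x \<noteq> 0} \<subseteq> U"
    using cutoff[of "{x. d \<le> \<phi> x} - V" U] closed_superlevel[OF D] assms by (metis closed_Diff)
  let ?\<psi> = "\<lambda>x. max 0 (?\<phi> x - \<xi> x)"
  have \<psi>D: "?\<psi> \<in> D" by (intro D_max D_diff D' \<xi>)
  have "\<xi> \<in> tests U"
    using \<xi> closure_subset[of "{x. \<xi> x \<noteq> 0}"] unfolding tests_def by blast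
  moreover have "?\<psi> \<in> tests V"
  proof -
    have "\<phi> x \<le> 1" for x using \<phi> by (auto simp: tests_def)
    then have "?\<psi> x \<le> 1" for x using \<xi>(2)[of x] d by (smt (verit))
    moreover have "?\<psi> x = 0" if "x \<notin> V" for x
    proof (cases "d \<le> \<phi> x")
      case True
      then have "\<xi> x = 1" "\<phi> x \<le> 1" using \<xi>(4)[of x] that \<phi> by (auto simp: tests_def)
      then show ?thesis using d by auto
    next
      case False
      then show ?thesis using \<xi>(2)[of x] by auto
    qed
    ultimately show ?thesis unfolding tests_def using \<psi>D by auto
  qed
  moreover have "L ?\<phi> \<le> L (\<lambda>x. \<xi> x + ?\<psi> x)"
    by (intro L_mono D_add \<xi> \<psi>D D') auto
  then have "ennreal (L ?\<phi>) \<le> ennreal (L \<xi>) + ennreal (L ?\<psi>)"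
    using L_add[OF \<xi>(1) \<psi>D] L_nonneg[OF \<xi>(1,2)] L_nonneg[OF \<psi>D]
    by (simp add: ennreal_leI flip: ennreal_plus)
  ultimately show "ennreal (L ?\<phi>) \<le> content U + content V"
    by (meson add_mono content_upper order_trans)
qed

lemma content_UN_finite:
  "(\<And>i. open (U i)) \<Longrightarrow> content (\<Union>i<n. U i) \<le> (\<Sum>i<n. content (U i))" for U :: "nat \<Rightarrow> 'a set"
proof (induction n)
  case 0
  have "L \<phi> = 0" if "\<phi> \<in> tests {}" for \<phi>
  proof -
    have "\<phi> = (\<lambda>x. 0)" using that unfolding tests_def by auto
    then show ?thesis using L_scale[OF D_one, of 0] by simp
  qed
  then have "content {} \<le> 0" unfolding content_def by (intro SUP_least) auto
  then show ?case by simp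
next
  case (Suc n)
  have "content (\<Union>i<Suc n. U i) = content ((\<Union>i<n. U i) \<union> U n)"
    by (simp add: lessThan_Suc Un_commute)
  also have "\<dots> \<le> content (\<Union>i<n. U i) + content (U n)"
    by (intro content_Un open_UN Suc.prems ballI)
  also have "\<dots> \<le> (\<Sum>i<Suc n. content (U i))"
    using Suc by (simp add: add_right_mono)
  finally show ?case .
qed

text \<open>The level set of a test at a positive height is compact, so finitely many of the
  \<open>U i\<close> already carry the truncated test.\<close>

lemma content_UN:
  fixes U :: "nat \<Rightarrow> 'a set"
  assumes "\<And>i. open (U i)"
  shows "content (\<Union>i. U i) \<le> (\<Sum>i. content (U i))"
proof (rule content_leI)
  fix \<phi> and d :: real assume \<phi>: "\<phi> \<in> tests (\<Union>i. U i)" and d: "d > 0"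
  then have D: "\<phi> \<in> D" by (simp add: tests_def)
  have D': "(\<lambda>x. max 0 (\<phi> x - d)) \<in> D" by (intro D_max D_diff D_const D)
  have "compact {x. d \<le> \<phi> x}"
    using closed_superlevel[OF D] compact_space compact_Int_closed by fastforce
  moreover have "{x. d \<le> \<phi> x} \<subseteq> (\<Union>i. U i)"
    using \<phi> d by (fastforce simp: tests_def)
  ultimately obtain I where I: "finite I" "{x. d \<le> \<phi> x} \<subseteq> (\<Union>i\<in>I. U i)"
    using compactE_image[of "{x. d \<le> \<phi> x}" UNIV U] assms by (metis subset_UNIV)
  obtain n where "I \<subseteq> {..<n}" using I(1) finite_nat_iff_bounded by blast
  then have sub: "{x. d \<le> \<phi> x} \<subseteq> (\<Union>i<n. U i)" using I(2) by blast
  have "(\<lambda>x. max 0 (\<phi> x - d)) \<in> tests (\<Union>i<n. U i)"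
  proof -
    have "\<phi> x \<le> 1" for x using \<phi> by (auto simp: tests_def)
    then have "max 0 (\<phi> x - d) \<le> 1" for x using d by (smt (verit))
    moreover have "max 0 (\<phi> x - d) = 0" if "x \<notin> (\<Union>i<n. U i)" for x
      using sub that by (cases "d \<le> \<phi> x") auto
    ultimately show ?thesis unfolding tests_def using D' by auto
  qed
  then have "ennreal (L (\<lambda>x. max 0 (\<phi> x - d))) \<le> content (\<Union>i<n. U i)" by (rule content_upper)
  also have "\<dots> \<le> (\<Sum>i<n. content (U i))" by (rule content_UN_finite[OF assms])
  also have "\<dots> \<le> (\<Sum>i. content (U i))" by (intro sum_le_suminf) auto
  finally show "ennreal (L (\<lambda>x. max 0 (\<phi> x - d))) \<le> (\<Sum>i. content (U i))" .
qed

definition outer :: "'a set \<Rightarrow> ennreal" where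
  "outer A = (INF U\<in>{U. open U \<and> A \<subseteq> U}. content U)"

lemma outer_open: "open U \<Longrightarrow> outer U = content U"
  unfolding outer_def by (intro antisym INF_lower INF_greatest) (auto intro: content_mono)

lemma outer_mono: "A \<subseteq> B \<Longrightarrow> outer A \<le> outer B"
  unfolding outer_def by (intro INF_superset_mono) auto

lemma outer_close:
  assumes "outer A < c"
  obtains U where "open U" "A \<subseteq> U" "content U < c"
  using assms unfolding outer_def INF_less_iff by auto

lemma outer_finite: "outer A < top"
  using outer_mono[of A UNIV] by (simp add: outer_open content_UNIV le_less_trans[OF _ ennreal_less_top])

lemma outer_measure_space: "outer_measure_space (Pow UNIV) outer"
  unfolding outer_measure_space_def
proof (intro conjI)
  have "outer {} \<le> 0" using content_UN_finite[of "\<lambda>_. {}" 0] by (simp add: outer_open)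
  then show "positive (Pow UNIV) outer" by (simp add: positive_def)
  show "increasing (Pow UNIV) outer" by (simp add: increasing_def outer_mono)
  show "countably_subadditive (Pow UNIV) outer"
    unfolding countably_subadditive_def
  proof (intro allI impI)
    fix A :: "nat \<Rightarrow> 'a set"
    show "outer (\<Union>i. A i) \<le> (\<Sum>n. outer (A n))"
    proof (rule ennreal_le_epsilon)
      fix e :: real assume e: "0 < e"
      have "outer (A n) < outer (A n) + e * (1/2)^Suc n" for n
        using outer_finite[of "A n"] e by (simp add: less_top)
      then have "\<exists>U. open U \<and> A n \<subseteq> U \<and> content U \<le> outer (A n) + e * (1/2)^Suc n" for n
        by (meson outer_close less_imp_le)
      then obtain U where U: "\<And>n. open (U n)" "\<And>n. A n \<subseteq> U n"
        "\<And>n. content (U n) \<le> outer (A n) + e * (1/2)^Suc n" by metis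
      have "outer (\<Union>i. A i) \<le> outer (\<Union>i. U i)" using U(2) by (intro outer_mono) blast
      also have "\<dots> = content (\<Union>i. U i)" using U(1) by (intro outer_open open_UN) auto
      also have "\<dots> \<le> (\<Sum>i. content (U i))" by (rule content_UN[OF U(1)])
      also have "\<dots> \<le> (\<Sum>n. outer (A n) + e * (1/2) ^ Suc n)" by (intro suminf_le U) auto
      also have "\<dots> = (\<Sum>n. outer (A n)) + (\<Sum>n. ennreal e * ennreal ((1/2) ^ Suc n))"
        using e by (subst suminf_add[symmetric])
          (auto simp del: ennreal_suminf_cmult simp add: ennreal_mult[symmetric])
      also have "\<dots> = (\<Sum>n. outer (A n)) + e"
        unfolding ennreal_suminf_cmult
        by (subst suminf_ennreal_eq[OF zero_le_power power_half_series]) auto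
      finally show "outer (\<Union>i. A i) \<le> (\<Sum>n. outer (A n)) + e" .
    qed
  qed
qed

text \<open>The nontrivial half of the Caratheodory condition for open \<open>U\<close>, tested on
  open \<open>G\<close>. A truncated test of \<open>G \<inter> U\<close> and a test of
  \<open>G\<close> minus the corresponding level set are never both nonzero at a point, so their sum
  is again a test of \<open>G\<close>.\<close>

lemma content_split:
  assumes "open U" "open G"
  shows "content (G \<inter> U) + outer (G - U) \<le> content G"
proof -
  have "content (G \<inter> U) \<le> content G - outer (G - U)"
  proof (rule content_leI)
    fix \<phi> and d :: real assume \<phi>: "\<phi> \<in> tests (G \<inter> U)" and d: "d > 0"
    then have D: "\<phi> \<in> D" by (simp add: tests_def)
    let ?\<phi> = "\<lambda>x. max 0 (\<phi> x - d)"
    have D': "?\<phi> \<in> D" by (intro D_max D_diff D_const D)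
    define H where "H = G - {x. d \<le> \<phi> x}"
    have H: "open H" "G - U \<subseteq> H"
      unfolding H_def using assms closed_superlevel[OF D] \<phi> d by (auto simp: tests_def)
    have "ennreal (L ?\<phi>) + content H \<le> content G"
    proof -
      have "ennreal (L ?\<phi>) + ennreal (L \<psi>) \<le> content G" if \<psi>: "\<psi> \<in> tests H" for \<psi>
      proof -
        have \<psi>D: "\<psi> \<in> D" using \<psi> by (simp add: tests_def)
        have "(\<lambda>x. ?\<phi> x + \<psi> x) \<in> tests G"
        proof -
          have "?\<phi> x + \<psi> x \<le> 1" for x
          proof (cases "d \<le> \<phi> x")
            case True
            then have "\<psi> x = 0" "\<phi> x \<le> 1" using \<psi> \<phi> by (auto simp: tests_def H_def)
            then show ?thesis using d by auto
          next
            case False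
            then show ?thesis using \<psi> by (auto simp: tests_def)
          qed
          moreover have "?\<phi> x + \<psi> x = 0" if "x \<notin> G" for x
            using that \<phi> \<psi> d by (auto simp: tests_def H_def)
          moreover have "0 \<le> ?\<phi> x + \<psi> x" for x
            using \<psi> by (auto simp: tests_def)
          ultimately show ?thesis unfolding tests_def using D_add[OF D' \<psi>D] by auto
        qed
        then have "ennreal (L (\<lambda>x. ?\<phi> x + \<psi> x)) \<le> content G" by (rule content_upper)
        moreover have "0 \<le> L ?\<phi>" "0 \<le> L \<psi>"
          using \<psi> by (auto intro!: L_nonneg D' \<psi>D simp: tests_def)
        ultimately show ?thesis using L_add[OF D' \<psi>D] by simp
      qed
      then have "ennreal (L \<psi>) \<le> content G - ennreal (L ?\<phi>)" if "\<psi> \<in> tests H" for \<psi>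
        using that by (simp add: ennreal_le_minus_iff add.commute)
      then have "content H \<le> content G - ennreal (L ?\<phi>)"
        unfolding content_def[of H] by (intro SUP_least)
      moreover have "ennreal (L ?\<phi>) \<le> content G"
        using \<open>\<And>\<psi>. \<psi> \<in> tests H \<Longrightarrow> ennreal (L ?\<phi>) + ennreal (L \<psi>) \<le> content G\<close>[OF zero_test]
        by (meson le_iff_add order_trans)
      ultimately show ?thesis by (metis add_left_mono add_diff_inverse_ennreal)
    qed
    moreover have "outer (G - U) \<le> content H"
      using outer_mono[OF H(2)] outer_open[OF H(1)] by simp
    ultimately have "ennreal (L ?\<phi>) + outer (G - U) \<le> content G"
      by (meson add_left_mono order_trans)
    then show "ennreal (L ?\<phi>) \<le> content G - outer (G - U)"
      using outer_finite[of "G - U"] by (simp add: ennreal_le_minus_iff add.commute less_top)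
  qed
  moreover have "outer (G - U) \<le> content G"
    using outer_mono[of "G - U" G] outer_open[OF assms(2)] by simp
  ultimately show ?thesis by (metis add.commute add_left_mono add_diff_inverse_ennreal)
qed

lemma open_lambda_system:
  assumes "open U"
  shows "U \<in> lambda_system UNIV (Pow UNIV) outer"
proof -
  have sub: "outer A \<le> outer (A \<inter> U) + outer (A - U)" for A
  proof -
    interpret sigma_algebra UNIV "Pow UNIV :: 'a set set" by (rule sigma_algebra_Pow)
    have "subadditive (Pow UNIV) outer"
      using outer_measure_space unfolding outer_measure_space_def
      by (intro countably_subadditive_subadditive) auto
    then have "outer ((A \<inter> U) \<union> (A - U)) \<le> outer (A \<inter> U) + outer (A - U)"
      by (intro subadditiveD) auto
    then show ?thesis by (simp add: Int_Diff_Un)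
  qed
  moreover have "outer (A \<inter> U) + outer (A - U) \<le> outer A" for A
    unfolding outer_def[of A]
  proof (rule INF_greatest)
    fix G assume "G \<in> {G. open G \<and> A \<subseteq> G}"
    then have G: "open G" "A \<subseteq> G" by auto
    have "outer (A \<inter> U) + outer (A - U) \<le> content (G \<inter> U) + outer (G - U)"
      using G outer_mono[of "A \<inter> U" "G \<inter> U"] outer_open[OF open_Int[OF G(1) assms]]
        outer_mono[of "A - U" "G - U"]
      by (intro add_mono) auto
    also have "\<dots> \<le> content G" by (rule content_split[OF assms G(1)])
    finally show "outer (A \<inter> U) + outer (A - U) \<le> content G" .
  qed
  ultimately show ?thesis
    unfolding algebra.lambda_system_eq[OF algebra_Pow] by (auto intro: antisym)
qed

definition riesz_measure :: "'a measure" where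
  "riesz_measure = measure_of UNIV (sets borel) outer"

lemma sets_riesz [simp]: "sets riesz_measure = sets borel"
  unfolding riesz_measure_def using sigma_algebra.sets_measure_of_eq[OF sets.sigma_algebra_axioms, of borel]
  by simp

lemma emeasure_riesz:
  assumes "B \<in> sets borel"
  shows "emeasure riesz_measure B = outer B"
proof -
  have ms: "measure_space UNIV (lambda_system UNIV (Pow UNIV) outer) outer"
    by (rule sigma_algebra.caratheodory_lemma[OF sigma_algebra_Pow outer_measure_space])
  then interpret sigma_algebra UNIV "lambda_system UNIV (Pow UNIV) outer"
    by (simp add: measure_space_def)
  have "sets borel \<subseteq> lambda_system UNIV (Pow UNIV) outer"
  proof -
    have "{S. open S} \<subseteq> lambda_system UNIV (Pow UNIV) outer" using open_lambda_system by blast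
    moreover have "sets borel = sigma_sets UNIV {S :: 'a set. open S}" by (simp add: borel_def)
    ultimately show ?thesis using sigma_sets_subset by metis
  qed
  then have "measure_space UNIV (sets borel) outer"
    using measure_down[OF ms] sets.sigma_algebra_axioms[of borel] by simp
  then show ?thesis
    unfolding riesz_measure_def using assms
    by (intro emeasure_measure_of_sigma) (auto simp: measure_space_def)
qed

lemma emeasure_riesz_open: "open U \<Longrightarrow> emeasure riesz_measure U = content U"
  by (simp add: emeasure_riesz outer_open)

lemma space_riesz [simp]: "space riesz_measure = UNIV"
  using sets_eq_imp_space_eq[OF sets_riesz] by simp

lemma finite_riesz: "finite_measure riesz_measure"
  by (intro finite_measureI) (simp add: emeasure_riesz_open content_UNIV)

section \<open>Layer-cake comparison of the functional with the integral\<close>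

lemma sum_clamp: "t \<ge> 0 \<Longrightarrow> (\<Sum>k<n. min 1 (max 0 (t - real k))) = min (real n) t"
  by (induction n) (auto simp: min_def max_def)

lemma sum_of_bool_le:
  assumes "t \<ge> 0"
  shows "(\<Sum>k<n. of_bool (real k < t)) \<le> t + 1"
proof -
  have "(\<Sum>k<n. of_bool (real k < t)) \<le> (\<Sum>k<Suc n. of_bool (real k < t) :: real)" by simp
  also have "\<dots> = of_bool (real 0 < t) + (\<Sum>k<n. of_bool (real (Suc k) < t))"
    by (rule sum.lessThan_Suc_shift)
  \<comment> \<open>Where \<open>t\<close> exceeds \<open>Suc k\<close> the layer number
    \<open>k\<close> is full; the shift by one is the origin of the error term 1.\<close>
  also have "(\<Sum>k<n. of_bool (real (Suc k) < t)) \<le> (\<Sum>k<n. min 1 (max 0 (t - real k)))"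
    by (intro sum_mono) (auto simp: min_def max_def)
  also have "\<dots> = min (real n) t" by (rule sum_clamp[OF assms])
  finally have "(\<Sum>k<n. of_bool (real k < t)) \<le> of_bool (real 0 < t) + min (real n) t" by simp
  also have "\<dots> \<le> t + 1" using assms by (auto simp: min_def)
  finally show ?thesis .
qed

text \<open>With \<open>N = Suc n\<close>, the function \<open>N f\<close> is a sum of layers, layer
  \<open>k\<close> being a test of the open set where \<open>N f > k\<close>. At each point at most
  \<open>N f + 1\<close> of these sets occur, so the error after division by \<open>N\<close> is the
  total mass over \<open>N\<close>.\<close>

lemma L_le_integral_unit:
  assumes f: "f \<in> D" and rng: "\<And>x. 0 \<le> f x \<and> f x \<le> 1"
  shows "L f \<le> (\<integral>x. f x \<partial>riesz_measure)"
proof -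
  interpret finite_measure riesz_measure by (rule finite_riesz)
  have "real (Suc n) * L f \<le> real (Suc n) * (\<integral>x. f x \<partial>riesz_measure) + measure riesz_measure UNIV" for n
  proof -
    let ?n = "Suc n"
    let ?\<chi> = "\<lambda>k x. min 1 (max 0 (real ?n * f x - real k))"
    let ?U = "\<lambda>k. {x. real k < real ?n * f x}"
    have \<chi>D: "?\<chi> k \<in> D" for k by (intro D_clamp D_diff D_scale D_const f)
    have U: "open (?U k)" for k
      by (intro open_Collect_less continuous_intros D_continuous f)
    have ind: "measure riesz_measure (?U k) = (\<integral>x. of_bool (real k < real ?n * f x) \<partial>riesz_measure)"
      "integrable riesz_measure (\<lambda>x. of_bool (real k < real ?n * f x) :: real)" for k
    proof -
      have e: "(\<lambda>x. of_bool (real k < real ?n * f x) :: real) = indicator (?U k)"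
        by (auto simp: indicator_def)
      have "?U k \<in> sets riesz_measure" using U by simp
      then show "measure riesz_measure (?U k) = (\<integral>x. of_bool (real k < real ?n * f x) \<partial>riesz_measure)"
        "integrable riesz_measure (\<lambda>x. of_bool (real k < real ?n * f x) :: real)"
        unfolding e by (auto simp: less_top[symmetric])
    qed
    have "real ?n * L f = L (\<lambda>x. real ?n * f x)" using L_scale[OF f] by simp
    also have "(\<lambda>x. real ?n * f x) = (\<lambda>x. \<Sum>k<?n. ?\<chi> k x)"
    proof
      fix x
      have "real ?n * f x \<le> real ?n * 1" by (intro mult_left_mono) (use rng in auto)
      then show "real ?n * f x = (\<Sum>k<?n. ?\<chi> k x)"
        using sum_clamp[of "real ?n * f x" ?n] rng[of x] by simp
    qed
    also have "L (\<lambda>x. \<Sum>k<?n. ?\<chi> k x) = (\<Sum>k<?n. L (?\<chi> k))"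
      using \<chi>D by (intro L_sum) auto
    also have "\<dots> \<le> (\<Sum>k<?n. measure riesz_measure (?U k))"
    proof (rule sum_mono)
      fix k
      have "?\<chi> k \<in> tests (?U k)" using \<chi>D unfolding tests_def by auto
      then have "ennreal (L (?\<chi> k)) \<le> emeasure riesz_measure (?U k)"
        using content_upper emeasure_riesz_open[OF U] by simp
      then show "L (?\<chi> k) \<le> measure riesz_measure (?U k)"
        by (simp add: emeasure_eq_measure)
    qed
    also have "\<dots> = (\<integral>x. (\<Sum>k<?n. of_bool (real k < real ?n * f x)) \<partial>riesz_measure)"
      by (subst Bochner_Integration.integral_sum) (auto intro: ind(2) simp del: of_nat_Suc simp: ind(1))
    also have "\<dots> \<le> (\<integral>x. real ?n * f x + 1 \<partial>riesz_measure)"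
    proof (rule integral_mono)
      show "integrable riesz_measure (\<lambda>x. real ?n * f x + 1)"
        using finite_measure_integrable[OF f sets_riesz finite_riesz] by simp
      show "integrable riesz_measure (\<lambda>x. \<Sum>k<?n. of_bool (real k < real ?n * f x) :: real)"
        by (rule Bochner_Integration.integrable_sum) (rule ind(2))
      show "(\<Sum>k<?n. of_bool (real k < real ?n * f x)) \<le> real ?n * f x + 1" for x
        by (rule sum_of_bool_le) (use rng in simp)
    qed
    also have "\<dots> = real ?n * (\<integral>x. f x \<partial>riesz_measure) + measure riesz_measure UNIV"
      using finite_measure_integrable[OF f sets_riesz finite_riesz] by simp
    finally show ?thesis .
  qed
  then have "L f \<le> (\<integral>x. f x \<partial>riesz_measure) + measure riesz_measure UNIV / real (Suc n)" for n
    by (simp add: field_simps)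
  moreover have "(\<lambda>n. (\<integral>x. f x \<partial>riesz_measure) + measure riesz_measure UNIV / real (Suc n))
      \<longlonglongrightarrow> (\<integral>x. f x \<partial>riesz_measure) + 0"
    by (intro tendsto_intros) (rule LIMSEQ_Suc, rule lim_const_over_n)
  ultimately show ?thesis by (intro LIMSEQ_le_const[where X = "\<lambda>n. (\<integral>x. f x \<partial>riesz_measure)
      + measure riesz_measure UNIV / real (Suc n)"]) auto
qed

text \<open>An affine map takes [-C, C] to the unit interval. Constants may be added freely because
  \<open>L\<close> of the constant 1 is exactly the total mass.\<close>

lemma L_le_integral:
  assumes f: "f \<in> D"
  shows "L f \<le> (\<integral>x. f x \<partial>riesz_measure)"
proof -
  interpret finite_measure riesz_measure by (rule finite_riesz)
  obtain C where C: "C > 0" "\<And>x. \<bar>f x\<bar> \<le> C" by (rule D_bounded[OF f]) blast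
  let ?g = "\<lambda>x. (1 / (2 * C)) * (f x + C)"
  have gD: "(\<lambda>x. f x + C) \<in> D" "?g \<in> D" by (intro D_scale D_add D_const f)+
  have rng: "0 \<le> ?g x \<and> ?g x \<le> 1" for x
    using C(1) C(2)[of x] by (auto simp: field_simps)
  have one: "L (\<lambda>x. 1) = measure riesz_measure UNIV"
    using emeasure_riesz_open[of UNIV] L_nonneg[OF D_one] by (simp add: content_UNIV emeasure_eq_measure)
  have "L ?g = (1 / (2 * C)) * (L f + C * L (\<lambda>x. 1))"
    unfolding L_scale[OF gD(1)] using L_add[OF f D_const, of C] L_scale[OF D_one, of C] by simp
  moreover have "(\<integral>x. ?g x \<partial>riesz_measure)
      = (1 / (2 * C)) * ((\<integral>x. f x \<partial>riesz_measure) + C * measure riesz_measure UNIV)"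
    using finite_measure_integrable[OF f sets_riesz finite_riesz] by simp
  moreover have "L ?g \<le> (\<integral>x. ?g x \<partial>riesz_measure)" by (rule L_le_integral_unit[OF gD(2) rng])
  ultimately have "L f + C * L (\<lambda>x. 1) \<le> (\<integral>x. f x \<partial>riesz_measure) + C * measure riesz_measure UNIV"
    using C(1) by (simp add: divide_le_cancel)
  then show ?thesis using one by simp
qed

lemma integral_riesz:
  assumes f: "f \<in> D"
  shows "(\<integral>x. f x \<partial>riesz_measure) = L f"
proof (rule antisym)
  have "L (\<lambda>x. (-1) * f x) \<le> (\<integral>x. (-1) * f x \<partial>riesz_measure)" by (intro L_le_integral D_scale f)
  then show "(\<integral>x. f x \<partial>riesz_measure) \<le> L f" using L_scale[OF f, of "-1"] by simp
qed (rule L_le_integral[OF f])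

text \<open>Supplies the uniqueness that the definite description of the energy measure
  requires.\<close>

lemma riesz_unique:
  assumes "sets \<nu> = sets borel" "finite_measure \<nu>" "\<And>f. f \<in> D \<Longrightarrow> (\<integral>x. f x \<partial>\<nu>) = L f"
  shows "\<nu> = riesz_measure"
  by (rule measure_eqI_D) (use assms finite_riesz integral_riesz in auto)

end

section \<open>Energy measures of a strongly local form\<close>

lemma real_vec_Basis: "(Basis :: (real ^ 'n) set) = range (\<lambda>j. axis j 1)"
  unfolding Basis_vec_def by auto

lemma sum_Basis_vec: "(\<Sum>i\<in>(Basis :: (real ^ 'n) set). g i) = (\<Sum>j\<in>UNIV. g (axis j 1))"
  unfolding real_vec_Basis
  by (subst sum.reindex) (auto intro!: injI simp: axis_eq_axis)

lemma supp_subset: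
  assumes "closed S" "\<And>x. x \<notin> S \<Longrightarrow> f x = 0"
  shows "supp M f \<subseteq> S"
proof -
  have "- S \<in> {U. open U \<and> (AE x in M. x \<in> U \<longrightarrow> f x = 0)}"
    using assms by auto
  then show ?thesis unfolding supp_def by blast
qed

locale strongly_local_form = dirichlet_form M E F
  for M :: "'a::metric_space measure" and E F +
  assumes compact_K: "compact (UNIV :: 'a set)"
    and borel_M: "sets M = sets borel"
    and finite_M: "finite_measure M"
    and regular: "regular_form M E F"
    and strong_local: "strong_local M E F"
begin

lemma compact_supp: "compact (supp M f)"
proof -
  have "closed (supp M f)" unfolding supp_def by (intro closed_Compl open_Union) auto
  then show ?thesis using compact_Int_closed[OF compact_K] by force
qed

lemma form_local:
  assumes "f \<in> F" "g \<in> F" "open U" "supp M f \<subseteq> U" "\<And>x. x \<in> U \<Longrightarrow> g x = c"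
  shows "E f g = 0"
proof -
  have "AE x in M. x \<in> U \<longrightarrow> g x = c" using assms(5) by simp
  then have "\<exists>U c. open U \<and> supp M f \<subseteq> U \<and> (AE x in M. x \<in> U \<longrightarrow> g x = c)"
    using assms(3,4) by blast
  then show ?thesis using strong_local assms(1,2) compact_supp[of f] compact_supp[of g]
    unfolding strong_local_def by simp
qed

lemma uniform_approx: "\<lbrakk>continuous_on UNIV f; e > 0\<rbrakk> \<Longrightarrow> \<exists>g\<in>F. continuous_on UNIV g \<and> (\<forall>x. \<bar>f x - g x\<bar> < e)"
  using regular unfolding regular_form_def by blast

text \<open>A function in \<open>F\<close> within distance 1 of the constant 2 has the constant 1 as
  its unit truncation. Strong locality, with the whole space as neighbourhood, makes the constant 1
  orthogonal to \<open>F\<close>.\<close>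

sublocale conservative_form M E F
proof (intro conservative_form.intro conservative_form_axioms.intro dirichlet_form_axioms finite_M)
  obtain g where g: "g \<in> F" "\<And>x. \<bar>2 - g x\<bar> < 1"
    using uniform_approx[of "\<lambda>x. 2" 1] by auto
  have "min 1 (max 0 (g x)) = 1" for x using g(2)[of x] by auto
  then show one: "(\<lambda>x. 1) \<in> F" using markov_domain[OF g(1)] by simp
  show "E (\<lambda>x. 1) f = 0" if "f \<in> F" for f
    using form_local[OF that one open_UNIV] form_sym[OF one that] by simp
qed

definition D :: "('a \<Rightarrow> real) set" where "D = {f \<in> F. continuous_on UNIV f}"

lemma D_F: "f \<in> D \<Longrightarrow> f \<in> F" and D_cont: "f \<in> D \<Longrightarrow> continuous_on UNIV f"
  by (auto simp: D_def)

lemma continuous_bounded_measurable: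
  assumes "continuous_on UNIV f"
  shows "f \<in> bounded_measurable M"
proof -
  have "bounded (range f)"
    using compact_continuous_image[OF assms compact_K] by (rule compact_imp_bounded)
  then obtain C where "\<And>x. \<bar>f x\<bar> \<le> C" unfolding bounded_iff by auto
  moreover have "f \<in> borel_measurable M"
    using borel_measurable_continuous_onI[OF assms] measurable_cong_sets[OF borel_M refl] by blast
  ultimately show ?thesis by (rule bounded_measurableI[rotated])
qed

lemma D_bm: "f \<in> D \<Longrightarrow> f \<in> bounded_measurable M"
  by (intro continuous_bounded_measurable D_cont)

lemma dense_lattice_D: "dense_lattice D"
proof (rule dense_lattice.intro)
  fix f assume f: "f \<in> D"
  have c: "continuous_on UNIV (\<lambda>x. max 0 (f x))"
    by (intro continuous_on_max continuous_on_const D_cont f)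
  have "(\<lambda>x. max 0 (f x)) \<in> F"
  proof (rule lipschitz_domain[where h = f])
    show "\<bar>max 0 (f x) - max 0 (f y)\<bar> \<le> norm (f x - f y)" for x y by auto
  qed (use f c in \<open>simp_all add: D_bm D_F continuous_bounded_measurable\<close>)
  then show "(\<lambda>x. max 0 (f x)) \<in> D" using c by (simp add: D_def)
next
  fix f g assume "f \<in> D" "g \<in> D"
  then show "(\<lambda>x. f x + g x) \<in> D"
    using domain_add[of f g] continuous_on_add[of UNIV f g] by (simp add: D_def)
next
  fix f c assume "f \<in> D"
  then show "(\<lambda>x. c * f x) \<in> D"
    using domain_scale[of f c] continuous_on_mult_left[of UNIV f c] by (simp add: D_def)
next
  fix f :: "'a \<Rightarrow> real" and e :: real
  assume "continuous_on UNIV f" "e > 0"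
  then show "\<exists>g\<in>D. \<forall>x. \<bar>f x - g x\<bar> < e"
    using uniform_approx[of f e] unfolding D_def by blast
next
  show "(\<lambda>x. 1) \<in> D" using one_in by (simp add: D_def)
qed (use compact_K D_cont in blast)+

sublocale dense_lattice D by (rule dense_lattice_D)

lemma D_mult: "\<lbrakk>f \<in> D; g \<in> D\<rbrakk> \<Longrightarrow> (\<lambda>x. f x * g x) \<in> D"
  using domain_mult[of f g] D_bm[of f] D_bm[of g] continuous_on_mult[of UNIV f g] by (simp add: D_def)

lemma D_prod: "\<lbrakk>finite I; \<And>i. i \<in> I \<Longrightarrow> f i \<in> D\<rbrakk> \<Longrightarrow> (\<lambda>x. \<Prod>i\<in>I. f i x) \<in> D"
proof (induction I rule: finite_induct)
  case empty
  show ?case using D_one by simp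
next
  case (insert i I)
  then show ?case using D_mult[of "f i" "\<lambda>x. \<Prod>i\<in>I. f i x"] by simp
qed

lemma energy_functional: "f \<in> D \<Longrightarrow> positive_functional D (energy_integral f)"
  by unfold_locales
    (auto simp: energy_integral_add energy_integral_scale energy_integral_nonneg D_F D_bm)

text \<open>Resolves the definite description: a continuous function on a compact space falls under
  the bounded case, where the Riesz measure is the only candidate.\<close>

lemma energy_measure_eq:
  assumes f: "f \<in> D"
  shows "energy_measure M E F f = positive_functional.riesz_measure D (energy_integral f)"
proof -
  interpret P: positive_functional D "energy_integral f" by (rule energy_functional[OF f])
  obtain C where "\<And>x. \<bar>f x\<bar> \<le> C" by (rule D_bounded[OF f]) blast
  then have "energy_measure M E F f = energy_measure_bounded E F f"
    unfolding energy_measure_def by (auto intro!: AE_I2)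
  also have "\<dots> = P.riesz_measure"
    unfolding energy_measure_bounded_def
  proof (rule the_equality)
    show "sets P.riesz_measure = sets borel \<and> finite_measure P.riesz_measure \<and>
      (\<forall>\<phi>\<in>F. continuous_on UNIV \<phi> \<longrightarrow> (\<integral>x. \<phi> x \<partial>P.riesz_measure)
        = 2 * E f (\<lambda>x. f x * \<phi> x) - E (\<lambda>x. (f x)\<^sup>2) \<phi>)"
    proof (intro conjI ballI impI P.sets_riesz P.finite_riesz)
      fix \<phi> assume "\<phi> \<in> F" "continuous_on UNIV \<phi>"
      then have D: "\<phi> \<in> D" by (simp add: D_def)
      show "(\<integral>x. \<phi> x \<partial>P.riesz_measure) = 2 * E f (\<lambda>x. f x * \<phi> x) - E (\<lambda>x. (f x)\<^sup>2) \<phi>"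
        unfolding P.integral_riesz[OF D] by (rule energy_integral_def)
    qed
    show "\<nu> = P.riesz_measure" if "sets \<nu> = sets borel \<and> finite_measure \<nu> \<and>
      (\<forall>\<phi>\<in>F. continuous_on UNIV \<phi> \<longrightarrow> (\<integral>x. \<phi> x \<partial>\<nu>)
        = 2 * E f (\<lambda>x. f x * \<phi> x) - E (\<lambda>x. (f x)\<^sup>2) \<phi>)" for \<nu>
      using that by (intro P.riesz_unique) (auto simp: D_def energy_integral_def)
  qed
  finally show ?thesis .
qed

text \<open>The measures of the \<open>g j\<close> are outer regular by construction, so
  \<open>B\<close> can be enlarged to an open set at small cost. There the measure of
  \<open>f\<close> is a supremum over tests, to which \<open>le\<close> applies. One open set must
  serve all \<open>j\<close>, hence the finite intersection and the share \<open>d\<close> of the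
  error.\<close>

lemma energy_measure_mono:
  assumes f: "f \<in> D" and g: "\<And>j. j \<in> J \<Longrightarrow> g j \<in> D" and J: "finite J" "J \<noteq> {}"
    and le: "\<And>\<phi>. \<lbrakk>\<phi> \<in> D; \<And>x. 0 \<le> \<phi> x\<rbrakk>
      \<Longrightarrow> energy_integral f \<phi> \<le> (\<Sum>j\<in>J. energy_integral (g j) \<phi>)"
    and B: "B \<in> sets borel"
  shows "emeasure (energy_measure M E F f) B \<le> (\<Sum>j\<in>J. emeasure (energy_measure M E F (g j)) B)"
proof (rule ennreal_le_epsilon)
  fix e :: real assume e: "e > 0"
  define d where "d = e / real (card J)"
  have cJ: "card J > 0" using J by (simp add: card_gt_0_iff)
  have d: "d > 0" unfolding d_def using e cJ by simp
  let ?\<nu> = "\<lambda>f. energy_measure M E F f"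
  have "\<exists>G. open G \<and> B \<subseteq> G \<and> emeasure (?\<nu> (g j)) G \<le> emeasure (?\<nu> (g j)) B + ennreal d"
    if j: "j \<in> J" for j
  proof -
    interpret P: positive_functional D "energy_integral (g j)" by (rule energy_functional[OF g[OF j]])
    have "P.outer B < P.outer B + ennreal d"
      using P.outer_finite[of B] d by (simp add: less_top)
    then obtain G where "open G" "B \<subseteq> G" "P.content G < P.outer B + ennreal d"
      by (rule P.outer_close)
    then show ?thesis
      unfolding energy_measure_eq[OF g[OF j]] P.emeasure_riesz[OF B]
      using P.emeasure_riesz_open by (metis less_imp_le)
  qed
  then obtain G where G: "\<And>j. j \<in> J \<Longrightarrow> open (G j)" "\<And>j. j \<in> J \<Longrightarrow> B \<subseteq> G j"
    "\<And>j. j \<in> J \<Longrightarrow> emeasure (?\<nu> (g j)) (G j) \<le> emeasure (?\<nu> (g j)) B + ennreal d"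
    by metis
  let ?G = "\<Inter>j\<in>J. G j"
  have oG: "open ?G" using J(1) G(1) by (intro open_INT) auto
  interpret P: positive_functional D "energy_integral f" by (rule energy_functional[OF f])
  have "emeasure (?\<nu> f) B \<le> emeasure (?\<nu> f) ?G"
    using G(2) oG unfolding energy_measure_eq[OF f] by (intro emeasure_mono) auto
  also have "\<dots> = P.content ?G"
    unfolding energy_measure_eq[OF f] by (rule P.emeasure_riesz_open[OF oG])
  also have "\<dots> \<le> (\<Sum>j\<in>J. emeasure (?\<nu> (g j)) ?G)"
    unfolding P.content_def
  proof (rule SUP_least)
    fix \<phi> assume \<phi>: "\<phi> \<in> P.tests ?G"
    then have D: "\<phi> \<in> D" "\<And>x. 0 \<le> \<phi> x" by (auto simp: P.tests_def)
    have "ennreal (energy_integral f \<phi>) \<le> ennreal (\<Sum>j\<in>J. energy_integral (g j) \<phi>)"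
      by (intro ennreal_leI le D)
    also have "\<dots> = (\<Sum>j\<in>J. ennreal (energy_integral (g j) \<phi>))"
      using g D by (intro sum_ennreal[symmetric]) (auto simp: energy_integral_nonneg D_F D_bm)
    also have "\<dots> \<le> (\<Sum>j\<in>J. emeasure (?\<nu> (g j)) ?G)"
    proof (rule sum_mono)
      fix j assume j: "j \<in> J"
      interpret Q: positive_functional D "energy_integral (g j)" by (rule energy_functional[OF g[OF j]])
      have "\<phi> \<in> Q.tests ?G" using \<phi> unfolding P.tests_def Q.tests_def .
      then show "ennreal (energy_integral (g j) \<phi>) \<le> emeasure (?\<nu> (g j)) ?G"
        unfolding energy_measure_eq[OF g[OF j]] Q.emeasure_riesz_open[OF oG] by (rule Q.content_upper)
    qed
    finally show "ennreal (energy_integral f \<phi>) \<le> (\<Sum>j\<in>J. emeasure (?\<nu> (g j)) ?G)" .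
  qed
  also have "\<dots> \<le> (\<Sum>j\<in>J. emeasure (?\<nu> (g j)) B + ennreal d)"
  proof (rule sum_mono)
    fix j assume j: "j \<in> J"
    interpret Q: positive_functional D "energy_integral (g j)" by (rule energy_functional[OF g[OF j]])
    have "emeasure (?\<nu> (g j)) ?G \<le> emeasure (?\<nu> (g j)) (G j)"
      using j G(1)[OF j] unfolding energy_measure_eq[OF g[OF j]] by (intro emeasure_mono) auto
    then show "emeasure (?\<nu> (g j)) ?G \<le> emeasure (?\<nu> (g j)) B + ennreal d"
      using G(3)[OF j] by (rule order_trans)
  qed
  also have "\<dots> = (\<Sum>j\<in>J. emeasure (?\<nu> (g j)) B) + ennreal e"
    using cJ d by (simp add: sum.distrib d_def ennreal_of_nat_eq_real_of_nat flip: ennreal_mult)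
  finally show "emeasure (?\<nu> f) B \<le> (\<Sum>j\<in>J. emeasure (?\<nu> (g j)) B) + ennreal e" .
qed

lemma emeasure_energy_measure_vec:
  fixes h :: "'a \<Rightarrow> real ^ 'n"
  assumes h: "\<And>j. (\<lambda>z. h z $ j) \<in> D" and B: "B \<in> sets borel"
  shows "emeasure (energy_measure_vec M E F h) B
    = (\<Sum>j\<in>UNIV. emeasure (energy_measure M E F (\<lambda>z. h z $ j)) B)"
  unfolding energy_measure_vec_def
proof (rule emeasure_measure_of_sigma)
  let ?\<nu> = "\<lambda>j. energy_measure M E F (\<lambda>z. h z $ j)"
  have s: "sets (?\<nu> j) = sets borel" for j
  proof -
    interpret Q: positive_functional D "energy_integral (\<lambda>z. h z $ j)" by (rule energy_functional[OF h])
    show ?thesis unfolding energy_measure_eq[OF h] by simp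
  qed
  show "sigma_algebra UNIV (sets (borel :: 'a measure))"
    using sets.sigma_algebra_axioms[of "borel :: 'a measure"] by simp
  show "positive (sets borel) (\<lambda>B. \<Sum>j\<in>UNIV. emeasure (?\<nu> j) B)"
    by (simp add: positive_def)
  show "countably_additive (sets borel) (\<lambda>B. \<Sum>j\<in>UNIV. emeasure (?\<nu> j) B)"
    unfolding countably_additive_def
  proof (intro allI impI)
    fix A :: "nat \<Rightarrow> 'a set"
    assume A: "range A \<subseteq> sets borel" "disjoint_family A"
    have "(\<Sum>i. \<Sum>j\<in>UNIV. emeasure (?\<nu> j) (A i)) = (\<Sum>j\<in>UNIV. \<Sum>i. emeasure (?\<nu> j) (A i))"
      by (rule suminf_sum) auto
    also have "\<dots> = (\<Sum>j\<in>UNIV. emeasure (?\<nu> j) (\<Union>i. A i))"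
      using A s by (intro sum.cong refl suminf_emeasure) auto
    finally show "(\<Sum>i. \<Sum>j\<in>UNIV. emeasure (?\<nu> j) (A i)) = (\<Sum>j\<in>UNIV. emeasure (?\<nu> j) (\<Union>i. A i))" .
  qed
qed (rule B)

text \<open>\<open>f - u\<close> and \<open>f\<^sup>2 - u\<^sup>2\<close> vanish on a neighbourhood
  of the support of \<open>\<phi>\<close>, so strong locality annihilates them against
  \<open>f * \<phi>\<close> and \<open>\<phi>\<close>.\<close>

lemma energy_integral_local:
  assumes f: "f \<in> D" and u: "u \<in> D" and \<phi>: "\<phi> \<in> D" and W: "open W" "closure {x. \<phi> x \<noteq> 0} \<subseteq> W"
    and eq: "\<And>x. x \<in> W \<Longrightarrow> f x = u x"
  shows "energy_integral f \<phi> = energy_integral u \<phi>"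
proof -
  have zero: "\<phi> x = 0" if "x \<notin> W" for x
    using that W(2) closure_subset[of "{x. \<phi> x \<noteq> 0}"] by blast
  have mult: "(\<lambda>x. f x * \<phi> x) = (\<lambda>x. u x * \<phi> x)"
    using eq zero by (metis mult_zero_right)
  have fp: "(\<lambda>x. f x * \<phi> x) \<in> D" and f2: "(\<lambda>x. (f x)\<^sup>2) \<in> D" and u2: "(\<lambda>x. (u x)\<^sup>2) \<in> D"
    using D_mult f u \<phi> by (auto simp: power2_eq_square)
  have supp: "supp M p \<subseteq> W" if "\<And>x. \<phi> x = 0 \<Longrightarrow> p x = 0" for p
  proof -
    have "supp M p \<subseteq> closure {x. \<phi> x \<noteq> 0}"
      using that closure_subset[of "{x. \<phi> x \<noteq> 0}"] by (intro supp_subset) auto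
    then show ?thesis using W(2) by blast
  qed
  have "E (\<lambda>x. f x * \<phi> x) (\<lambda>x. f x - u x) = 0"
    by (rule form_local[where c = 0, OF _ _ W(1) supp]) (use fp f u eq in \<open>auto simp: D_F domain_diff\<close>)
  then have 1: "E f (\<lambda>x. f x * \<phi> x) = E u (\<lambda>x. u x * \<phi> x)"
    using form_diff_right[of f u "\<lambda>x. f x * \<phi> x"] form_sym[of _ "\<lambda>x. f x * \<phi> x"] f u fp mult
    by (simp add: D_F)
  have "E \<phi> (\<lambda>x. (f x)\<^sup>2 - (u x)\<^sup>2) = 0"
    by (rule form_local[where c = 0, OF _ _ W(1) supp]) (use \<phi> f2 u2 eq in \<open>auto simp: D_F domain_diff\<close>)
  then have 2: "E (\<lambda>x. (f x)\<^sup>2) \<phi> = E (\<lambda>x. (u x)\<^sup>2) \<phi>"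
    using form_diff_right[of _ _ \<phi>] form_sym[of _ \<phi>] f2 u2 \<phi> by (simp add: D_F)
  show ?thesis unfolding energy_integral_def 1 2 ..
qed

section \<open>Gluing local Lipschitz functions\<close>

text \<open>Each new function is \<open>\<xi> w\<close> times the product of
  \<open>1 - \<xi> z\<close> over the earlier \<open>z\<close>, so that the sums telescope. This
  needs only products, under which \<open>D\<close> is closed, and no normalizing quotient.\<close>

lemma partition_of_unity:
  assumes W: "\<And>z. open (W z)" "\<And>z. z \<in> W z"
  obtains X \<eta> where "finite X" "\<And>z. z \<in> X \<Longrightarrow> \<eta> z \<in> D" "\<And>z x. z \<in> X \<Longrightarrow> 0 \<le> \<eta> z x"
    "\<And>z. z \<in> X \<Longrightarrow> closure {x. \<eta> z x \<noteq> 0} \<subseteq> W z" "\<And>x. (\<Sum>z\<in>X. \<eta> z x) = 1"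
proof -
  have "\<exists>\<xi> r. \<xi> \<in> D \<and> (\<forall>x. 0 \<le> \<xi> x \<and> \<xi> x \<le> 1) \<and> r > 0 \<and> (\<forall>x\<in>ball z r. \<xi> x = 1)
      \<and> closure {x. \<xi> x \<noteq> 0} \<subseteq> W z" for z
  proof -
    obtain r where r: "r > 0" "cball z r \<subseteq> W z" using W open_contains_cball by blast
    obtain \<xi> where "\<xi> \<in> D" "\<And>x. 0 \<le> \<xi> x" "\<And>x. \<xi> x \<le> 1" "\<And>x. x \<in> cball z r \<Longrightarrow> \<xi> x = 1"
      "closure {x. \<xi> x \<noteq> 0} \<subseteq> W z"
      by (rule cutoff[OF closed_cball W(1) r(2)]) blast
    then show ?thesis using r by (intro exI[of _ \<xi>] exI[of _ r]) auto
  qed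
  then obtain \<xi> r where \<xi>: "\<And>z. \<xi> z \<in> D" "\<And>z x. 0 \<le> \<xi> z x \<and> \<xi> z x \<le> 1" "\<And>z. r z > 0"
    "\<And>z x. x \<in> ball z (r z) \<Longrightarrow> \<xi> z x = 1" "\<And>z. closure {x. \<xi> z x \<noteq> 0} \<subseteq> W z"
    by metis
  obtain X where X: "finite X" "UNIV \<subseteq> (\<Union>z\<in>X. ball z (r z))"
  proof (rule compactE_image[OF compact_K, of UNIV "\<lambda>z. ball z (r z)"])
    show "UNIV \<subseteq> (\<Union>z\<in>UNIV. ball z (r z))" 
    proof
      fix x
      have "x \<in> ball x (r x)" using \<xi>(3)[of x] by simp
      then show "x \<in> (\<Union>z\<in>UNIV. ball z (r z))" by blast
    qed
  qed (use that in auto)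
  have "\<exists>\<eta>. (\<forall>z\<in>Y. \<eta> z \<in> D \<and> (\<forall>x. 0 \<le> \<eta> z x) \<and> {x. \<eta> z x \<noteq> 0} \<subseteq> {x. \<xi> z x \<noteq> 0})
      \<and> (\<forall>x. (\<Sum>z\<in>Y. \<eta> z x) = 1 - (\<Prod>z\<in>Y. 1 - \<xi> z x))" if "finite Y" for Y
    using that
  proof (induction Y rule: finite_induct)
    case empty
    then show ?case by simp
  next
    case (insert w Y)
    then obtain \<eta> where \<eta>: "\<And>z. z \<in> Y \<Longrightarrow> \<eta> z \<in> D" "\<And>z x. z \<in> Y \<Longrightarrow> 0 \<le> \<eta> z x"
      "\<And>z. z \<in> Y \<Longrightarrow> {x. \<eta> z x \<noteq> 0} \<subseteq> {x. \<xi> z x \<noteq> 0}"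
      "\<And>x. (\<Sum>z\<in>Y. \<eta> z x) = 1 - (\<Prod>z\<in>Y. 1 - \<xi> z x)" by blast
    let ?p = "\<lambda>x. \<xi> w x * (\<Prod>z\<in>Y. 1 - \<xi> z x)"
    have p: "?p \<in> D" "\<And>x. 0 \<le> ?p x"
      using \<xi>(1,2) insert.hyps(1)
      by (auto intro!: D_mult D_prod D_diff D_const mult_nonneg_nonneg prod_nonneg)
    have "(\<Sum>z\<in>insert w Y. (\<eta>(w := ?p)) z x) = 1 - (\<Prod>z\<in>insert w Y. 1 - \<xi> z x)" for x
    proof -
      have "(\<Sum>z\<in>Y. (\<eta>(w := ?p)) z x) = (\<Sum>z\<in>Y. \<eta> z x)"
        using insert.hyps(2) by (intro sum.cong) auto
      then show ?thesis using insert.hyps \<eta>(4)[of x] by (simp add: algebra_simps)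
    qed
    then show ?case
      using \<eta>(1-3) p by (intro exI[of _ "\<eta>(w := ?p)"]) auto
  qed
  from this[OF X(1)] obtain \<eta> where \<eta>: "\<And>z. z \<in> X \<Longrightarrow> \<eta> z \<in> D" "\<And>z x. z \<in> X \<Longrightarrow> 0 \<le> \<eta> z x"
      "\<And>z. z \<in> X \<Longrightarrow> {x. \<eta> z x \<noteq> 0} \<subseteq> {x. \<xi> z x \<noteq> 0}"
      "\<And>x. (\<Sum>z\<in>X. \<eta> z x) = 1 - (\<Prod>z\<in>X. 1 - \<xi> z x)" by blast
  show ?thesis
  proof (rule that[OF X(1) \<eta>(1,2)])
    show "closure {x. \<eta> z x \<noteq> 0} \<subseteq> W z" if "z \<in> X" for z
      using closure_mono[OF \<eta>(3)[OF that]] \<xi>(5)[of z] by blast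
    show "(\<Sum>z\<in>X. \<eta> z x) = 1" for x
    proof -
      obtain z where "z \<in> X" "x \<in> ball z (r z)" using X(2) by blast
      then have "(\<Prod>z\<in>X. 1 - \<xi> z x) = 0" using X(1) \<xi>(4) by (auto intro!: prod_zero)
      then show ?thesis using \<eta>(4) by simp
    qed
  qed auto
qed

text \<open>Every local model \<open>u\<close> is a contraction of \<open>h\<close> on the whole
  space, so the global results apply to it; \<open>W\<close> only records where it agrees with
  \<open>f\<close>. A partition of unity assembles \<open>f\<close> from the models and cuts a test
  into pieces that each see a single model.\<close>

lemma locally_lipschitz_energy:
  fixes h :: "'a \<Rightarrow> real ^ 'n"
  assumes h: "\<And>j. (\<lambda>z. h z $ j) \<in> D"
    and loc: "\<And>z. \<exists>W u. open W \<and> z \<in> W \<and> (\<forall>x\<in>W. f x = u x) \<and> (\<forall>x y. \<bar>u x - u y\<bar> \<le> norm (h x - h y))"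
  shows "f \<in> D"
    and "\<lbrakk>\<phi> \<in> D; \<And>x. 0 \<le> \<phi> x\<rbrakk>
      \<Longrightarrow> energy_integral f \<phi> \<le> (\<Sum>j\<in>UNIV. energy_integral (\<lambda>z. h z $ j) \<phi>)"
proof -
  have hb: "(\<lambda>x. h x \<bullet> i) \<in> D" if "i \<in> Basis" for i
    using that h by (auto simp: real_vec_Basis inner_axis)
  have hc: "continuous_on UNIV h"
    unfolding continuous_on_componentwise[of UNIV h] using hb D_cont by blast
  have uD: "u \<in> D" if u: "\<And>x y. \<bar>u x - u y\<bar> \<le> norm (h x - h y)" for u
  proof -
    have "continuous_on UNIV u"
      using hc unfolding continuous_on_iff dist_norm by (metis u order_le_less_trans real_norm_def)
    moreover have "u \<in> F"
      by (rule lipschitz_domain[where h = h, OF continuous_bounded_measurable[OF calculation]])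
         (use hb u in \<open>auto simp: D_bm D_F\<close>)
    ultimately show ?thesis by (simp add: D_def)
  qed
  obtain W u where W: "\<And>z. open (W z)" "\<And>z. z \<in> W z" and eq: "\<And>z x. x \<in> W z \<Longrightarrow> f x = u z x"
    and u: "\<And>z x y. \<bar>u z x - u z y\<bar> \<le> norm (h x - h y)"
    using loc by metis
  obtain X \<eta> where X: "finite X" and \<eta>: "\<And>z. z \<in> X \<Longrightarrow> \<eta> z \<in> D" "\<And>z x. z \<in> X \<Longrightarrow> 0 \<le> \<eta> z x"
    and supp: "\<And>z. z \<in> X \<Longrightarrow> closure {x. \<eta> z x \<noteq> 0} \<subseteq> W z" and one: "\<And>x. (\<Sum>z\<in>X. \<eta> z x) = 1"
    by (rule partition_of_unity[OF W]) blast
  have zero: "\<eta> z x = 0" if "z \<in> X" "x \<notin> W z" for z x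
    using that supp[of z] closure_subset[of "{x. \<eta> z x \<noteq> 0}"] by blast
  have "f x = (\<Sum>z\<in>X. \<eta> z x * u z x)" for x
  proof -
    have "f x = (\<Sum>z\<in>X. \<eta> z x * f x)" using one[of x] by (simp flip: sum_distrib_right)
    also have "\<dots> = (\<Sum>z\<in>X. \<eta> z x * u z x)"
      using eq zero by (intro sum.cong refl) (metis mult_zero_left)
    finally show ?thesis .
  qed
  then have "f = (\<lambda>x. \<Sum>z\<in>X. \<eta> z x * u z x)" by auto
  then show fD: "f \<in> D" using X \<eta> uD[OF u] by (auto intro!: D_sum D_mult)
  assume \<phi>: "\<phi> \<in> D" "\<And>x. 0 \<le> \<phi> x"
  let ?\<psi> = "\<lambda>z x. \<eta> z x * \<phi> x"
  have \<psi>: "?\<psi> z \<in> D" "\<And>x. 0 \<le> ?\<psi> z x" "closure {x. ?\<psi> z x \<noteq> 0} \<subseteq> W z" if "z \<in> X" for z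
  proof -
    show "?\<psi> z \<in> D" "\<And>x. 0 \<le> ?\<psi> z x" using D_mult \<eta> \<phi> that by auto
    have "{x. ?\<psi> z x \<noteq> 0} \<subseteq> {x. \<eta> z x \<noteq> 0}" by auto
    then show "closure {x. ?\<psi> z x \<noteq> 0} \<subseteq> W z"
      by (rule order_trans[OF closure_mono supp[OF that]])
  qed
  have split: "energy_integral g \<phi> = (\<Sum>z\<in>X. energy_integral g (?\<psi> z))" if "g \<in> D" for g
  proof -
    interpret P: positive_functional D "energy_integral g" by (rule energy_functional[OF that])
    have "\<phi> = (\<lambda>x. \<Sum>z\<in>X. ?\<psi> z x)" using one by (simp flip: sum_distrib_right)
    then show ?thesis using P.L_sum[OF X, of ?\<psi>] \<psi>(1) by simp
  qed
  have "energy_integral f \<phi> = (\<Sum>z\<in>X. energy_integral f (?\<psi> z))" by (rule split[OF fD])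
  also have "\<dots> = (\<Sum>z\<in>X. energy_integral (u z) (?\<psi> z))"
  proof (rule sum.cong[OF refl])
    fix z assume z: "z \<in> X"
    show "energy_integral f (?\<psi> z) = energy_integral (u z) (?\<psi> z)"
      by (rule energy_integral_local[OF fD uD[OF u] \<psi>(1)[OF z] W(1) \<psi>(3)[OF z] eq])
  qed
  also have "\<dots> \<le> (\<Sum>z\<in>X. \<Sum>j\<in>UNIV. energy_integral (\<lambda>x. h x $ j) (?\<psi> z))"
  proof (rule sum_mono)
    fix z assume z: "z \<in> X"
    have "energy_integral (u z) (?\<psi> z) \<le> (\<Sum>i\<in>Basis. energy_integral (\<lambda>x. h x \<bullet> i) (?\<psi> z))"
      by (rule energy_integral_mono)
         (use uD[OF u] hb \<psi>[OF z] u in \<open>auto simp: D_F D_bm\<close>)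
    then show "energy_integral (u z) (?\<psi> z) \<le> (\<Sum>j\<in>UNIV. energy_integral (\<lambda>x. h x $ j) (?\<psi> z))"
      by (simp add: sum_Basis_vec inner_axis)
  qed
  also have "\<dots> = (\<Sum>j\<in>UNIV. energy_integral (\<lambda>x. h x $ j) \<phi>)"
    by (subst sum.swap) (simp add: split[OF h])
  finally show "energy_integral f \<phi> \<le> (\<Sum>j\<in>UNIV. energy_integral (\<lambda>z. h z $ j) \<phi>)" .
qed

lemma locally_lipschitz_le_intrinsic_dist:
  fixes h :: "'a \<Rightarrow> real ^ 'n"
  assumes h: "\<And>j. (\<lambda>z. h z $ j) \<in> D"
    and loc: "\<And>z. \<exists>W u. open W \<and> z \<in> W \<and> (\<forall>x\<in>W. f x = u x) \<and> (\<forall>x y. \<bar>u x - u y\<bar> \<le> norm (h x - h y))"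
  shows "ereal (f y - f x) \<le> intrinsic_dist M E F h x y"
proof -
  note f = locally_lipschitz_energy[OF h loc]
  have "emeasure (energy_measure M E F f) B \<le> emeasure (energy_measure_vec M E F h) B"
    if B: "B \<in> sets borel" for B
    unfolding emeasure_energy_measure_vec[OF h B]
    by (rule energy_measure_mono[OF f(1) h _ _ f(2) B]) auto
  then show ?thesis
    unfolding intrinsic_dist_def using f(1) by (intro Sup_upper) (auto simp: D_def)
qed

end

section \<open>Walks through the cells of a finite decomposition\<close>

text \<open>Components are relatively closed. Away from \<open>V\<close>, membership in a closed
  cell thus improves to membership in the cell itself.\<close>

lemma component_closure_Int:
  assumes "U \<in> components S" "w \<in> closure U" "w \<in> S"
  shows "w \<in> U"
proof -
  obtain T where T: "closed T" "U = S \<inter> T"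
    using closedin_component[OF assms(1)] unfolding closedin_closed by blast
  then have "closure U \<subseteq> T" by (intro closure_minimal) auto
  then show ?thesis using T assms by blast
qed

lemma component_unique:
  assumes "U \<in> components S" "U' \<in> components S" "w \<in> U" "w \<in> U'"
  shows "U = U'"
  using components_eq[OF assms(1,2)] assms(3,4) by blast

text \<open>The space need not be locally connected. Openness comes from finiteness: the remaining
  components form a finite union of relatively closed sets.\<close>

lemma open_component_finite:
  assumes "open S" "finite (components S)" "U \<in> components S"
  shows "open U"
proof -
  have cl: "closedin (top_of_set S) (\<Union>(components S - {U}))"
    using assms(2) closedin_component by (intro closedin_Union) auto
  have "U = S - \<Union>(components S - {U})"
  proof
    show "U \<subseteq> S - \<Union>(components S - {U})"
      using in_components_subset[OF assms(3)] component_unique[OF assms(3)] by blast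
    show "S - \<Union>(components S - {U}) \<subseteq> U" using Union_components[of S] by blast
  qed
  then have "openin (top_of_set S) U"
    using openin_diff[OF openin_topspace cl] by simp
  then show ?thesis using assms(1) openin_open_trans by blast
qed

section \<open>Walks and shortest-walk potentials\<close>

fun walk_length :: "('a \<Rightarrow> 'a \<Rightarrow> real) \<Rightarrow> 'a list \<Rightarrow> real" where
  "walk_length w (a # b # c) = w a b + walk_length w (b # c)"
| "walk_length w _ = 0"

definition adjacent :: "'a::topological_space set \<Rightarrow> 'a \<Rightarrow> 'a \<Rightarrow> bool" where
  "adjacent V p q \<longleftrightarrow> (\<exists>U\<in>components (- V). p \<in> closure U \<and> q \<in> closure U)"

definition walks :: "'a::topological_space set \<Rightarrow> 'a set \<Rightarrow> 'a \<Rightarrow> 'a \<Rightarrow> 'a list set" where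
  "walks V A p q = {c. c \<noteq> [] \<and> hd c = p \<and> last c = q \<and> set c \<subseteq> A \<and> successively (adjacent V) c}"

lemma walk_length_append:
  "walk_length w (c @ p # d) = walk_length w (c @ [p]) + walk_length w (p # d)"
proof (induction c)
  case Nil
  then show ?case by simp
next
  case (Cons a c)
  then show ?case by (cases c) auto
qed

lemma walk_length_nonneg: "(\<And>a b. 0 \<le> w a b) \<Longrightarrow> 0 \<le> walk_length w c"
  by (induction w c rule: walk_length.induct) auto

lemma walk_length_snoc: "c \<noteq> [] \<Longrightarrow> walk_length w (c @ [p]) = walk_length w c + w (last c) p"
  by (induction w c rule: walk_length.induct) auto

lemma walk_length_diff:
  "(\<And>a b. w a b \<le> v a b + e) \<Longrightarrow> 0 \<le> e \<Longrightarrow> walk_length w c \<le> walk_length v c + e * real (length c)"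
proof (induction w c rule: walk_length.induct)
  case (1 w a b c)
  then have "walk_length w (b # c) \<le> walk_length v (b # c) + e * real (length (b # c))" by blast
  moreover have "w a b \<le> v a b + e" by (rule 1)
  ultimately show ?case by (simp add: distrib_left)
qed auto

text \<open>Cutting out loops bounds the length of the list by the number of vertices, so that a
  fixed loss per edge has a bounded total.\<close>

lemma walk_shortcut:
  assumes "\<And>a b. 0 \<le> w a b" "c \<in> walks V A p q"
  shows "\<exists>d\<in>walks V A p q. distinct d \<and> walk_length w d \<le> walk_length w c"
  using assms(2)
proof (induction "length c" arbitrary: c rule: less_induct)
  case less
  show ?case
  proof (cases "distinct c")
    case True
    then show ?thesis using less.prems by blast
  next
    case False
    then obtain xs ys zs v where c: "c = xs @ [v] @ ys @ [v] @ zs"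
      using not_distinct_decomp by blast
    let ?d = "xs @ v # zs"
    have "walk_length w c = walk_length w (xs @ [v]) + walk_length w ((v # ys) @ v # zs)"
      unfolding c using walk_length_append[of w xs v "ys @ [v] @ zs"] by simp
    also have "walk_length w ((v # ys) @ v # zs) = walk_length w (v # ys @ [v]) + walk_length w (v # zs)"
      using walk_length_append[of w "v # ys" v zs] by simp
    finally have "walk_length w ?d \<le> walk_length w c"
      using walk_length_append[of w xs v zs] walk_length_nonneg[of w "v # ys @ [v]", OF assms(1)] by simp
    moreover have "?d \<in> walks V A p q"
      using less.prems unfolding walks_def c
      by (auto simp: successively_append_iff successively_Cons hd_append last_append split: if_splits)
    moreover have "length ?d < length c" unfolding c by simp
    ultimately show ?thesis using less.hyps[of ?d] order_trans by blast
  qed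
qed

text \<open>The potential of a point is its distance from \<open>x\<close> in the graph on \<open>V \<union> {x, y}\<close>, where each
  edge is shortened by \<open>2 \<epsilon>\<close>. This makes the interpolating function \<open>f\<close> constant near the
  points of \<open>V\<close>, so that it is locally a Lipschitz function of \<open>h\<close> there as well.\<close>

lemma walk_potential:
  fixes h :: "'a::metric_space \<Rightarrow> 'b::real_normed_vector" and \<epsilon> r :: real
  assumes V: "finite V" "finite (components (- V))" and h: "continuous_on UNIV h"
    and \<epsilon>: "\<epsilon> > 0" and r: "r \<ge> 0"
    and long: "\<And>c. \<lbrakk>c \<in> walks V (V \<union> {x, y}) x y; distinct c\<rbrakk>
      \<Longrightarrow> r < walk_length (\<lambda>p q. norm (h p - h q)) c"
  shows "\<exists>f. (\<forall>z. \<exists>W u. open W \<and> z \<in> W \<and> (\<forall>a\<in>W. f a = u a)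
      \<and> (\<forall>a b. \<bar>u a - u b\<bar> \<le> norm (h a - h b)))
    \<and> r - 2 * \<epsilon> * real (card (V \<union> {x, y})) \<le> f y - f x"
proof -
  define A where "A = V \<union> {x, y}"
  have finA: "finite A" unfolding A_def using V by simp
  have clV: "closed V" using V finite_imp_closed by blast
  define w where "w p q = max 0 (norm (h p - h q) - 2 * \<epsilon>)" for p q
  \<comment> \<open>Inserting \<open>r\<close> keeps the set nonempty when no walk reaches
    \<open>p\<close> and caps the potential, whose values then stay in [0, r].\<close>
  define a where "a p = Inf (insert r (walk_length w ` walks V A x p))" for p
  have w_nonneg: "0 \<le> w p q" for p q unfolding w_def by simp
  have bdd: "bdd_below (insert r (walk_length w ` walks V A x p))" for p
    using r walk_length_nonneg[of w, OF w_nonneg] by (intro bdd_belowI[of _ 0]) auto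
  have a_le_r: "a p \<le> r" for p unfolding a_def by (intro cInf_lower bdd) simp
  have a_le: "a p \<le> walk_length w c" if "c \<in> walks V A x p" for c p
    unfolding a_def using that by (intro cInf_lower bdd) simp
  have a_nonneg: "0 \<le> a p" for p
    unfolding a_def using r walk_length_nonneg[of w, OF w_nonneg] by (intro cInf_greatest) auto
  have "[x] \<in> walks V A x x" unfolding walks_def A_def by simp
  then have ax: "a x = 0" using a_le[of "[x]" x] a_nonneg[of x] by simp
  have a_step: "a p \<le> a q + w q p" if "p \<in> A" "adjacent V q p" for p q
  proof -
    have "a p - w q p \<le> s" if s: "s \<in> insert r (walk_length w ` walks V A x q)" for s
    proof -
      from s consider "s = r" | c where "c \<in> walks V A x q" "s = walk_length w c" by blast
      then show ?thesis
      proof cases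
        case 1
        then show ?thesis using a_le_r[of p] w_nonneg[of q p] by simp
      next
        case 2
        then have "c @ [p] \<in> walks V A x p"
          using \<open>p \<in> A\<close> \<open>adjacent V q p\<close> unfolding walks_def by (auto simp: successively_append_iff)
        then have "a p \<le> walk_length w (c @ [p])" by (rule a_le)
        also have "\<dots> = s + w q p" using 2 by (auto simp: walk_length_snoc walks_def)
        finally show ?thesis by simp
      qed
    qed
    then have "a p - w q p \<le> a q" unfolding a_def[of q] by (intro cInf_greatest) auto
    then show ?thesis by simp
  qed
  \<comment> \<open>The walks behind \<open>a y\<close> may repeat vertices. Only after loops are
    removed does \<open>long\<close> apply and the loss of at most \<open>2 * \<epsilon>\<close> per
    edge add up to the stated amount.\<close>
  have ay: "r - 2 * \<epsilon> * real (card A) \<le> a y"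
  proof -
    have "r - 2 * \<epsilon> * real (card A) \<le> s" if s: "s \<in> insert r (walk_length w ` walks V A x y)" for s
    proof -
      from s consider "s = r" | c where "c \<in> walks V A x y" "s = walk_length w c" by blast
      then show ?thesis
      proof cases
        case 1
        then show ?thesis using \<epsilon> by simp
      next
        case 2
        obtain d where d: "d \<in> walks V A x y" "distinct d" "walk_length w d \<le> walk_length w c"
          using walk_shortcut[of w c V A x y, OF w_nonneg 2(1)] by blast
        have "r < walk_length (\<lambda>p q. norm (h p - h q)) d"
          using long d(1,2) unfolding A_def by blast
        also have "\<dots> \<le> walk_length w d + 2 * \<epsilon> * real (length d)"
          using \<epsilon> by (intro walk_length_diff) (auto simp: w_def)
        also have "real (length d) \<le> real (card A)"
          using d(1,2) finA card_mono[of A "set d"] by (auto simp: walks_def distinct_card)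
        finally show ?thesis using 2(2) d(3) \<epsilon> by (simp add: mult_left_mono)
      qed
    qed
    then show ?thesis unfolding a_def by (intro cInf_greatest) auto
  qed
  \<comment> \<open>Each term is a cone over a vertex \<open>q\<close>, measured through
    \<open>h\<close>, whose tip is flattened at radius \<open>\<epsilon>\<close>. A minimum of such
    cones and the constant \<open>r\<close> is still 1-Lipschitz in \<open>h\<close>.\<close>
  define g where "g U z = Min (insert r ((\<lambda>q. a q + max 0 (norm (h z - h q) - \<epsilon>)) ` (A \<inter> closure U)))"
    for U z
  have fin: "finite (insert r ((\<lambda>q. a q + max 0 (norm (h z - h q) - \<epsilon>)) ` (A \<inter> closure U)))" for U z
    using finA by simp
  have g_le_r: "g U z \<le> r" for U z unfolding g_def by (rule Min_le[OF fin]) simp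
  have g_le: "g U z \<le> a q + max 0 (norm (h z - h q) - \<epsilon>)" if "q \<in> A" "q \<in> closure U" for U z q
    unfolding g_def using that by (intro Min_le[OF fin]) auto
  have g_ge: "s \<le> g U z"
    if "s \<le> r" "\<And>q. \<lbrakk>q \<in> A; q \<in> closure U\<rbrakk> \<Longrightarrow> s \<le> a q + max 0 (norm (h z - h q) - \<epsilon>)" for s U z
    unfolding g_def using that by (subst Min_ge_iff[OF fin]) auto
  have g_lip: "\<bar>g U z - g U z'\<bar> \<le> norm (h z - h z')" for U z z'
  proof -
    have "g U z - norm (h z - h z') \<le> g U z'" for z z'
    proof (rule g_ge)
      show "g U z - norm (h z - h z') \<le> r" using g_le_r[of U z] norm_ge_zero[of "h z - h z'"] by linarith
      fix q assume q: "q \<in> A" "q \<in> closure U"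
      have "norm (h z - h q) \<le> norm (h z - h z') + norm (h z' - h q)"
        using norm_triangle_ineq[of "h z - h z'" "h z' - h q"] by simp
      then show "g U z - norm (h z - h z') \<le> a q + max 0 (norm (h z' - h q) - \<epsilon>)"
        using g_le[OF q, of z] norm_ge_zero[of "h z - h z'"] by linarith
    qed
    from this[of z z'] this[of z' z] show ?thesis by (simp add: norm_minus_commute)
  qed
  \<comment> \<open>Here the \<open>2 * \<epsilon>\<close> is spent: one \<open>\<epsilon>\<close>
    absorbs the distance from \<open>z\<close> to \<open>p\<close>, the other the flattened tip at
    \<open>q\<close>. No other cone can then undercut the value \<open>a p\<close>.\<close>
  have g_eq: "g U z = a p"
    if U: "U \<in> components (- V)" and p: "p \<in> A" "p \<in> closure U" and near: "norm (h z - h p) \<le> \<epsilon>" for U z p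
  proof (rule antisym)
    show "g U z \<le> a p" using g_le[OF p, of z] near by simp
    show "a p \<le> g U z"
    proof (rule g_ge[OF a_le_r])
      fix q assume q: "q \<in> A" "q \<in> closure U"
      have "adjacent V q p" unfolding adjacent_def using U p q by blast
      then have "a p \<le> a q + w q p" by (rule a_step[OF p(1)])
      moreover have "norm (h p - h q) \<le> norm (h z - h p) + norm (h z - h q)"
        using norm_triangle_ineq[of "h p - h z" "h z - h q"] by (simp add: norm_minus_commute)
      ultimately show "a p \<le> a q + max 0 (norm (h z - h q) - \<epsilon>)"
        using near unfolding w_def by (auto simp: max_def norm_minus_commute split: if_splits)
    qed
  qed
  define f where "f z = (if z \<in> V then a z else g (connected_component_set (- V) z) z)" for z
  have comp: "connected_component_set (- V) z \<in> components (- V)" "z \<in> connected_component_set (- V) z"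
    if "z \<notin> V" for z
    using that by (auto simp: components_def connected_component_refl_eq)
  have f_comp: "f z = g U z" if "U \<in> components (- V)" "z \<in> U" for U z
  proof -
    have "z \<notin> V" using that in_components_subset by blast
    then show ?thesis using component_unique[OF comp(1) that(1) comp(2) that(2)] unfolding f_def by simp
  qed
  have f_A: "f p = a p" if "p \<in> A" for p
  proof (cases "p \<in> V")
    case True
    then show ?thesis unfolding f_def by simp
  next
    case False
    let ?U = "connected_component_set (- V) p"
    have "p \<in> closure ?U" using comp(2)[OF False] closure_subset by blast
    then have "g ?U p = a p" using comp(1)[OF False] that \<epsilon> by (intro g_eq) auto
    then show ?thesis using f_comp[OF comp[OF False]] by simp
  qed
  have "\<exists>W u. open W \<and> z \<in> W \<and> (\<forall>b\<in>W. f b = u b) \<and> (\<forall>b c. \<bar>u b - u c\<bar> \<le> norm (h b - h c))" for z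
  proof (cases "z \<in> V")
    case False
    let ?U = "connected_component_set (- V) z"
    have "open ?U" using open_component_finite[OF _ V(2) comp(1)[OF False]] clV by blast
    then show ?thesis
      using comp[OF False] f_comp[OF comp(1)[OF False]] g_lip
      by (intro exI[of _ ?U] exI[of _ "g ?U"]) auto
  next
    case True
    \<comment> \<open>\<open>W\<close> meets only components with \<open>z\<close> in their closure
      and contains no other point of \<open>V\<close>, so \<open>g_eq\<close> gives the same
      constant \<open>a z\<close> on all of them.\<close>
    define W where "W = - (V - {z}) \<inter> - \<Union>(closure ` {U \<in> components (- V). z \<notin> closure U})
        \<inter> {b. norm (h b - h z) < \<epsilon>}"
    have "open W" unfolding W_def
    proof (intro open_Int open_Compl)
      show "closed (V - {z})" using V(1) by (intro finite_imp_closed) simp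
      show "closed (\<Union>(closure ` {U \<in> components (- V). z \<notin> closure U}))"
        using V(2) by (intro closed_Union) auto
      show "open {b. norm (h b - h z) < \<epsilon>}"
        by (intro open_Collect_less continuous_on_norm continuous_on_diff h continuous_on_const)
    qed
    moreover have "z \<in> W" unfolding W_def using \<epsilon> by auto
    moreover have "f b = a z" if b: "b \<in> W" for b
    proof (cases "b \<in> V")
      case True
      then show ?thesis using b f_A[of z] \<open>z \<in> V\<close> unfolding W_def A_def by auto
    next
      case False
      let ?U = "connected_component_set (- V) b"
      have "b \<in> closure ?U" using comp(2)[OF False] closure_subset by blast
      then have "z \<in> closure ?U" using b comp(1)[OF False] unfolding W_def by blast
      then have "g ?U b = a z"
        using b \<open>z \<in> V\<close> comp(1)[OF False] by (intro g_eq) (auto simp: W_def A_def)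
      then show ?thesis using f_comp[OF comp[OF False]] by simp
    qed
    ultimately show ?thesis
      by (intro exI[of _ W] exI[of _ "\<lambda>_. a z"]) auto
  qed
  moreover have "f x = 0" "f y = a y" using f_A ax unfolding A_def by auto
  ultimately show ?thesis using ay unfolding A_def by (intro exI[of _ f]) auto
qed

text \<open>If all distinct walks were longer than \<open>r\<close>, the potential would be a
  competitor for the intrinsic distance whose increment exceeds it.\<close>

lemma (in strongly_local_form) short_walk_exists:
  fixes h :: "'a \<Rightarrow> real ^ 'n"
  assumes h: "\<And>j. (\<lambda>z. h z $ j) \<in> D" and V: "finite V" "finite (components (- V))"
    and r: "intrinsic_dist M E F h x y < ereal r"
  shows "\<exists>c\<in>walks V (V \<union> {x, y}) x y. distinct c \<and> walk_length (\<lambda>p q. norm (h p - h q)) c \<le> r"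
proof (rule ccontr)
  assume neg: "\<not> ?thesis"
  have "ereal ((\<lambda>z. 0) y - (\<lambda>z. 0) x) \<le> intrinsic_dist M E F h x y"
    by (rule locally_lipschitz_le_intrinsic_dist[OF h])
       (intro exI[of _ UNIV] exI[of _ "\<lambda>z. 0 :: real"], auto)
  then obtain d where d: "intrinsic_dist M E F h x y = ereal d" "0 \<le> d"
    using r by (cases "intrinsic_dist M E F h x y") auto
  have dr: "d < r" using r d by simp
  let ?n = "card (V \<union> {x, y})"
  have n: "real ?n > 0" using V(1) by (simp add: card_gt_0_iff)
  \<comment> \<open>The total loss \<open>2 * \<epsilon> * card (V \<union> {x, y})\<close> is then
    half of the slack \<open>r - d\<close>.\<close>
  define \<epsilon> where "\<epsilon> = (r - d) / (4 * real ?n)"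
  have \<epsilon>: "\<epsilon> > 0" unfolding \<epsilon>_def using dr n by simp
  have hc: "continuous_on UNIV h"
  proof -
    have "continuous_on UNIV (\<lambda>z. \<chi> j. h z $ j)" by (intro continuous_on_vec_lambda D_cont h)
    then show ?thesis by simp
  qed
  have "r < walk_length (\<lambda>p q. norm (h p - h q)) c" if "c \<in> walks V (V \<union> {x, y}) x y" "distinct c" for c
    using neg that by fastforce
  then obtain f where f: "\<And>z. \<exists>W u. open W \<and> z \<in> W \<and> (\<forall>a\<in>W. f a = u a)
      \<and> (\<forall>a b. \<bar>u a - u b\<bar> \<le> norm (h a - h b))"
    and gap: "r - 2 * \<epsilon> * real ?n \<le> f y - f x"
    using walk_potential[OF V hc \<epsilon>, of r x y] dr d(2) by auto
  have "ereal (f y - f x) \<le> ereal d"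
    using locally_lipschitz_le_intrinsic_dist[OF h f, of y x] unfolding d(1) .
  then have "r - 2 * \<epsilon> * real ?n \<le> d" using gap by simp
  moreover have "2 * \<epsilon> * real ?n = (r - d) / 2" unfolding \<epsilon>_def using n by (simp add: field_simps)
  ultimately show False using dr by simp
qed

section \<open>Paths from compatible walks\<close>

lemma component_superset:
  assumes "V \<subseteq> V'" "U' \<in> components (- V')"
  obtains U where "U \<in> components (- V)" "U' \<subseteq> U"
proof -
  have "U' \<subseteq> - V" using in_components_subset[OF assms(2)] assms(1) by blast
  then show ?thesis
    using exists_component_superset[of U' "- V"] in_components_nonempty[OF assms(2)]
      in_components_connected[OF assms(2)] that by blast
qed

text \<open>A walk for \<open>V'\<close> changes the component of \<open>- V\<close> only at points of \<open>V\<close>, so deleting points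
  outside \<open>V\<close> leaves a walk for \<open>V\<close>.\<close>

lemma successively_adjacent_filter:
  assumes sub: "V \<subseteq> V'" and A: "V \<subseteq> A"
    and c: "successively (adjacent V') c"
  shows "successively (adjacent V) (filter (\<lambda>p. p \<in> A) c)
    \<and> (c \<noteq> [] \<longrightarrow> hd c \<notin> A \<longrightarrow> filter (\<lambda>p. p \<in> A) c \<noteq> [] \<longrightarrow>
      (\<forall>U\<in>components (- V). hd c \<in> U \<longrightarrow> hd (filter (\<lambda>p. p \<in> A) c) \<in> closure U))"
  using c
\<comment> \<open>The second conjunct carries the induction: it remembers the cell in which a
  deleted head lies and places the next kept point on its closure.\<close>
proof (induction c)
  case Nil
  then show ?case by simp
next
  case (Cons a c)
  show ?case
  proof (cases c)
    case Nil
    then show ?thesis by simp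
  next
    case c: (Cons b d)
    let ?f = "filter (\<lambda>p. p \<in> A)"
    have IH: "successively (adjacent V) (?f c)"
      "\<And>U. \<lbrakk>b \<notin> A; ?f c \<noteq> []; U \<in> components (- V); b \<in> U\<rbrakk> \<Longrightarrow> hd (?f c) \<in> closure U"
      using Cons.IH Cons.prems c by (auto simp: successively_Cons)
    have "adjacent V' a b" using Cons.prems c by simp
    then obtain U' where U': "U' \<in> components (- V')" "a \<in> closure U'" "b \<in> closure U'"
      unfolding adjacent_def by blast
    obtain U where U: "U \<in> components (- V)" "U' \<subseteq> U" using component_superset[OF sub U'(1)] .
    have ab: "a \<in> closure U" "b \<in> closure U" using U' closure_mono[OF U(2)] by auto
    \<comment> \<open>A deleted \<open>b\<close> is outside \<open>V\<close>, hence in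
      \<open>U\<close> itself and not merely in its closure. The walk therefore stays in the same
      cell of \<open>- V\<close> until the next kept point.\<close>
    have next_in: "hd (?f c) \<in> closure U" if "?f c \<noteq> []"
    proof (cases "b \<in> A")
      case True
      then show ?thesis using c ab by simp
    next
      case False
      then have "b \<in> U" using component_closure_Int[OF U(1) ab(2)] A by blast
      then show ?thesis using IH(2)[OF False that U(1)] by simp
    qed
    show ?thesis
    proof (cases "a \<in> A")
      case True
      then show ?thesis using IH(1) next_in ab(1) U(1) by (auto simp: successively_Cons adjacent_def)
    next
      case False
      then have "a \<in> U" using component_closure_Int[OF U(1) ab(1)] A by blast
      then have "U2 = U" if "U2 \<in> components (- V)" "a \<in> U2" for U2
        using component_unique[OF that(1) U(1) that(2)] by simp
      then show ?thesis using IH(1) next_in False by auto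
    qed
  qed
qed

text \<open>The triangle inequality bridges a deleted inner point, nonnegativity drops a deleted
  last one; the starting point \<open>a\<close> is always kept.\<close>

lemma walk_length_filter:
  assumes nn: "\<And>a b. 0 \<le> w a b" and tri: "\<And>a b d. w a d \<le> w a b + w b d"
  shows "walk_length w (a # filter P c) \<le> walk_length w (a # c)"
proof (induction c arbitrary: a)
  case (Cons b c)
  show ?case
  proof (cases "P b")
    case True
    then show ?thesis using Cons.IH[of b] by simp
  next
    case False
    have "walk_length w (a # c) \<le> w a b + walk_length w (b # c)"
      using nn[of a b] tri[of a "hd c" b] by (cases c) auto
    then show ?thesis using False Cons.IH[of a] by simp
  qed
qed simp

lemma walks_filter:
  assumes c: "c \<in> walks V' A' x y" and sub: "V \<subseteq> V'" and A: "V \<subseteq> A" "x \<in> A" "y \<in> A"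
  shows "filter (\<lambda>p. p \<in> A) c \<in> walks V A x y"
proof -
  let ?f = "filter (\<lambda>p. p \<in> A)"
  obtain d where d: "c = x # d" using c unfolding walks_def by (cases c) auto
  obtain e where e: "c = e @ [y]" using c unfolding walks_def by (cases c rule: rev_cases) auto
  have "hd (?f c) = x" unfolding d using A(2) by simp
  moreover have "last (?f c) = y" "?f c \<noteq> []" unfolding e using A(3) by simp_all
  ultimately show ?thesis
    using c successively_adjacent_filter[OF sub A(1), of c] unfolding walks_def by auto
qed

lemma walk_length_sum: "walk_length w c = (\<Sum>i<length c - 1. w (c ! i) (c ! Suc i))"
proof (induction w c rule: walk_length.induct)
  case (1 w a b c)
  then show ?case by (simp add: sum.lessThan_Suc_shift del: sum.lessThan_Suc)
qed auto

text \<open>Bounds the partition sums of a step function that runs along the walk. Several sample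
  times may select the same point, so \<open>N\<close> is only weakly increasing.\<close>

lemma sum_consecutive_le:
  fixes w :: "'a \<Rightarrow> 'a \<Rightarrow> real"
  assumes nn: "\<And>a b. 0 \<le> w a b" and refl: "\<And>a. w a a = 0" and tri: "\<And>a b d. w a d \<le> w a b + w b d"
    and N: "\<And>k. k \<le> n \<Longrightarrow> N k < length c" "\<And>k. k < n \<Longrightarrow> N k \<le> N (Suc k)"
  shows "(\<Sum>k<n. w (c ! N k) (c ! N (Suc k))) \<le> walk_length w c"
proof -
  define S where "S i = (\<Sum>k<i. w (c ! k) (c ! Suc k))" for i
  have step: "w (c ! i) (c ! j) \<le> S j - S i" if "i \<le> j" for i j
    using that
  proof (induction rule: dec_induct)
    case base
    then show ?case using refl by simp
  next
    case (step j)
    then show ?case using tri[of "c ! i" "c ! Suc j" "c ! j"] unfolding S_def by simp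
  qed
  have "(\<Sum>k<n. w (c ! N k) (c ! N (Suc k))) \<le> (\<Sum>k<n. S (N (Suc k)) - S (N k))"
    using N by (intro sum_mono step) auto
  also have "\<dots> = S (N n) - S (N 0)" by (rule sum_lessThan_telescope)
  also have "\<dots> \<le> S (N n)" unfolding S_def using nn by (simp add: sum_nonneg)
  also have "\<dots> \<le> S (length c - 1)"
    unfolding S_def using N(1)[of n] nn by (intro sum_mono2) auto
  finally show ?thesis unfolding S_def walk_length_sum .
qed

section \<open>Mesh size and compatible walks\<close>

text \<open>Finitely many interiors of small stars cover the space. At a level beyond all of theirs
  every component lies in one of these stars, since refining \<open>V\<close> only subdivides
  components.\<close>

lemma mesh_tendsto_zero:
  fixes V :: "nat \<Rightarrow> 'a::metric_space set"
  assumes K: "compact (UNIV :: 'a set)" and V: "incseq V"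
    and fund: "\<And>z. fundamental_system z (\<lambda>m. cell_star (V m) z)" and e: "e > 0"
  shows "\<exists>m. \<forall>p q. adjacent (V m) p q \<longrightarrow> dist p q \<le> e"
proof -
  have "\<exists>m. cell_star (V m) z \<subseteq> ball z (e/2)" for z
  proof -
    have "open (ball z (e/2)) \<and> z \<in> ball z (e/2)" using e by simp
    then show ?thesis using fund[of z] unfolding fundamental_system_def by blast
  qed
  then obtain m where m: "\<And>z. cell_star (V (m z)) z \<subseteq> ball z (e/2)" by metis
  have int: "z \<in> interior (cell_star (V (m z)) z)" for z
    using fund[of z] unfolding fundamental_system_def by blast
  obtain Z where Z: "finite Z" "UNIV \<subseteq> (\<Union>z\<in>Z. interior (cell_star (V (m z)) z))"
  proof (rule compactE_image[OF K, of UNIV "\<lambda>z. interior (cell_star (V (m z)) z)"])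
    show "UNIV \<subseteq> (\<Union>z\<in>UNIV. interior (cell_star (V (m z)) z))" using int by blast
  qed (use that in auto)
  define n where "n = Max (m ` Z)"
  have mn: "V (m z) \<subseteq> V n" if "z \<in> Z" for z
  proof (rule incseqD[OF V])
    show "m z \<le> n" unfolding n_def using Z(1) that by simp
  qed
  have "dist p q \<le> e" if pq: "adjacent (V n) p q" for p q
  proof -
    obtain U where U: "U \<in> components (- V n)" "p \<in> closure U" "q \<in> closure U"
      using pq unfolding adjacent_def by blast
    \<comment> \<open>A point of \<open>U\<close> itself avoids \<open>V (m z)\<close> and so
      determines the coarse component that contains it; a point of the closure might not.\<close>
    obtain b where b: "b \<in> U" using in_components_nonempty[OF U(1)] by blast
    obtain z where z: "z \<in> Z" "b \<in> cell_star (V (m z)) z" using Z(2) interior_subset by blast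
    obtain C where C: "C \<in> components (- V (m z))" "z \<in> closure C" "b \<in> closure C"
      using z(2) unfolding cell_star_def by blast
    obtain C' where C': "C' \<in> components (- V (m z))" "U \<subseteq> C'" using component_superset[OF mn[OF z(1)] U(1)] .
    have "b \<in> - V (m z)" using b C' in_components_subset by blast
    then have "b \<in> C" by (rule component_closure_Int[OF C(1,3)])
    then have "C' = C" using component_unique[OF C'(1) C(1)] b C'(2) by blast
    then have "U \<subseteq> cell_star (V (m z)) z"
      using C' C closure_subset[of C] unfolding cell_star_def by blast
    then have "U \<subseteq> cball z (e/2)" using m[of z] by (auto simp: less_imp_le subset_iff)
    then have "closure U \<subseteq> cball z (e/2)" by (intro closure_minimal closed_cball)
    then have "dist z p \<le> e/2" "dist z q \<le> e/2" using U by auto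
    then show ?thesis using dist_triangle[of p q z] by (simp add: dist_commute)
  qed
  then show ?thesis by blast
qed

text \<open>An inverse limit of nonempty finite sets is nonempty (Koenig). The \<open>good\<close>
  elements are those with preimages on every later level.\<close>

lemma inverse_system_thread:
  fixes S :: "nat \<Rightarrow> 'a set" and R :: "nat \<Rightarrow> 'a \<Rightarrow> 'a"
  assumes fin: "\<And>m. finite (S m)" and ne: "\<And>m. S m \<noteq> {}"
    and R_in: "\<And>m n c. \<lbrakk>m \<le> n; c \<in> S n\<rbrakk> \<Longrightarrow> R m c \<in> S m"
    and R_R: "\<And>m n c. m \<le> n \<Longrightarrow> R m (R n c) = R m c"
  shows "\<exists>c. (\<forall>m. c m \<in> S m) \<and> (\<forall>m n. m \<le> n \<longrightarrow> R m (c n) = c m)"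
proof -
  define good where "good m d \<longleftrightarrow> d \<in> S m \<and> (\<forall>n\<ge>m. \<exists>e\<in>S n. R m e = d)" for m d
  have R_id: "R m d = d" if "\<exists>n\<ge>m. \<exists>e\<in>S n. R m e = d" for m d
    using that R_R[of m m] by force
  \<comment> \<open>The predicate lets one pigeonhole argument serve twice: a trivial
    \<open>P\<close> yields the starting element, and \<open>P\<close> saying that the image is a
    given good element yields its lift.\<close>
  have ex: "\<exists>d. good m d \<and> P d"
    if P: "\<And>N. N \<ge> m \<Longrightarrow> \<exists>e\<in>S N. P (R m e)" for m P
  proof (rule ccontr)
    assume neg: "\<not> ?thesis"
    have "\<exists>n\<ge>m. \<forall>e\<in>S n. R m e \<noteq> d" if "d \<in> S m" "P d" for d
      using neg that unfolding good_def by blast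
    then obtain n where n: "\<And>d. \<lbrakk>d \<in> S m; P d\<rbrakk> \<Longrightarrow> n d \<ge> m"
      "\<And>d e. \<lbrakk>d \<in> S m; P d; e \<in> S (n d)\<rbrakk> \<Longrightarrow> R m e \<noteq> d" by metis
    define N where "N = Max (insert m (n ` S m))"
    have Nm: "N \<ge> m" "\<And>d. d \<in> S m \<Longrightarrow> n d \<le> N" unfolding N_def using fin[of m] by auto
    obtain e where e: "e \<in> S N" "P (R m e)" using P[OF Nm(1)] by blast
    let ?d = "R m e"
    have d: "?d \<in> S m" by (rule R_in[OF Nm(1) e(1)])
    have "R (n ?d) e \<in> S (n ?d)" by (rule R_in[OF Nm(2)[OF d] e(1)])
    moreover have "R m (R (n ?d) e) = ?d" by (rule R_R[OF n(1)[OF d e(2)]])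
    ultimately show False using n(2)[OF d e(2)] by blast
  qed
  have "\<exists>d. good 0 d" using ex[of 0 "\<lambda>_. True"] ne by blast
  moreover have "\<exists>d'. good (Suc m) d' \<and> R m d' = d" if d: "good m d" for m d
  proof (rule ex)
    fix N assume "N \<ge> Suc m"
    then obtain e where "e \<in> S N" "R m e = d" using d unfolding good_def by (meson Suc_leD)
    then show "\<exists>e\<in>S N. R m (R (Suc m) e) = d" using R_R[of m "Suc m" e] by auto
  qed
  ultimately obtain c where c: "\<And>m. good m (c m)" "\<And>m. R m (c (Suc m)) = c m"
    using dependent_nat_choice[of good "\<lambda>m d d'. R m d' = d"] by blast
  have "c m \<in> S m" for m using c(1) unfolding good_def by blast
  moreover have "R m (c n) = c m" if "m \<le> n" for m n
    using that
  proof (induction rule: dec_induct)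
    case base
    show ?case by (rule R_id) (use c(1)[of m] in \<open>auto simp: good_def\<close>)
  next
    case (step n)
    then show ?case using R_R[of m n "c (Suc n)"] c(2)[of n] by simp
  qed
  ultimately show ?thesis by blast
qed

section \<open>The common time order of compatible walks\<close>

definition before :: "'a list \<Rightarrow> 'a \<Rightarrow> 'a \<Rightarrow> bool" where
  "before c p q \<longleftrightarrow> (\<exists>i j. i < j \<and> j < length c \<and> c ! i = p \<and> c ! j = q)"

lemma before_iff_append: "before c p q \<longleftrightarrow> (\<exists>a b d. c = a @ p # b @ q # d)"
proof
  assume "before c p q"
  then obtain i j where ij: "i < j" "j < length c" "c ! i = p" "c ! j = q" unfolding before_def by blast
  have "c = take i c @ p # drop (Suc i) c" using ij id_take_nth_drop[of i c] by simp
  moreover have "drop (Suc i) c = take (j - Suc i) (drop (Suc i) c) @ q # drop (Suc j) c"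
    using ij id_take_nth_drop[of "j - Suc i" "drop (Suc i) c"] by simp
  ultimately show "\<exists>a b d. c = a @ p # b @ q # d" by metis
next
  assume "\<exists>a b d. c = a @ p # b @ q # d"
  then obtain a b d where c: "c = a @ p # b @ q # d" by blast
  show "before c p q"
    unfolding before_def c
    by (intro exI[of _ "length a"] exI[of _ "Suc (length a + length b)"]) (auto simp: nth_append)
qed

lemma before_total:
  assumes "p \<in> set c" "q \<in> set c" "p \<noteq> q"
  shows "before c p q \<or> before c q p"
proof -
  obtain i j where "i < length c" "c ! i = p" "j < length c" "c ! j = q"
    using assms by (auto simp: in_set_conv_nth)
  moreover from this have "i < j \<or> j < i" using assms(3) by (cases i j rule: linorder_cases) auto
  ultimately show ?thesis unfolding before_def by blast
qed

lemma before_asym: "distinct c \<Longrightarrow> before c p q \<Longrightarrow> \<not> before c q p"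
  unfolding before_def by (auto simp: nth_eq_iff_index_eq)

lemma before_trans:
  assumes "distinct c" "before c p q" "before c q s"
  shows "before c p s"
proof -
  obtain i j where ij: "i < j" "j < length c" "c ! i = p" "c ! j = q"
    using assms(2) unfolding before_def by blast
  obtain k l where kl: "k < l" "l < length c" "c ! k = q" "c ! l = s"
    using assms(3) unfolding before_def by blast
  have "j = k" using nth_eq_iff_index_eq[OF assms(1), of j k] ij kl by simp
  then show ?thesis unfolding before_def using ij kl less_trans by blast
qed

lemma before_set: "before c p q \<Longrightarrow> p \<in> set c \<and> q \<in> set c"
  unfolding before_def by auto

lemma before_filter:
  assumes "distinct c" "P p" "P q"
  shows "before (filter P c) p q \<longleftrightarrow> before c p q"
proof -
  have to: "before (filter P c) a b" if ab: "before c a b" "P a" "P b" for a b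
  proof -
    obtain u v w where "c = u @ a # v @ b # w" using ab(1) unfolding before_iff_append by blast
    then have "filter P c = filter P u @ a # filter P v @ b # filter P w" using ab by simp
    then show ?thesis unfolding before_iff_append by blast
  qed
  have "before c p q" if b: "before (filter P c) p q"
  proof (rule ccontr)
    assume "\<not> before c p q"
    moreover have "p \<noteq> q" using before_asym[OF distinct_filter[OF assms(1)] b] b by blast
    ultimately have "before c q p" using before_total[of p c q] before_set[OF b] by auto
    then have "before (filter P c) q p" using to assms by blast
    then show False using before_asym[OF distinct_filter[OF assms(1)] b] by blast
  qed
  then show ?thesis using to assms by blast
qed

text \<open>The orders of the single walks unite to one strict order \<open>prec\<close>, which is
  embedded into the reals by a weighted sum of relative ranks over all levels. The level on which a
  point appears makes the embedding strict, and division by \<open>\<tau> y\<close> normalizes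
  it.\<close>

lemma thread_times:
  fixes c :: "nat \<Rightarrow> 'a list"
  assumes dist: "\<And>m. distinct (c m)" and A: "\<And>m. set (c m) \<subseteq> A m"
    and thread: "\<And>m n. m \<le> n \<Longrightarrow> filter (\<lambda>p. p \<in> A m) (c n) = c m"
    and ends: "\<And>m. c m \<noteq> []" "\<And>m. hd (c m) = x" "\<And>m. last (c m) = y" and xy: "x \<noteq> y"
  shows "\<exists>\<tau> :: 'a \<Rightarrow> real. \<tau> x = 0 \<and> \<tau> y = 1 \<and> (\<forall>m. sorted_wrt (\<lambda>p q. \<tau> p < \<tau> q) (c m))"
proof -
  define prec where "prec p q \<longleftrightarrow> (\<exists>n. before (c n) p q)" for p q
  have sub: "set (c m) \<subseteq> set (c n)" if "m \<le> n" for m n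
    unfolding thread[OF that, symmetric] by (rule filter_is_subset)
  have up: "before (c n) p q \<longleftrightarrow> before (c m) p q" if "m \<le> n" "p \<in> set (c m)" "q \<in> set (c m)" for m n p q
  proof -
    have "p \<in> A m" "q \<in> A m" using that(2,3) A[of m] by auto
    then show ?thesis
      using before_filter[OF dist[of n], of "\<lambda>p. p \<in> A m" p q] thread[OF that(1)] by simp
  qed
  have prec_iff: "prec p q \<longleftrightarrow> before (c m) p q" if "p \<in> set (c m)" "q \<in> set (c m)" for m p q
  proof
    assume "prec p q"
    then obtain n where n: "before (c n) p q" unfolding prec_def by blast
    then have "before (c (max m n)) p q" using up[of n "max m n"] before_set[OF n] by simp
    then show "before (c m) p q" using up[of m "max m n"] that by simp
  qed (auto simp: prec_def)
  have prec_trans: "prec p s" if pq: "prec p q" and qs: "prec q s" for p q s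
  proof -
    obtain m n where mn: "before (c m) p q" "before (c n) q s" using pq qs unfolding prec_def by blast
    let ?N = "max m n"
    have "before (c ?N) p q" using up[of m ?N p q] before_set[OF mn(1)] mn(1) by simp
    moreover have "before (c ?N) q s" using up[of n ?N q s] before_set[OF mn(2)] mn(2) by simp
    ultimately show ?thesis using before_trans[OF dist] unfolding prec_def by blast
  qed
  have prec_irrefl: "\<not> prec p p" for p
    unfolding prec_def using before_asym[OF dist] by blast
  have prec_x: "\<not> prec p x" for p
  proof
    assume "prec p x"
    then obtain n i j where ij: "i < j" "j < length (c n)" "c n ! j = x"
      unfolding prec_def before_def by blast
    have "c n ! 0 = x" using ends(1,2)[of n] by (simp add: hd_conv_nth)
    then have "j = 0" using ij ends(1)[of n] nth_eq_iff_index_eq[OF dist, of j n 0] by simp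
    then show False using ij by simp
  qed
  have xin: "x \<in> set (c m)" and yin: "y \<in> set (c m)" for m
    using ends[of m] hd_in_set[of "c m"] last_in_set[of "c m"] by simp_all
  have "before (c 0) x y" using before_total[OF xin yin xy] prec_x unfolding prec_def by blast
  then have prec_xy: "prec x y" unfolding prec_def by blast
  \<comment> \<open>The proportion of points of the walk \<open>c m\<close> that precede
    \<open>p\<close>; \<open>p\<close> itself need not lie on that walk.\<close>
  define frac where "frac m p = real (card {q \<in> set (c m). prec q p}) / real (card (set (c m)))" for m p
  have card_pos: "card (set (c m)) > 0" for m using ends(1)[of m] by (simp add: card_gt_0_iff)
  have frac01: "0 \<le> frac m p" "frac m p \<le> 1" for m p
  proof -
    have "card {q \<in> set (c m). prec q p} \<le> card (set (c m))" by (intro card_mono) auto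
    then show "0 \<le> frac m p" "frac m p \<le> 1" unfolding frac_def using card_pos[of m] by simp_all
  qed
  have frac_le: "frac m p \<le> frac m q" if "prec p q" for m p q
  proof -
    have "{s \<in> set (c m). prec s p} \<subseteq> {s \<in> set (c m). prec s q}"
      using prec_trans[OF _ that] by blast
    then show ?thesis
      unfolding frac_def by (intro divide_right_mono of_nat_mono card_mono) simp_all
  qed
  have frac_less: "frac k p < frac k q" if "prec p q" "p \<in> set (c k)" for k p q
  proof -
    have "{s \<in> set (c k). prec s p} \<subset> {s \<in> set (c k). prec s q}"
      using that prec_trans[OF _ that(1)] prec_irrefl[of p] by blast
    then have "card {s \<in> set (c k). prec s p} < card {s \<in> set (c k). prec s q}"
      by (intro psubset_card_mono) auto
    then show ?thesis unfolding frac_def using card_pos[of k] by (simp add: divide_strict_right_mono)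
  qed
  define \<tau> where "\<tau> p = (\<Sum>m. (1/2)^m * frac m p)" for p
  have summ: "summable (\<lambda>m. (1/2)^m * frac m p)" for p
  proof (rule summable_comparison_test')
    show "summable (\<lambda>m. (1/2)^m :: real)" by (rule summable_geometric) simp
    show "norm ((1/2)^m * frac m p) \<le> (1/2)^m" for m
      using frac01[of m p] by (simp add: abs_mult mult_left_le)
  qed
  have \<tau>_less: "\<tau> p < \<tau> q" if pq: "prec p q" for p q
  proof -
    obtain k where "before (c k) p q" using pq unfolding prec_def by blast
    then have k: "p \<in> set (c k)" using before_set[of "c k" p q] by simp
    have "0 < (\<Sum>m. (1/2)^m * frac m q - (1/2)^m * frac m p)"
    proof (rule suminf_pos2[where i = k])
      show "summable (\<lambda>m. (1/2)^m * frac m q - (1/2)^m * frac m p)" by (intro summable_diff summ)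
      show "0 \<le> (1/2)^m * frac m q - (1/2)^m * frac m p" for m
        using mult_left_mono[OF frac_le[OF pq, of m], of "(1/2)^m"] by simp
      show "0 < (1/2)^k * frac k q - (1/2)^k * frac k p" 
        using mult_strict_left_mono[OF frac_less[OF pq k], of "(1/2)^k"] by simp
    qed
    also have "\<dots> = \<tau> q - \<tau> p" unfolding \<tau>_def by (rule suminf_diff[OF summ summ, symmetric])
    finally show ?thesis by simp
  qed
  have "frac m x = 0" for m unfolding frac_def using prec_x by simp
  then have \<tau>x: "\<tau> x = 0" unfolding \<tau>_def by simp
  have \<tau>y: "0 < \<tau> y" using \<tau>_less[OF prec_xy] \<tau>x by simp
  show ?thesis
  proof (intro exI[of _ "\<lambda>p. \<tau> p / \<tau> y"] conjI allI)
    show "sorted_wrt (\<lambda>p q. \<tau> p / \<tau> y < \<tau> q / \<tau> y) (c m)" for m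
      unfolding sorted_wrt_iff_nth_less
    proof (intro allI impI)
      fix i j assume ij: "i < j" "j < length (c m)"
      then have "before (c m) (c m ! i) (c m ! j)" unfolding before_def by blast
      then have "prec (c m ! i) (c m ! j)" unfolding prec_def by blast
      then show "\<tau> (c m ! i) / \<tau> y < \<tau> (c m ! j) / \<tau> y" using \<tau>_less \<tau>y by (simp add: divide_strict_right_mono)
    qed
  qed (use \<tau>x \<tau>y in auto)
qed

text \<open>Times increase strictly along the list, so two points with no list element between them
  in time are consecutive entries.\<close>

lemma sorted_successively_neighbours:
  fixes \<tau> :: "'a \<Rightarrow> real"
  assumes s: "sorted_wrt (\<lambda>p q. \<tau> p < \<tau> q) l" and R: "successively R l"
    and pq: "p \<in> set l" "q \<in> set l" "\<tau> p < \<tau> q" and no: "\<And>z. z \<in> set l \<Longrightarrow> \<tau> p < \<tau> z \<Longrightarrow> \<tau> q \<le> \<tau> z"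
  shows "R p q"
proof -
  obtain i j where i: "i < length l" "l ! i = p" and j: "j < length l" "l ! j = q"
    using pq by (auto simp: in_set_conv_nth)
  have mono: "\<tau> (l ! a) < \<tau> (l ! b)" if "a < b" "b < length l" for a b
    using s that unfolding sorted_wrt_iff_nth_less by blast
  have "i < j"
  proof (rule ccontr)
    assume "\<not> i < j"
    then show False using mono[of j i] i j pq(3) by (cases "i = j") auto
  qed
  moreover have "\<not> Suc i < j"
  proof
    assume a: "Suc i < j"
    then have "\<tau> p < \<tau> (l ! Suc i)" "\<tau> (l ! Suc i) < \<tau> q"
      using mono[of i "Suc i"] mono[of "Suc i" j] i j by auto
    then show False using no[of "l ! Suc i"] a j(1) by simp
  qed
  ultimately have "j = Suc i" by simp
  then show ?thesis using R i j unfolding successively_conv_nth by blast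
qed

section \<open>The limit curve\<close>

text \<open>The step functions \<open>g m\<close> traverse the walk of level \<open>m\<close> at the
  times \<open>\<tau>\<close>. Their values at one time on finer levels, or at nearby times on one
  level, are equal or adjacent for \<open>V m\<close>; a small mesh thus gives uniform convergence
  and a continuous limit. Each partition sum of the limit is a limit of sums bounded by walk
  lengths.\<close>

lemma path_of_thread:
  fixes h :: "'a::metric_space \<Rightarrow> real ^ 'n" and V A :: "nat \<Rightarrow> 'a set" and c :: "nat \<Rightarrow> 'a list"
  assumes K: "compact (UNIV :: 'a set)" and h: "continuous_on UNIV h"
    and V: "\<And>m n. m \<le> n \<Longrightarrow> V m \<subseteq> V n" "\<And>m. V m \<subseteq> A m" "\<And>m. x \<in> A m" "\<And>m. y \<in> A m"
    and mesh: "\<And>e. e > 0 \<Longrightarrow> \<exists>m. \<forall>p q. adjacent (V m) p q \<longrightarrow> dist p q \<le> e"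
    and c: "\<And>m. c m \<in> walks (V m) (A m) x y"
    and thread: "\<And>m n. m \<le> n \<Longrightarrow> filter (\<lambda>p. p \<in> A m) (c n) = c m"
    and r: "\<And>m. walk_length (\<lambda>p q. norm (h p - h q)) (c m) \<le> r"
    and \<tau>: "\<tau> x = 0" "\<tau> y = (1::real)" "\<And>m. sorted_wrt (\<lambda>p q. \<tau> p < \<tau> q) (c m)"
  shows "\<exists>\<gamma>. path \<gamma> \<and> pathstart \<gamma> = x \<and> pathfinish \<gamma> = y \<and> curve_length h 0 1 \<gamma> \<le> ereal r"
proof -
  have ne: "c m \<noteq> []" "hd (c m) = x" "last (c m) = y" "set (c m) \<subseteq> A m" "successively (adjacent (V m)) (c m)" for m
    using c[of m] unfolding walks_def by simp_all
  have c0: "c m ! 0 = x" for m using ne(1,2)[of m] by (simp add: hd_conv_nth)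
  have mono: "\<tau> (c m ! i) < \<tau> (c m ! j)" if "i < j" "j < length (c m)" for m i j
    using \<tau>(3)[of m] that unfolding sorted_wrt_iff_nth_less by blast
  have inj: "p = q" if p: "p \<in> set (c m)" and q: "q \<in> set (c m)" and eq: "\<tau> p = \<tau> q" for m p q
  proof -
    obtain i where i: "i < length (c m)" "c m ! i = p" using p unfolding in_set_conv_nth by blast
    obtain j where j: "j < length (c m)" "c m ! j = q" using q unfolding in_set_conv_nth by blast
    have "i = j"
    proof (cases i j rule: linorder_cases)
      case less
      then show ?thesis using mono[OF less j(1)] i(2) j(2) eq by simp
    next
      case greater
      then show ?thesis using mono[OF greater i(1)] i(2) j(2) eq by simp
    qed
    then show ?thesis using i(2) j(2) by simp
  qed
  \<comment> \<open>The index of the last point of the walk that is visited by time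
    \<open>t\<close>.\<close>
  define N where "N m t = Max {i. i < length (c m) \<and> \<tau> (c m ! i) \<le> t}" for m t
  define g where "g m t = c m ! N m t" for m t
  have finN: "finite {i. i < length (c m) \<and> \<tau> (c m ! i) \<le> t}" for m t by simp
  have N: "N m t < length (c m)" "\<tau> (g m t) \<le> t"
    "\<And>i. \<lbrakk>i < length (c m); \<tau> (c m ! i) \<le> t\<rbrakk> \<Longrightarrow> i \<le> N m t" if t: "t \<ge> 0" for m t
  proof -
    have "0 \<in> {i. i < length (c m) \<and> \<tau> (c m ! i) \<le> t}" using t c0[of m] ne(1)[of m] \<tau>(1) by simp
    then have "N m t \<in> {i. i < length (c m) \<and> \<tau> (c m ! i) \<le> t}"
      unfolding N_def by (intro Max_in[OF finN]) blast
    then show "N m t < length (c m)" "\<tau> (g m t) \<le> t" unfolding g_def by simp_all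
    show "i \<le> N m t" if "i < length (c m)" "\<tau> (c m ! i) \<le> t" for i
      unfolding N_def using that by (intro Max_ge[OF finN]) simp
  qed
  have g_in: "g m t \<in> set (c m)" if "t \<ge> 0" for m t unfolding g_def using N(1)[OF that] by simp
  have g_max: "\<tau> z \<le> \<tau> (g m t)" if t: "t \<ge> 0" and z: "z \<in> set (c m)" "\<tau> z \<le> t" for m t z
  proof -
    obtain i where i: "i < length (c m)" "c m ! i = z" using z(1) unfolding in_set_conv_nth by blast
    then have "i \<le> N m t" using N(3)[OF t] z(2) by simp
    show ?thesis
    proof (cases "i = N m t")
      case True
      then show ?thesis using i(2) unfolding g_def by simp
    next
      case False
      then have "\<tau> (c m ! i) < \<tau> (c m ! N m t)"
        using \<open>i \<le> N m t\<close> N(1)[OF t, of m] by (intro mono) simp_all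
      then show ?thesis using i(2) unfolding g_def by simp
    qed
  qed
  have sub: "set (c m) \<subseteq> set (c n)" if "m \<le> n" for m n
    unfolding thread[OF that, symmetric] by (rule filter_is_subset)
  \<comment> \<open>The fine walk is filtered to \<open>A m\<close> together with the single extra
    point \<open>g n t\<close>. In this walk for the coarse \<open>V m\<close> nothing lies between
    \<open>g m t\<close> and \<open>g n t\<close> in time, so the two are neighbours.\<close>
  have levels: "g m t = g n t \<or> adjacent (V m) (g m t) (g n t)" if mn: "m \<le> n" and t: "t \<ge> 0" for m n t
  proof (cases "g m t = g n t")
    case False
    let ?p = "g m t" and ?q = "g n t"
    have p: "?p \<in> set (c n)" "?p \<in> A m" using g_in[OF t, of m] sub[OF mn] ne(4)[of m] by blast+
    have q: "?q \<in> set (c n)" by (rule g_in[OF t])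
    have "\<tau> ?p \<le> \<tau> ?q" by (rule g_max[OF t p(1) N(2)[OF t]])
    moreover have "\<tau> ?p \<noteq> \<tau> ?q" using inj[OF p(1) q] False by blast
    ultimately have less: "\<tau> ?p < \<tau> ?q" by simp
    let ?l = "filter (\<lambda>p. p \<in> insert ?q (A m)) (c n)"
    have "?l \<in> walks (V m) (insert ?q (A m)) x y"
      using V(2-4)[of m] by (intro walks_filter[OF c V(1)[OF mn]]) blast+
    then have succ: "successively (adjacent (V m)) ?l" unfolding walks_def by blast
    have sort: "sorted_wrt (\<lambda>p q. \<tau> p < \<tau> q) ?l" by (intro sorted_wrt_filter \<tau>)
    have no: "\<tau> ?q \<le> \<tau> z" if z: "z \<in> set ?l" "\<tau> ?p < \<tau> z" for z
    proof (rule ccontr)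
      assume "\<not> \<tau> ?q \<le> \<tau> z"
      then have zq: "\<tau> z < \<tau> ?q" by simp
      then have "z \<noteq> ?q" by blast
      then have "z \<in> set (filter (\<lambda>p. p \<in> A m) (c n))" using z(1) by simp
      then have zm: "z \<in> set (c m)" unfolding thread[OF mn] .
      have "\<tau> z \<le> t" using zq N(2)[OF t, of n] by linarith
      then have "\<tau> z \<le> \<tau> ?p" by (rule g_max[OF t zm])
      then show False using z(2) by simp
    qed
    have mem: "?p \<in> set ?l" "?q \<in> set ?l" using p q by simp_all
    have "adjacent (V m) ?p ?q"
      by (rule sorted_successively_neighbours[OF sort succ mem less no])
    then show ?thesis by blast
  qed simp
  \<comment> \<open>\<open>\<delta>\<close> is at most the smallest gap between visiting times on
    level \<open>m\<close>, so at most one new point is reached within it; the inserted 1 keeps the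
    minimum over a nonempty set.\<close>
  have times: "\<exists>\<delta>>0. \<forall>s t. 0 \<le> s \<longrightarrow> s \<le> t \<longrightarrow> t < s + \<delta> \<longrightarrow> g m s = g m t \<or> adjacent (V m) (g m s) (g m t)" for m
  proof -
    define G where "G = insert 1 ((\<lambda>(p, q). \<tau> q - \<tau> p) ` {(p, q). p \<in> set (c m) \<and> q \<in> set (c m) \<and> \<tau> p < \<tau> q})"
    have "finite {(p, q). p \<in> set (c m) \<and> q \<in> set (c m) \<and> \<tau> p < \<tau> q}"
      by (rule finite_subset[of _ "set (c m) \<times> set (c m)"]) auto
    then have finG: "finite G" unfolding G_def by simp
    define \<delta> where "\<delta> = Min G"
    have "\<delta> \<in> G" unfolding \<delta>_def by (rule Min_in[OF finG]) (simp add: G_def)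
    then have \<delta>: "\<delta> > 0" unfolding G_def by auto
    have gap: "\<delta> \<le> \<tau> q - \<tau> p" if "p \<in> set (c m)" "q \<in> set (c m)" "\<tau> p < \<tau> q" for p q
      unfolding \<delta>_def using that by (intro Min_le[OF finG]) (auto simp: G_def)
    have "g m s = g m t \<or> adjacent (V m) (g m s) (g m t)" if st: "0 \<le> s" "s \<le> t" "t < s + \<delta>" for s t
    proof (cases "g m s = g m t")
      case False
      have t: "0 \<le> t" using st by simp
      note gs = g_in[OF st(1), of m] and gt = g_in[OF t, of m]
      have "\<tau> (g m s) \<le> t" using N(2)[OF st(1), of m] st(2) by linarith
      then have "\<tau> (g m s) \<le> \<tau> (g m t)" by (rule g_max[OF t gs])
      moreover have "\<tau> (g m s) \<noteq> \<tau> (g m t)" using inj[OF gs gt] False by blast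
      ultimately have less: "\<tau> (g m s) < \<tau> (g m t)" by simp
      have "\<tau> (g m t) \<le> \<tau> z" if z: "z \<in> set (c m)" "\<tau> (g m s) < \<tau> z" for z
      proof (rule ccontr)
        assume "\<not> \<tau> (g m t) \<le> \<tau> z"
        then have "\<tau> z < \<tau> (g m t)" by simp
        then have "\<delta> \<le> \<tau> (g m t) - \<tau> z" by (rule gap[OF z(1) gt])
        moreover have "s < \<tau> z"
        proof (rule ccontr)
          assume "\<not> s < \<tau> z"
          then have "\<tau> z \<le> \<tau> (g m s)" by (intro g_max[OF st(1) z(1)]) simp
          then show False using z(2) by simp
        qed
        ultimately show False using N(2)[OF t, of m] st(3) by linarith
      qed
      then have "adjacent (V m) (g m s) (g m t)"
        by (rule sorted_successively_neighbours[OF \<tau>(3) ne(5) gs gt less])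
      then show ?thesis by blast
    qed simp
    then show ?thesis using \<delta> by blast
  qed
  have conv: "convergent (\<lambda>n. g n t)" if t: "t \<ge> 0" for t
  proof -
    have "Cauchy (\<lambda>n. g n t)"
    proof (rule metric_CauchyI)
      fix e :: real assume e: "e > 0"
      obtain m where m: "\<And>p q. adjacent (V m) p q \<Longrightarrow> dist p q \<le> e/3" using mesh[of "e/3"] e by auto
      have d: "dist (g m t) (g n t) \<le> e/3" if "n \<ge> m" for n
        using levels[OF that t]
      proof
        assume "g m t = g n t"
        then show ?thesis using e by simp
      qed (rule m)
      have "dist (g a t) (g b t) < e" if "a \<ge> m" "b \<ge> m" for a b
        using d[OF that(1)] d[OF that(2)] dist_triangle3[of "g a t" "g b t" "g m t"] e by linarith
      then show "\<exists>M. \<forall>a\<ge>M. \<forall>b\<ge>M. dist (g a t) (g b t) < e" by blast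
    qed
    then show ?thesis
      using compact_imp_complete[OF K] unfolding complete_def convergent_def by blast
  qed
  define \<gamma> where "\<gamma> t = lim (\<lambda>n. g n t)" for t
  have \<gamma>: "(\<lambda>n. g n t) \<longlonglongrightarrow> \<gamma> t" if "t \<ge> 0" for t
    using conv[OF that] unfolding \<gamma>_def convergent_LIMSEQ_iff .
  have close: "dist (g m t) (\<gamma> t) \<le> e"
    if m: "\<And>p q. adjacent (V m) p q \<Longrightarrow> dist p q \<le> e" and e: "e > 0" and t: "t \<ge> 0" for m e t
  proof (rule LIMSEQ_le_const2)
    show "(\<lambda>n. dist (g m t) (g n t)) \<longlonglongrightarrow> dist (g m t) (\<gamma> t)" by (intro tendsto_intros \<gamma> t)
    have "dist (g m t) (g n t) \<le> e" if "n \<ge> m" for n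
      using levels[OF that t]
    proof
      assume "g m t = g n t"
      then show ?thesis using e by simp
    qed (rule m)
    then show "\<exists>M. \<forall>n\<ge>M. dist (g m t) (g n t) \<le> e" by blast
  qed
  have "path \<gamma>"
    unfolding path_def continuous_on_iff
  proof (intro ballI allI impI)
    fix s e :: real assume s: "s \<in> {0..1}" and e: "e > 0"
    \<comment> \<open>Three errors of size \<open>e/4\<close> occur: the passage from step function
      to limit at each of the two times, and one step of the walk.\<close>
    obtain m where m: "\<And>p q. adjacent (V m) p q \<Longrightarrow> dist p q \<le> e/4" using mesh[of "e/4"] e by auto
    obtain \<delta> where \<delta>: "\<delta> > 0" "\<And>s t. \<lbrakk>0 \<le> s; s \<le> t; t < s + \<delta>\<rbrakk> \<Longrightarrow> g m s = g m t \<or> adjacent (V m) (g m s) (g m t)"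
      using times[of m] by blast
    have near: "dist (g m a) (g m b) \<le> e/4" if "0 \<le> a" "a \<le> b" "b < a + \<delta>" for a b
      using \<delta>(2)[OF that]
    proof
      assume "g m a = g m b"
      then show ?thesis using e by simp
    qed (rule m)
    have "dist (\<gamma> t) (\<gamma> s) < e" if t: "t \<in> {0..1}" "dist t s < \<delta>" for t
    proof -
      have "dist (g m t) (g m s) \<le> e/4"
        using near[of t s] near[of s t] s t by (cases "t \<le> s") (auto simp: dist_real_def dist_commute)
      moreover have "dist (g m t) (\<gamma> t) \<le> e/4" "dist (g m s) (\<gamma> s) \<le> e/4"
        using close[OF m, where t = t] close[OF m, where t = s] e s t by auto
      ultimately show ?thesis
        using dist_triangle[of "\<gamma> t" "\<gamma> s" "g m t"] dist_triangle[of "g m t" "\<gamma> s" "g m s"] e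
        by (simp add: dist_commute)
    qed
    then show "\<exists>d>0. \<forall>t\<in>{0..1}. dist t s < d \<longrightarrow> dist (\<gamma> t) (\<gamma> s) < e" using \<delta>(1) by blast
  qed
  moreover have "pathstart \<gamma> = x"
  proof -
    have x: "x \<in> set (c m)" for m using ne(1,2)[of m] hd_in_set[of "c m"] by simp
    have "g m 0 = x" for m
    proof (rule inj[OF g_in x])
      show "\<tau> (g m 0) = \<tau> x"
        using g_max[OF order_refl x, of m] N(2)[OF order_refl, of m] \<tau>(1) by simp
    qed simp
    then have "(\<lambda>n. g n 0) \<longlonglongrightarrow> x" by simp
    then show ?thesis unfolding pathstart_def using \<gamma>[of 0] LIMSEQ_unique by blast
  qed
  moreover have "pathfinish \<gamma> = y"
  proof -
    have y: "y \<in> set (c m)" for m using ne(1,3)[of m] last_in_set[of "c m"] by simp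
    have "g m 1 = y" for m
    proof (rule inj[OF g_in y])
      show "\<tau> (g m 1) = \<tau> y"
        using g_max[OF zero_le_one y, of m] N(2)[OF zero_le_one, of m] \<tau>(2) by simp
    qed simp
    then have "(\<lambda>n. g n 1) \<longlonglongrightarrow> y" by simp
    then show ?thesis unfolding pathfinish_def using \<gamma>[of 1] LIMSEQ_unique by fastforce
  qed
  moreover have "curve_length h 0 1 \<gamma> \<le> ereal r"
    unfolding curve_length_def
  proof (rule Sup_least, clarify)
    fix n :: nat and s :: "nat \<Rightarrow> real"
    assume s: "n \<ge> 1" "s 0 = 0" "s n = 1" "\<forall>i\<in>{1..n}. s (i - 1) < s i"
    have step: "s k < s (Suc k)" if "k < n" for k using s(4) that by force
    have pos: "0 \<le> s k" if "k \<le> n" for k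
      using that
    proof (induction k)
      case (Suc k)
      then show ?case using step[of k] by simp
    qed (simp add: s)
    have ht: "(\<lambda>m. h (g m t)) \<longlonglongrightarrow> h (\<gamma> t)" if "t \<ge> 0" for t
      using continuous_on_tendsto_compose[OF h \<gamma>[OF that]] by simp
    have "(\<lambda>m. \<Sum>k<n. norm (h (g m (s k)) - h (g m (s (Suc k)))))
        \<longlonglongrightarrow> (\<Sum>k<n. norm (h (\<gamma> (s k)) - h (\<gamma> (s (Suc k)))))"
      by (intro tendsto_intros ht pos) auto
    moreover have "(\<Sum>k<n. norm (h (g m (s k)) - h (g m (s (Suc k))))) \<le> r" for m
    proof -
      have "(\<Sum>k<n. norm (h (c m ! N m (s k)) - h (c m ! N m (s (Suc k)))))
          \<le> walk_length (\<lambda>p q. norm (h p - h q)) (c m)"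
      proof (rule sum_consecutive_le)
        show "norm (h a - h d) \<le> norm (h a - h b) + norm (h b - h d)" for a b d
          using norm_triangle_ineq[of "h a - h b" "h b - h d"] by simp
        show "N m (s k) < length (c m)" if "k \<le> n" for k by (rule N(1)[OF pos[OF that]])
        show "N m (s k) \<le> N m (s (Suc k))" if "k < n" for k
          using N(1,2)[OF pos, of k m] step[OF that] that
          by (intro N(3) pos) (auto simp: g_def)
      qed auto
      then show ?thesis using r[of m] unfolding g_def by simp
    qed
    ultimately have "(\<Sum>k<n. norm (h (\<gamma> (s k)) - h (\<gamma> (s (Suc k))))) \<le> r"
      by (intro LIMSEQ_le_const2) auto
    then show "ereal (\<Sum>i=1..n. norm (h (\<gamma> (s i)) - h (\<gamma> (s (i - 1))))) \<le> ereal r"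
      by (simp add: sum.atLeast1_atMost_eq norm_minus_commute)
  qed
  ultimately show ?thesis by blast
qed

text \<open>Distinct walks on a finite vertex set form a finite set, and deleting vertices maps
  short walks to short walks of the coarser level. These are the data of an inverse system, whose
  thread is a compatible family of walks.\<close>

lemma geodesic_dist_le:
  fixes h :: "'a::metric_space \<Rightarrow> real ^ 'n"
  assumes K: "compact (UNIV :: 'a set)" and h: "continuous_on UNIV h"
    and V: "incseq V" "\<And>m. finite (V m)"
    and fund: "\<And>z. fundamental_system z (\<lambda>m. cell_star (V m) z)"
    and xy: "x \<noteq> y"
    and short: "\<And>m. \<exists>c\<in>walks (V m) (V m \<union> {x, y}) x y. distinct c
      \<and> walk_length (\<lambda>p q. norm (h p - h q)) c \<le> r"
  shows "geodesic_dist h x y \<le> ereal r"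
proof -
  let ?w = "\<lambda>p q. norm (h p - h q)"
  define A where "A m = V m \<union> {x, y}" for m
  define S where "S m = {c \<in> walks (V m) (A m) x y. distinct c \<and> walk_length ?w c \<le> r}" for m
  have Vmono: "V m \<subseteq> V n" if "m \<le> n" for m n using incseqD[OF V(1) that] .
  have fin: "finite (S m)" for m
  proof (rule finite_subset)
    show "S m \<subseteq> {c. set c \<subseteq> A m \<and> distinct c}" unfolding S_def walks_def by blast
    show "finite {c. set c \<subseteq> A m \<and> distinct c}"
      by (rule finite_subset_distinct) (simp add: A_def V)
  qed
  have ne: "S m \<noteq> {}" for m using short[of m] unfolding S_def A_def by blast
  have R_in: "filter (\<lambda>p. p \<in> A m) c \<in> S m" if mn: "m \<le> n" and c: "c \<in> S n" for m n c
  proof -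
    have cw: "c \<in> walks (V n) (A n) x y" using c unfolding S_def by blast
    have "filter (\<lambda>p. p \<in> A m) c \<in> walks (V m) (A m) x y"
      by (rule walks_filter[OF cw Vmono[OF mn]]) (auto simp: A_def)
    moreover have "walk_length ?w (filter (\<lambda>p. p \<in> A m) c) \<le> walk_length ?w c"
    proof -
      obtain d where d: "c = x # d" using cw unfolding walks_def by (cases c) auto
      have "norm (h a - h d) \<le> norm (h a - h b) + norm (h b - h d)" for a b d
        using norm_triangle_ineq[of "h a - h b" "h b - h d"] by simp
      then have "walk_length ?w (x # filter (\<lambda>p. p \<in> A m) d) \<le> walk_length ?w (x # d)"
        by (intro walk_length_filter norm_ge_zero)
      then show ?thesis unfolding d by (simp add: A_def)
    qed
    ultimately show ?thesis using c unfolding S_def by (simp add: order_trans)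
  qed
  have R_R: "filter (\<lambda>p. p \<in> A m) (filter (\<lambda>p. p \<in> A n) c) = filter (\<lambda>p. p \<in> A m) c"
    if "m \<le> n" for m n c
  proof -
    have "A m \<subseteq> A n" using Vmono[OF that] unfolding A_def by blast
    then show ?thesis unfolding filter_filter by (intro filter_cong) blast+
  qed
  have "\<exists>c. (\<forall>m. c m \<in> S m) \<and> (\<forall>m n. m \<le> n \<longrightarrow> filter (\<lambda>p. p \<in> A m) (c n) = c m)"
  proof (rule inverse_system_thread)
    show "filter (\<lambda>p. p \<in> A m) c \<in> S m" if "m \<le> n" "c \<in> S n" for m n c by (rule R_in[OF that])
    show "filter (\<lambda>p. p \<in> A m) (filter (\<lambda>p. p \<in> A n) c) = filter (\<lambda>p. p \<in> A m) c"
      if "m \<le> n" for m n c by (rule R_R[OF that])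
  qed (rule fin, rule ne)
  then obtain c where c: "\<And>m. c m \<in> S m"
    and thread: "\<And>m n. m \<le> n \<Longrightarrow> filter (\<lambda>p. p \<in> A m) (c n) = c m" by blast
  have cw: "c m \<in> walks (V m) (A m) x y" "distinct (c m)" "walk_length ?w (c m) \<le> r" for m
    using c[of m] unfolding S_def by auto
  have "\<exists>\<tau> :: 'a \<Rightarrow> real. \<tau> x = 0 \<and> \<tau> y = 1 \<and> (\<forall>m. sorted_wrt (\<lambda>p q. \<tau> p < \<tau> q) (c m))"
  proof (rule thread_times[of c A x y])
    show "set (c m) \<subseteq> A m" "c m \<noteq> []" "hd (c m) = x" "last (c m) = y" for m
      using cw(1)[of m] unfolding walks_def by simp_all
    show "filter (\<lambda>p. p \<in> A m) (c n) = c m" if "m \<le> n" for m n by (rule thread[OF that])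
  qed (rule cw(2), rule xy)
  then obtain \<tau> :: "'a \<Rightarrow> real" where \<tau>: "\<tau> x = 0" "\<tau> y = 1"
    "\<And>m. sorted_wrt (\<lambda>p q. \<tau> p < \<tau> q) (c m)" by blast
  have "\<exists>\<gamma>. path \<gamma> \<and> pathstart \<gamma> = x \<and> pathfinish \<gamma> = y \<and> curve_length h 0 1 \<gamma> \<le> ereal r"
  proof (rule path_of_thread[where V = V and A = A and c = c and \<tau> = \<tau>])
    show "V m \<subseteq> V n" if "m \<le> n" for m n by (rule Vmono[OF that])
    show "V m \<subseteq> A m" "x \<in> A m" "y \<in> A m" for m by (auto simp: A_def)
    show "\<exists>m. \<forall>p q. adjacent (V m) p q \<longrightarrow> dist p q \<le> e" if "e > 0" for e
      by (rule mesh_tendsto_zero[OF K V(1) fund that])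
    show "filter (\<lambda>p. p \<in> A m) (c n) = c m" if "m \<le> n" for m n by (rule thread[OF that])
  qed (rule K h cw(1) cw(3) \<tau>)+
  then obtain \<gamma> where \<gamma>: "path \<gamma>" "pathstart \<gamma> = x" "pathfinish \<gamma> = y" "curve_length h 0 1 \<gamma> \<le> ereal r"
    by blast
  have "geodesic_dist h x y \<le> curve_length h 0 1 \<gamma>"
    unfolding geodesic_dist_def using \<gamma> by (intro Inf_lower) blast
  then show ?thesis using \<gamma>(4) by (rule order_trans)
qed

text \<open>The diagonal is treated apart by a constant curve, because visiting times 0 and 1
  presuppose two different endpoints.\<close>

lemma geodesic_dist_refl_le:
  fixes h :: "'a::metric_space \<Rightarrow> real ^ 'n"
  shows "geodesic_dist h x x \<le> 0"
proof -
  have "curve_length h 0 1 (\<lambda>_. x) \<le> 0"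
    unfolding curve_length_def by (rule Sup_least) auto
  moreover have "geodesic_dist h x x \<le> curve_length h 0 1 (\<lambda>_. x)"
    unfolding geodesic_dist_def
    by (intro Inf_lower) (auto simp: path_def pathstart_def pathfinish_def)
  ultimately show ?thesis by (rule order_trans[rotated])
qed

theorem theorem2p2:
  fixes M :: "'a::metric_space measure"
    and E :: "('a \<Rightarrow> real) \<Rightarrow> ('a \<Rightarrow> real) \<Rightarrow> real"
    and F :: "('a \<Rightarrow> real) set"
    and h :: "'a \<Rightarrow> real ^ 'n"
    and x y :: 'a
  assumes compact_K: "compact (UNIV :: 'a set)"
    and borel_M: "sets M = sets borel"
    and finite_M: "finite_measure M"
    and support_M: "full_support M"
    and form: "dirichlet_form M E F"
    and regular: "regular_form M E F"
    and local: "strong_local M E F"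
    and h: "\<And>j. (\<lambda>z. h z $ j) \<in> F" "\<And>j. continuous_on UNIV (\<lambda>z. h z $ j)"
    and A1: "\<exists>V :: nat \<Rightarrow> 'a set. incseq V \<and>
      (\<forall>m. finite (V m) \<and> V m \<noteq> {} \<and> finite (components (- V m))) \<and>
      (\<forall>z. fundamental_system z (\<lambda>m. cell_star (V m) z))"
    and A2: "\<forall>f\<in>F. \<exists>g. continuous_on UNIV g \<and> (AE z in M. f z = g z)"
    and A3: "\<forall>f\<in>F. E f f = 0 \<longleftrightarrow> (\<exists>c. AE z in M. f z = c)"
  shows "geodesic_dist h x y \<le> intrinsic_dist M E F h x y"
proof -
  interpret strongly_local_form M E F
    by (rule strongly_local_form.intro[OF form
          strongly_local_form_axioms.intro[OF compact_K borel_M finite_M regular local]])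
  have hD: "(\<lambda>z. h z $ j) \<in> D" for j using h unfolding D_def by simp
  have hc: "continuous_on UNIV h"
  proof -
    have "continuous_on UNIV (\<lambda>z. \<chi> j. h z $ j)" by (intro continuous_on_vec_lambda h)
    then show ?thesis by simp
  qed
  have nonneg: "0 \<le> intrinsic_dist M E F h x y"
  proof -
    have "ereal ((\<lambda>z. 0) y - (\<lambda>z. 0) x) \<le> intrinsic_dist M E F h x y"
      by (rule locally_lipschitz_le_intrinsic_dist[OF hD])
         (intro exI[of _ UNIV] exI[of _ "\<lambda>z. 0 :: real"], auto)
    then show ?thesis by (simp add: zero_ereal_def)
  qed
  obtain V :: "nat \<Rightarrow> 'a set" where V: "incseq V" "\<And>m. finite (V m)" "\<And>m. finite (components (- V m))"
    "\<And>z. fundamental_system z (\<lambda>m. cell_star (V m) z)"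
    using A1 by blast
  show ?thesis
  proof (cases "x = y")
    case True
    then show ?thesis using geodesic_dist_refl_le[of h x] nonneg by auto
  next
    case False
    show ?thesis
    \<comment> \<open>A bound strictly above the intrinsic distance provides the slack for the
      shortened edges. Only real bounds carry content, and an infinite intrinsic distance admits
      none.\<close>
    proof (rule dense_ge)
      fix s assume s: "intrinsic_dist M E F h x y < s"
      show "geodesic_dist h x y \<le> s"
      proof (cases s)
        case (real r)
        then show ?thesis
          using geodesic_dist_le[OF compact_K hc V(1,2,4) False, of r]
            short_walk_exists[OF hD V(2,3)] s by blast
      qed (use s in auto)
    qed
  qed
qed

end
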